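(* Let $n\ge 2$ and $A:=\{y'\in\mathbb{R}^{n-1} : 3<|y'|<4\sqrt{n},\ -4<y_i<-3 \text{ for } i=1,\dots,n-1\}$. Let the boundary data $g=(g_1,\dots,g_n):\mathbb{R}^{n-1}\times\mathbb{R}\to\mathbb{R}^n$ be of the form $g_j(y',s)=a_j\,g_j^{\mathcal S}(y')\,g_j^{\mathcal T}(s)$ for $j=1,\dots,n$, where $a_j\in\mathbb{R}$, $g_j^{\mathcal S}\ge 0$, $g_j^{\mathcal T}\ge 0$, $\operatorname{supp}(g_j^{\mathcal S})\subset A$, $\operatorname{supp}(g_j^{\mathcal T})\subset(\tfrac34,\tfrac78)$, and $$g_j^{\mathcal S}\in L^1(\mathbb{R}^{n-1}),\qquad g_j^{\mathcal T}\in C_c^\infty(\mathbb{R}),\qquad j=1,\dots,n.$$ Let $u$ be the solution of the Stokes system in $\mathbb{R}^n_+\times(0,\infty)$ with zero initial data and boundary data $g$, defined by the Golovkin representation formula, and let $p$ be the associated pressure. Then $u,p\in C^\infty(Q_1^+)$.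
   Context: Notation: $x=(x',x_n)$, $\mathbb{R}^n_+=\{x\in\mathbb{R}^n : x_n>0\}$, $\Sigma=\mathbb{R}^{n-1}$; a point $y'\in\Sigma$ is identified with $(y',0)\in\mathbb{R}^n$. $B_r^+=\{x\in\mathbb{R}^n:|x|<r,\ x_n>0\}$ and $Q_1^+=B_1^+\times(0,1)$. Stokes system: $\partial_t u-\Delta u+\nabla p=0$, $\operatorname{div}u=0$ in $\mathbb{R}^n_+\times(0,\infty)$, $u|_{t=0}=0$, $u|_{x_n=0}=g$. Kernels: $\Gamma(x,t)=(4\pi t)^{-n/2}e^{-|x|^2/(4t)}$ for $t>0$ and $\Gamma(x,t)=0$ for $t\le0$; $E(x)=\frac{1}{n(n-2)|B_1|}|x|^{2-n}$ for $n\ge3$ and $E(x)=-\frac1{2\pi}\log|x|$ for $n=2$ ($|B_1|$ is the volume of the unit ball of $\mathbb{R}^n$); $$C_i(x,t)=\int_0^{x_n}\int_\Sigma \partial_n\Gamma(x-z,t)\,\partial_iE(z)\,dz'\,dz_n,\qquad \mathcal{A}(x,t)=\int_\Sigma\Gamma(z',0,t)\,E(x-z')\,dz'.$$ Golovkin tensor and representation formula: with $\delta_{ij}$ the Kronecker delta and $\delta(t)$ the Dirac delta in time, $$K_{ij}(x,t)=-2\delta_{ij}\partial_n\Gamma(x,t)-4\partial_jC_i(x,t)-2\delta_{nj}\,\partial_iE(x)\,\delta(t),\qquad u_i(x,t)=\sum_{j=1}^n\int_{-\infty}^\infty\int_\Sigma K_{ij}(x-y',t-s)\,g_j(y',s)\,dy'\,ds,$$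 where $g_j(y',s)=0$ for $s<0$. The term containing $\delta(t)$ contributes $-2\int_\Sigma\partial_iE(x-y')g_n(y',t)\,dy'$. Associated pressure: $$p(x,t)=2\sum_{i=1}^n\partial_i\partial_n\int_\Sigma E(x-y')g_i(y',t)\,dy'+2\int_\Sigma E(x-y')\,\partial_tg_n(y',t)\,dy'-4\sum_{j=1}^n(\partial_t-\Delta_{x'})\int_{-\infty}^\infty\int_\Sigma\partial_j\mathcal{A}(x-y',t-s)\,g_j(y',s)\,dy'\,ds.$$ *)

theory Defs
  imports "HOL-Analysis.Analysis"
begin

text \<open>
  With \<open>n = CARD('m) + 1\<close>, the boundary \<open>\<Sigma>\<close> is \<open>real ^ 'm\<close> and the point \<open>x = (x', x_n)\<close> of
  Euclidean \<open>n\<close>-space is a pair (whose norm is the Euclidean one). As \<open>'m\<close> is non-empty, \<open>n \<ge> 2\<close>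
  is automatic. The component indices \<open>1, ..., n\<close> are the elements of \<open>'m option\<close>: \<open>Some k\<close> is the
  tangential index \<open>k\<close> and \<open>None\<close> is the normal index \<open>n\<close>.
\<close>

type_synonym 'm space = "(real ^ 'm) \<times> real"

fun unit_dir :: "'m::finite option \<Rightarrow> 'm space" where
  "unit_dir (Some k) = (axis k 1, 0)"
| "unit_dir None = (0, 1)"

definition pderiv_dir :: "'a::real_vector \<Rightarrow> ('a \<Rightarrow> real) \<Rightarrow> 'a \<Rightarrow> real" where
  "pderiv_dir e f x = deriv (\<lambda>h. f (x + h *\<^sub>R e)) 0"

definition pd :: "'m::finite option \<Rightarrow> ('m space \<Rightarrow> real) \<Rightarrow> 'm space \<Rightarrow> real" where
  "pd i = pderiv_dir (unit_dir i)"

definition tangential_laplacian :: "('m::finite space \<Rightarrow> real) \<Rightarrow> 'm space \<Rightarrow> real" where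
  "tangential_laplacian f x = (\<Sum>k\<in>UNIV. pd (Some k) (pd (Some k) f) x)"

text \<open>On an open set, being \<open>k\<close> times differentiable with continuous \<open>k\<close>-th derivatives.\<close>

fun Ck_on :: "nat \<Rightarrow> 'a::real_normed_vector set \<Rightarrow> ('a \<Rightarrow> 'b::real_normed_vector) \<Rightarrow> bool" where
  "Ck_on 0 S f \<longleftrightarrow> continuous_on S f"
| "Ck_on (Suc k) S f \<longleftrightarrow>
     (\<forall>x\<in>S. f differentiable (at x)) \<and> (\<forall>v. Ck_on k S (\<lambda>x. frechet_derivative f (at x) v))"

definition smooth_on :: "'a::real_normed_vector set \<Rightarrow> ('a \<Rightarrow> 'b::real_normed_vector) \<Rightarrow> bool" where
  "smooth_on S f \<longleftrightarrow> (\<forall>k. Ck_on k S f)"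

definition support :: "('a::topological_space \<Rightarrow> real) \<Rightarrow> 'a set" where
  "support f = closure {x. f x \<noteq> 0}"

text \<open>
  For an element of \<open>L\<^sup>1\<close>, which is only determined almost everywhere, the support is the complement
  of the largest open set on which it vanishes almost everywhere.
\<close>

definition ess_support :: "('a::euclidean_space \<Rightarrow> real) \<Rightarrow> 'a set" where
  "ess_support f = - \<Union>{U. open U \<and> (AE x in lebesgue. x \<in> U \<longrightarrow> f x = 0)}"

definition heat_kernel :: "'a::euclidean_space \<Rightarrow> real \<Rightarrow> real" where
  "heat_kernel x t =
     (if t > 0 then (4 * pi * t) powr (- real DIM('a) / 2) * exp (- (norm x)\<^sup>2 / (4 * t)) else 0)"

definition laplace_kernel :: "'a::euclidean_space \<Rightarrow> real" where
  "laplace_kernel x =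
     (if DIM('a) = 2 then - (1 / (2 * pi)) * ln (norm x)
      else 1 / (real DIM('a) * (real DIM('a) - 2) * measure lebesgue (ball (0::'a) 1))
             * norm x powr (2 - real DIM('a)))"

definition kernel_C :: "'m::finite option \<Rightarrow> 'm space \<Rightarrow> real \<Rightarrow> real" where
  "kernel_C i x t =
     (LINT zn:{0..snd x}|lebesgue. LINT z'|lebesgue.
        pd None (\<lambda>y. heat_kernel y t) (x - (z', zn)) * pd i laplace_kernel (z', zn))"

definition kernel_A :: "'m::finite space \<Rightarrow> real \<Rightarrow> real" where
  "kernel_A x t = (LINT z'|lebesgue. heat_kernel (z' :: real ^ 'm, 0 :: real) t * laplace_kernel (x - (z', 0)))"

text \<open>
  The Golovkin tensor is the sum of the function below and of the distribution
  \<open>-2 \<delta>\<^bsub>nj\<^esub> \<partial>\<^sub>i E(x) \<delta>(t)\<close>; the latter enters \<open>stokes_velocity\<close> through its second summand.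
\<close>

definition golovkin_regular ::
    "'m::finite option \<Rightarrow> 'm option \<Rightarrow> 'm space \<Rightarrow> real \<Rightarrow> real" where
  "golovkin_regular i j x t =
     - 2 * (if i = j then 1 else 0) * pd None (\<lambda>y. heat_kernel y t) x
     - 4 * pd j (\<lambda>y. kernel_C i y t) x"

definition stokes_velocity ::
    "('m::finite option \<Rightarrow> real ^ 'm \<Rightarrow> real \<Rightarrow> real) \<Rightarrow> 'm option \<Rightarrow> 'm space \<Rightarrow> real \<Rightarrow> real" where
  "stokes_velocity g i x t =
     (\<Sum>j\<in>UNIV. LINT s|lebesgue. LINT y'|lebesgue.
        golovkin_regular i j (x - (y', 0)) (t - s) * g j y' s)
     - 2 * (LINT y'|lebesgue. pd i laplace_kernel (x - (y', 0)) * g None y' t)"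

definition stokes_pressure ::
    "('m::finite option \<Rightarrow> real ^ 'm \<Rightarrow> real \<Rightarrow> real) \<Rightarrow> 'm space \<Rightarrow> real \<Rightarrow> real" where
  "stokes_pressure g x t =
     2 * (\<Sum>i\<in>UNIV. pd i (pd None (\<lambda>z. LINT y'|lebesgue. laplace_kernel (z - (y', 0)) * g i y' t)) x)
     + 2 * (LINT y'|lebesgue. laplace_kernel (x - (y', 0)) * deriv (g None y') t)
     - 4 * (\<Sum>j\<in>UNIV.
         let h = (\<lambda>z \<tau>. LINT s|lebesgue. LINT y'|lebesgue.
                    pd j (\<lambda>w. kernel_A w (\<tau> - s)) (z - (y', 0)) * g j y' s)
         in deriv (\<lambda>\<tau>. h x \<tau>) t - tangential_laplacian (\<lambda>z. h z t) x)"

definition boundary_region :: "(real ^ 'm::finite) set" where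
  "boundary_region =
     {y. 3 < norm y \<and> norm y < 4 * sqrt (real (CARD('m) + 1)) \<and> (\<forall>i. - 4 < y $ i \<and> y $ i < - 3)}"

definition half_ball :: "real \<Rightarrow> ('m::finite space) set" where
  "half_ball r = {x. norm x < r \<and> snd x > 0}"

definition half_cylinder :: "('m::finite space \<times> real) set" where
  "half_cylinder = half_ball 1 \<times> {0<..<1}"

end

theory Submission
  imports Defs "HOL-Probability.Distributions" "HOL-Real_Asymp.Real_Asymp"
begin

text \<open>
  Only interior regularity is at stake: on \<open>x_n > c > 0\<close> the functions \<open>E\<close> and \<open>\<nabla>E\<close> are smooth, so every
  term that is instantaneous in time is smooth. The kernels that are convolved in time, \<open>\<partial>\<^sub>n\<Gamma>\<close>,
  \<open>\<partial>\<^sub>jC\<^sub>i\<close> and \<open>\<partial>\<^sub>j\<A>\<close>, are for each \<open>t > 0\<close> smooth in \<open>x\<close>, and locally uniformly in \<open>x_n > 0\<close> all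
  their spatial derivatives are \<open>O(t powr (- 1 / 2))\<close> as \<open>t \<rightarrow> 0\<close>. This is integrable at zero, so after
  the substitution \<open>s \<mapsto> t - s\<close> one can differentiate under the integral sign, with all time
  derivatives on the smooth factor of the data.

  For \<open>C\<^sub>i\<close>, a smooth cutoff in \<open>z_n\<close> splits the integral. Near \<open>z = 0\<close>, where \<open>\<nabla>E\<close> has an integrable
  singularity, \<open>\<partial>\<^sub>n\<Gamma>(x - z, t)\<close> has all derivatives bounded by a Gaussian in \<open>z\<close>, uniformly in \<open>t\<close>. Away
  from \<open>z_n = 0\<close> one substitutes \<open>z \<mapsto> x - z\<close>, so that the derivatives fall on the bounded smooth
  factor, and uses that the \<open>L\<^sup>1\<close> norm of \<open>\<partial>\<^sub>n\<Gamma>\<close> is \<open>O(t powr (- 1 / 2))\<close>.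
\<close>

section \<open>Families with uniformly bounded derivatives\<close>

text \<open>The upper limit \<open>snd x\<close> of the integral defining \<open>kernel_C\<close>
  moves with \<open>x\<close>; differentiating it directly would create boundary terms at z_n = x_n,
  exactly where \<Gamma>(x - z, t) concentrates as t tends to 0. The cutoff also removes this
  obstacle: the piece near the singularity of \<nabla>E lives on a fixed slab, and in the other
  piece the reflection turns z_n \<le> x_n into the fixed condition z_n \<ge> 0, while the condition
  at the lower limit disappears because the cutoff vanishes there. For \<A> the exponent - 1 / 2 has
  a different origin: the n-dimensional kernel \<Gamma> is integrated over a hyperplane, one
  dimension short of compensating its prefactor.

  Every differentiation under an integral is followed by further ones, so one dominating function
  has to serve all orders. This is why a family carries a single weight for all its derivatives, and
  why the calculus below multiplies, enlarges and integrates weights along with the functions.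
  Logarithmic growth of E in dimension two and the factors y / t produced by differentiating a
  Gaussian are both absorbed by giving up a part of the Gaussian exponent.\<close>

text \<open>
  All \<open>F \<omega>\<close> with \<open>\<omega> \<in> W\<close> have derivatives up to order \<open>k\<close> on \<open>S\<close>, and these are bounded by the
  weight \<open>w\<close> with constants that do not depend on \<open>\<omega>\<close>. The explicit bound makes this notion,
  unlike \<open>Ck_on\<close>, stable under integration over a parameter.
\<close>

fun bounded_Ck :: "nat \<Rightarrow> 'a::euclidean_space set \<Rightarrow> 'w set \<Rightarrow> ('w \<Rightarrow> 'a \<Rightarrow> real) \<Rightarrow> ('w \<Rightarrow> 'a \<Rightarrow> real) \<Rightarrow> bool" where
  "bounded_Ck 0 S W w F \<longleftrightarrow> (\<exists>C. \<forall>\<omega>\<in>W. \<forall>x\<in>S. \<bar>F \<omega> x\<bar> \<le> C * w \<omega> x)"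
| "bounded_Ck (Suc k) S W w F \<longleftrightarrow>
     (\<exists>C. \<forall>\<omega>\<in>W. \<forall>x\<in>S. \<bar>F \<omega> x\<bar> \<le> C * w \<omega> x) \<and>
     (\<forall>\<omega>\<in>W. \<forall>x\<in>S. F \<omega> differentiable (at x)) \<and>
     (\<forall>v. bounded_Ck k S W w (\<lambda>\<omega> x. frechet_derivative (F \<omega>) (at x) v))"

lemma bounded_Ck_bound:
  "bounded_Ck k S W w F \<Longrightarrow> \<exists>C. \<forall>\<omega>\<in>W. \<forall>x\<in>S. \<bar>F \<omega> x\<bar> \<le> C * w \<omega> x"
  by (cases k) auto

lemma bounded_Ck_SucD: "bounded_Ck (Suc k) S W w F \<Longrightarrow> bounded_Ck k S W w F"
proof (induction k arbitrary: F)
  case (Suc k)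
  from Suc.prems have "bounded_Ck k S W w (\<lambda>\<omega> x. frechet_derivative (F \<omega>) (at x) v)" for v
    by (intro Suc.IH) simp
  then show ?case using Suc.prems by simp
qed auto

text \<open>Both functions have the same candidates for a derivative at \<open>x\<close>, so the
  choice operator behind \<open>frechet_derivative\<close> returns the same map, whether or not a
  derivative exists.\<close>

lemma frechet_derivative_cong_open:
  assumes "open S" "x \<in> S" "\<And>y. y \<in> S \<Longrightarrow> f y = g y"
  shows "frechet_derivative f (at x) = frechet_derivative g (at x)"
proof -
  have "(f has_derivative D) (at x) \<longleftrightarrow> (g has_derivative D) (at x)" for D
    using assms has_derivative_transform_within_open[of f D x UNIV S g]
      has_derivative_transform_within_open[of g D x UNIV S f] by auto
  then show ?thesis unfolding frechet_derivative_def by simp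
qed

lemma differentiable_cong_open:
  assumes "open S" "x \<in> S" "\<And>y. y \<in> S \<Longrightarrow> f y = g y" "f differentiable (at x)"
  shows "g differentiable (at x)"
proof -
  obtain D where "(f has_derivative D) (at x)" using assms(4) by (auto simp: differentiable_def)
  from has_derivative_transform_within_open[OF this assms(1-3)] show ?thesis
    by (rule differentiableI)
qed

lemma bounded_Ck_cong:
  assumes "open S" "\<And>\<omega> x. \<omega> \<in> W \<Longrightarrow> x \<in> S \<Longrightarrow> F \<omega> x = G \<omega> x" "bounded_Ck k S W w F"
  shows "bounded_Ck k S W w G"
  using assms(2,3)
proof (induction k arbitrary: F G)
  case (Suc k)
  have "bounded_Ck k S W w (\<lambda>\<omega> x. frechet_derivative (G \<omega>) (at x) v)" for v
  proof (rule Suc.IH)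
    show "bounded_Ck k S W w (\<lambda>\<omega> x. frechet_derivative (F \<omega>) (at x) v)" using Suc.prems by simp
    show "frechet_derivative (F \<omega>) (at x) v = frechet_derivative (G \<omega>) (at x) v" if "\<omega> \<in> W" "x \<in> S" for \<omega> x
      using frechet_derivative_cong_open[OF assms(1) that(2), of "F \<omega>" "G \<omega>"] Suc.prems(1) that(1) by simp
  qed
  moreover have "\<forall>\<omega>\<in>W. \<forall>x\<in>S. G \<omega> differentiable (at x)"
  proof (intro ballI)
    show "G \<omega> differentiable (at x)" if "\<omega> \<in> W" "x \<in> S" for \<omega> x
      by (rule differentiable_cong_open[OF assms(1) that(2), of "F \<omega>"]) (use Suc.prems that in auto)
  qed
  moreover have "\<exists>C. \<forall>\<omega>\<in>W. \<forall>x\<in>S. \<bar>G \<omega> x\<bar> \<le> C * w \<omega> x"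
    using Suc.prems by simp
  ultimately show ?case by simp
qed auto

text \<open>The usual way to gain an order: the derivative is given by a formula, and uniqueness of
  derivatives identifies it with the \<open>frechet_derivative\<close> of the definition.\<close>

lemma bounded_Ck_SucI:
  assumes S: "open S"
    and b: "\<And>\<omega> x. \<omega> \<in> W \<Longrightarrow> x \<in> S \<Longrightarrow> \<bar>F \<omega> x\<bar> \<le> C * w \<omega> x"
    and d: "\<And>\<omega> x. \<omega> \<in> W \<Longrightarrow> x \<in> S \<Longrightarrow> (F \<omega> has_derivative F' \<omega> x) (at x)"
    and k: "\<And>v. bounded_Ck k S W w (\<lambda>\<omega> x. F' \<omega> x v)"
  shows "bounded_Ck (Suc k) S W w F"
proof -
  have "frechet_derivative (F \<omega>) (at x) = F' \<omega> x" if "\<omega> \<in> W" "x \<in> S" for \<omega> x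
    using d[OF that] frechet_derivative_at by metis
  then have "bounded_Ck k S W w (\<lambda>\<omega> x. frechet_derivative (F \<omega>) (at x) v)" for v
    by (intro bounded_Ck_cong[OF S _ k[of v]]) auto
  moreover have "\<exists>C. \<forall>\<omega>\<in>W. \<forall>x\<in>S. \<bar>F \<omega> x\<bar> \<le> C * w \<omega> x"
    using b by blast
  moreover have "\<forall>\<omega>\<in>W. \<forall>x\<in>S. F \<omega> differentiable (at x)"
    using d by (auto intro: differentiableI)
  ultimately show ?thesis by simp
qed

lemma bounded_Ck_has_derivative:
  assumes "bounded_Ck (Suc k) S W w F" "\<omega> \<in> W" "x \<in> S"
  shows "(F \<omega> has_derivative frechet_derivative (F \<omega>) (at x)) (at x)"
  using assms by (simp add: frechet_derivative_works[symmetric])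

lemma bounded_Ck_frechet:
  "bounded_Ck (Suc k) S W w F \<Longrightarrow> bounded_Ck k S W w (\<lambda>\<omega> x. frechet_derivative (F \<omega>) (at x) v)"
  by auto

lemma bounded_Ck_subset:
  assumes "bounded_Ck k S W w F" "S' \<subseteq> S" "W' \<subseteq> W"
  shows "bounded_Ck k S' W' w F"
  using assms(1)
proof (induction k arbitrary: F)
  case 0 then show ?case using assms(2,3) by simp blast
next
  case (Suc k)
  have "\<exists>C. \<forall>\<omega>\<in>W'. \<forall>x\<in>S'. \<bar>F \<omega> x\<bar> \<le> C * w \<omega> x"
    using Suc.prems assms(2,3) by simp blast
  moreover have "\<forall>\<omega>\<in>W'. \<forall>x\<in>S'. F \<omega> differentiable (at x)"
    using Suc.prems assms(2,3) by (simp add: subset_iff)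
  ultimately show ?case using Suc by simp
qed

lemma bounded_Ck_weight:
  assumes F: "bounded_Ck k S W w F"
    and w: "\<And>\<omega> x. \<omega> \<in> W \<Longrightarrow> x \<in> S \<Longrightarrow> 0 \<le> w \<omega> x \<and> w \<omega> x \<le> B * w' \<omega> x"
  shows "bounded_Ck k S W w' F"
proof -
  have *: "\<exists>C. \<forall>\<omega>\<in>W. \<forall>x\<in>S. \<bar>G \<omega> x\<bar> \<le> C * w' \<omega> x"
    if G: "\<exists>C. \<forall>\<omega>\<in>W. \<forall>x\<in>S. \<bar>G \<omega> x\<bar> \<le> C * w \<omega> x" for G
  proof -
    obtain C where C: "\<forall>\<omega>\<in>W. \<forall>x\<in>S. \<bar>G \<omega> x\<bar> \<le> C * w \<omega> x" using G by blast
    \<comment> \<open>The sign of \<open>C\<close> is unknown, and only a nonnegative factor lets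
      the comparison of weights be multiplied through.\<close>
    have "\<bar>G \<omega> x\<bar> \<le> \<bar>C\<bar> * B * w' \<omega> x" if "\<omega> \<in> W" "x \<in> S" for \<omega> x
    proof -
      have "\<bar>G \<omega> x\<bar> \<le> \<bar>C\<bar> * w \<omega> x"
        using C that w[OF that] by (meson abs_ge_self mult_right_mono order_trans)
      also have "\<dots> \<le> \<bar>C\<bar> * (B * w' \<omega> x)" using w[OF that] by (intro mult_left_mono) auto
      finally show ?thesis by (simp add: mult.assoc)
    qed
    then show ?thesis by blast
  qed
  show ?thesis using F
  proof (induction k arbitrary: F)
    case 0
    then show ?case using *[of F] by simp
  next
    case (Suc k)
    then show ?case using *[OF bounded_Ck_bound[OF Suc.prems]] by simp
  qed
qed

text \<open>Derivatives at a point are local, so only the constants have to be merged. This glues a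
  cutoff product to the region where it is identically zero.\<close>

lemma bounded_Ck_Un:
  assumes "bounded_Ck k S W w F" "bounded_Ck k T W w F" "\<And>\<omega> x. \<omega> \<in> W \<Longrightarrow> 0 \<le> w \<omega> x"
  shows "bounded_Ck k (S \<union> T) W w F"
proof -
  have *: "\<exists>C. \<forall>\<omega>\<in>W. \<forall>x\<in>S\<union>T. \<bar>G \<omega> x\<bar> \<le> C * w \<omega> x"
    if S: "\<exists>C. \<forall>\<omega>\<in>W. \<forall>x\<in>S. \<bar>G \<omega> x\<bar> \<le> C * w \<omega> x" and T: "\<exists>C. \<forall>\<omega>\<in>W. \<forall>x\<in>T. \<bar>G \<omega> x\<bar> \<le> C * w \<omega> x" for G
  proof -
    from S obtain C where C: "\<forall>\<omega>\<in>W. \<forall>x\<in>S. \<bar>G \<omega> x\<bar> \<le> C * w \<omega> x" by blast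
    from T obtain D where D: "\<forall>\<omega>\<in>W. \<forall>x\<in>T. \<bar>G \<omega> x\<bar> \<le> D * w \<omega> x" by blast
    have "\<bar>G \<omega> x\<bar> \<le> max C D * w \<omega> x" if "\<omega> \<in> W" "x \<in> S \<union> T" for \<omega> x
    proof -
      have "C * w \<omega> x \<le> max C D * w \<omega> x" "D * w \<omega> x \<le> max C D * w \<omega> x"
        using assms(3)[OF that(1), of x] by (auto intro: mult_right_mono)
      then show ?thesis using that C D by (meson Un_iff order_trans)
    qed
    then show ?thesis by blast
  qed
  show ?thesis using assms(1,2)
  proof (induction k arbitrary: F)
    case 0
    then show ?case using *[of F] by simp
  next
    case (Suc k)
    have "\<exists>C. \<forall>\<omega>\<in>W. \<forall>x\<in>S \<union> T. \<bar>F \<omega> x\<bar> \<le> C * w \<omega> x"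
      by (rule *[OF bounded_Ck_bound[OF Suc.prems(1)] bounded_Ck_bound[OF Suc.prems(2)]])
    moreover have "\<forall>\<omega>\<in>W. \<forall>x\<in>S \<union> T. F \<omega> differentiable (at x)"
      using Suc.prems by (simp add: ball_Un)
    moreover have "bounded_Ck k (S \<union> T) W w (\<lambda>\<omega> x. frechet_derivative (F \<omega>) (at x) v)" for v
      by (rule Suc.IH) (use Suc.prems in simp_all)
    ultimately show ?case by simp
  qed
qed

lemma bounded_Ck_const:
  assumes "open S" "\<And>\<omega> x. \<omega> \<in> W \<Longrightarrow> x \<in> S \<Longrightarrow> 0 \<le> w \<omega> x \<and> \<bar>m \<omega>\<bar> \<le> B * w \<omega> x"
  shows "bounded_Ck k S W w (\<lambda>\<omega> x. m \<omega>)"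
proof -
  have z: "bounded_Ck k S W w (\<lambda>\<omega> x. 0)" for k
    by (induction k) (auto intro!: exI[of _ 0])
  show ?thesis
  proof (cases k)
    case 0 then show ?thesis using assms by auto
  next
    case (Suc n)
    show ?thesis unfolding Suc
      by (rule bounded_Ck_SucI[where C=B and F'="\<lambda>\<omega> x v. 0"]) (use assms z in auto)
  qed
qed

lemma bounded_Ck_add:
  assumes "open S" "bounded_Ck k S W w F" "bounded_Ck k S W w G"
  shows "bounded_Ck k S W w (\<lambda>\<omega> x. F \<omega> x + G \<omega> x)"
  using assms(2,3)
proof (induction k arbitrary: F G)
  case (0)
  then obtain C D where "\<forall>\<omega>\<in>W. \<forall>x\<in>S. \<bar>F \<omega> x\<bar> \<le> C * w \<omega> x" "\<forall>\<omega>\<in>W. \<forall>x\<in>S. \<bar>G \<omega> x\<bar> \<le> D * w \<omega> x"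
    by auto
  then have "\<forall>\<omega>\<in>W. \<forall>x\<in>S. \<bar>F \<omega> x + G \<omega> x\<bar> \<le> (C+D) * w \<omega> x"
    by (intro ballI order_trans[OF abs_triangle_ineq]) (simp add: distrib_right add_mono)
  then show ?case by auto
next
  case (Suc k)
  obtain C D where C: "\<forall>\<omega>\<in>W. \<forall>x\<in>S. \<bar>F \<omega> x\<bar> \<le> C * w \<omega> x" "\<forall>\<omega>\<in>W. \<forall>x\<in>S. \<bar>G \<omega> x\<bar> \<le> D * w \<omega> x"
    using Suc.prems by auto
  show ?case
  proof (rule bounded_Ck_SucI[OF assms(1), where C="C+D"])
    show "\<bar>F \<omega> x + G \<omega> x\<bar> \<le> (C+D) * w \<omega> x" if "\<omega> \<in> W" "x \<in> S" for \<omega> x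
      using C that by (intro order_trans[OF abs_triangle_ineq]) (simp add: distrib_right add_mono)
    show "((\<lambda>x. F \<omega> x + G \<omega> x) has_derivative
        (\<lambda>v. frechet_derivative (F \<omega>) (at x) v + frechet_derivative (G \<omega>) (at x) v)) (at x)"
      if "\<omega> \<in> W" "x \<in> S" for \<omega> x
      by (rule has_derivative_add[OF bounded_Ck_has_derivative[OF Suc.prems(1) that]
            bounded_Ck_has_derivative[OF Suc.prems(2) that]])
    show "bounded_Ck k S W w (\<lambda>\<omega> x. frechet_derivative (F \<omega>) (at x) v + frechet_derivative (G \<omega>) (at x) v)" for v
      using Suc by auto
  qed
qed

text \<open>Since one weight bounds all derivatives of a factor, every term of the Leibniz rule is
  bounded by the same product of weights.\<close>

lemma bounded_Ck_mult:
  assumes "open S" "bounded_Ck k S W w F" "bounded_Ck k S W u G"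
    and "\<And>\<omega> x. \<omega> \<in> W \<Longrightarrow> x \<in> S \<Longrightarrow> 0 \<le> w \<omega> x \<and> 0 \<le> u \<omega> x"
  shows "bounded_Ck k S W (\<lambda>\<omega> x. w \<omega> x * u \<omega> x) (\<lambda>\<omega> x. F \<omega> x * G \<omega> x)"
  using assms(2,3)
proof (induction k arbitrary: F G)
  note b = assms(4)
  have bound: "\<exists>C. \<forall>\<omega>\<in>W. \<forall>x\<in>S. \<bar>F \<omega> x * G \<omega> x\<bar> \<le> C * (w \<omega> x * u \<omega> x)"
    if F: "bounded_Ck k S W w F" and G: "bounded_Ck k S W u G" for k F G
  proof -
    obtain C where C: "\<forall>\<omega>\<in>W. \<forall>x\<in>S. \<bar>F \<omega> x\<bar> \<le> C * w \<omega> x" using bounded_Ck_bound[OF F] by blast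
    obtain D where D: "\<forall>\<omega>\<in>W. \<forall>x\<in>S. \<bar>G \<omega> x\<bar> \<le> D * u \<omega> x" using bounded_Ck_bound[OF G] by blast
    have "\<bar>F \<omega> x * G \<omega> x\<bar> \<le> C * D * (w \<omega> x * u \<omega> x)" if "\<omega> \<in> W" "x \<in> S" for \<omega> x
    proof -
      have "\<bar>F \<omega> x\<bar> * \<bar>G \<omega> x\<bar> \<le> (C * w \<omega> x) * (D * u \<omega> x)"
      proof (rule mult_mono)
        show F: "\<bar>F \<omega> x\<bar> \<le> C * w \<omega> x" and "\<bar>G \<omega> x\<bar> \<le> D * u \<omega> x" using C D that by auto
        show "0 \<le> C * w \<omega> x" by (rule order_trans[OF abs_ge_zero F])
      qed simp
      then show ?thesis by (simp add: abs_mult mult_ac)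
    qed
    then show ?thesis by blast
  qed
  {
    case 0 then show ?case using bound[of 0] by simp
  next
    case (Suc k)
    obtain C where C: "\<forall>\<omega>\<in>W. \<forall>x\<in>S. \<bar>F \<omega> x * G \<omega> x\<bar> \<le> C * (w \<omega> x * u \<omega> x)"
      using bound[OF Suc.prems] by blast
    show ?case
    proof (rule bounded_Ck_SucI[OF assms(1), where C=C])
      show "((\<lambda>x. F \<omega> x * G \<omega> x) has_derivative
          (\<lambda>v. F \<omega> x * frechet_derivative (G \<omega>) (at x) v + frechet_derivative (F \<omega>) (at x) v * G \<omega> x)) (at x)"
        if "\<omega> \<in> W" "x \<in> S" for \<omega> x
        by (rule has_derivative_mult[OF bounded_Ck_has_derivative[OF Suc.prems(1) that]
              bounded_Ck_has_derivative[OF Suc.prems(2) that]])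
      show "bounded_Ck k S W (\<lambda>\<omega> x. w \<omega> x * u \<omega> x)
         (\<lambda>\<omega> x. F \<omega> x * frechet_derivative (G \<omega>) (at x) v + frechet_derivative (F \<omega>) (at x) v * G \<omega> x)" for v
        by (intro bounded_Ck_add assms(1) Suc.IH bounded_Ck_SucD[of k] Suc.prems bounded_Ck_frechet)
      show "\<bar>F \<omega> x * G \<omega> x\<bar> \<le> C * (w \<omega> x * u \<omega> x)" if "\<omega> \<in> W" "x \<in> S" for \<omega> x
        using C that by blast
    qed
  }
qed

lemma bounded_Ck_cmult:
  assumes "open S" "bounded_Ck k S W w F" "\<And>\<omega> x. \<omega> \<in> W \<Longrightarrow> x \<in> S \<Longrightarrow> 0 \<le> w \<omega> x"
  shows "bounded_Ck k S W (\<lambda>\<omega> x. \<bar>m \<omega>\<bar> * w \<omega> x) (\<lambda>\<omega> x. m \<omega> * F \<omega> x)"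
  by (rule bounded_Ck_mult[OF assms(1) _ assms(2)], rule bounded_Ck_const[where B=1])
    (use assms in auto)

lemma bounded_Ck_scale:
  assumes "open S" "bounded_Ck k S W w F" "\<And>\<omega> x. \<omega> \<in> W \<Longrightarrow> x \<in> S \<Longrightarrow> 0 \<le> w \<omega> x"
  shows "bounded_Ck k S W w (\<lambda>\<omega> x. c * F \<omega> x)"
  by (rule bounded_Ck_weight[OF bounded_Ck_cmult[OF assms, of "\<lambda>_. c"], where B="\<bar>c\<bar>"])
     (use assms(3) in auto)

lemma bounded_Ck_sum:
  assumes "open S" "finite I" "\<And>i. i \<in> I \<Longrightarrow> bounded_Ck k S W w (F i)"
    "\<And>\<omega> x. \<omega> \<in> W \<Longrightarrow> x \<in> S \<Longrightarrow> 0 \<le> w \<omega> x"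
  shows "bounded_Ck k S W w (\<lambda>\<omega> x. \<Sum>i\<in>I. F i \<omega> x)"
  using assms(2,3)
proof (induction I rule: finite_induct)
  case empty
  show ?case using bounded_Ck_const[of S W w "\<lambda>_. 0" 0] assms by auto
next
  case (insert i I)
  then show ?case using bounded_Ck_add[OF assms(1), of k W w "F i"] by simp
qed

text \<open>The chain rule with an affine inner map only replaces the direction \<open>v\<close> by
  \<open>L v\<close>, so the derivative family has the form required by the induction. Renaming the
  parameter through \<open>\<phi>\<close> and shifting by \<open>z \<omega>\<close> covers
  translates x - z as well as functions of space alone or of time alone.\<close>

lemma bounded_Ck_affine:
  fixes F :: "'w \<Rightarrow> 'b::euclidean_space \<Rightarrow> real" and L :: "'a::euclidean_space \<Rightarrow> 'b"
  assumes F: "bounded_Ck k S W w F" and S': "open S'" and L: "bounded_linear L"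
    and m: "\<And>\<omega> x. \<omega> \<in> W' \<Longrightarrow> x \<in> S' \<Longrightarrow> \<phi> \<omega> \<in> W \<and> L x + z \<omega> \<in> S"
  shows "bounded_Ck k S' W' (\<lambda>\<omega> x. w (\<phi> \<omega>) (L x + z \<omega>)) (\<lambda>\<omega> x. F (\<phi> \<omega>) (L x + z \<omega>))"
  using F
proof (induction k arbitrary: F)
  case 0 then show ?case using m by simp blast
next
  case (Suc k)
  obtain C where C: "\<forall>\<omega>\<in>W. \<forall>x\<in>S. \<bar>F \<omega> x\<bar> \<le> C * w \<omega> x" using Suc.prems by auto
  show ?case
  proof (rule bounded_Ck_SucI[OF S', where C=C])
    show "\<bar>F (\<phi> \<omega>) (L x + z \<omega>)\<bar> \<le> C * w (\<phi> \<omega>) (L x + z \<omega>)" if "\<omega> \<in> W'" "x \<in> S'" for \<omega> x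
      using C m[OF that] by auto
    show "((\<lambda>x. F (\<phi> \<omega>) (L x + z \<omega>)) has_derivative
          (\<lambda>v. frechet_derivative (F (\<phi> \<omega>)) (at (L x + z \<omega>)) (L v))) (at x)"
      if "\<omega> \<in> W'" "x \<in> S'" for \<omega> x
    proof -
      have "((\<lambda>x. L x + z \<omega>) has_derivative L) (at x)"
        using has_derivative_add[OF bounded_linear_imp_has_derivative[OF L] has_derivative_const] by simp
      from diff_chain_at[OF this] bounded_Ck_has_derivative[OF Suc.prems] m[OF that] show ?thesis
        by (auto simp: o_def)
    qed
    show "bounded_Ck k S' W' (\<lambda>\<omega> x. w (\<phi> \<omega>) (L x + z \<omega>))
      (\<lambda>\<omega> x. frechet_derivative (F (\<phi> \<omega>)) (at (L x + z \<omega>)) (L v))" for v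
      using Suc.IH[OF bounded_Ck_frechet[OF Suc.prems]] .
  qed
qed

lemma bounded_Ck_translate:
  assumes "bounded_Ck k S W w F" "open S'"
    and "\<And>\<omega> x. \<omega> \<in> W' \<Longrightarrow> x \<in> S' \<Longrightarrow> \<phi> \<omega> \<in> W \<and> x - z \<omega> \<in> S"
  shows "bounded_Ck k S' W' (\<lambda>\<omega> x. w (\<phi> \<omega>) (x - z \<omega>)) (\<lambda>\<omega> x. F (\<phi> \<omega>) (x - z \<omega>))"
  using bounded_Ck_affine[OF assms(1,2) bounded_linear_ident, of W' \<phi> "\<lambda>\<omega>. - z \<omega>"] assms(3) by simp

text \<open>The order is one higher than in the conclusion because continuity of the last derivative
  is obtained from its differentiability.\<close>

lemma bounded_Ck_imp_Ck_on:
  assumes "\<forall>x\<in>S. \<exists>T. open T \<and> x \<in> T \<and> bounded_Ck (Suc k) T {()} (\<lambda>_ _. 1) (\<lambda>_. f)"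
  shows "Ck_on k S f"
  using assms
proof (induction k arbitrary: f)
  case 0
  have "f differentiable (at x)" if x: "x \<in> S" for x
  proof -
    obtain T where "open T \<and> x \<in> T \<and> bounded_Ck (Suc 0) T {()} (\<lambda>_ _. 1) (\<lambda>_. f)"
      using bspec[OF 0 x] by (rule exE)
    then show ?thesis by simp
  qed
  then show ?case
    by (auto intro!: continuous_at_imp_continuous_on differentiable_imp_continuous_within)
next
  case (Suc k)
  have "f differentiable (at x)" if x: "x \<in> S" for x
  proof -
    obtain T where "open T \<and> x \<in> T \<and> bounded_Ck (Suc (Suc k)) T {()} (\<lambda>_ _. 1) (\<lambda>_. f)"
      using bspec[OF Suc.prems x] by (rule exE)
    then show ?thesis by simp
  qed
  moreover have "Ck_on k S (\<lambda>x. frechet_derivative f (at x) v)" for v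
  proof (rule Suc.IH, intro ballI)
    fix x assume "x \<in> S"
    obtain T where T: "open T \<and> x \<in> T \<and> bounded_Ck (Suc (Suc k)) T {()} (\<lambda>_ _. 1) (\<lambda>_. f)"
      using bspec[OF Suc.prems \<open>x \<in> S\<close>] by (rule exE)
    have "bounded_Ck (Suc k) T {()} (\<lambda>_ _. 1) (\<lambda>_ x. frechet_derivative f (at x) v)"
      by (rule bounded_Ck_frechet) (use T in blast)
    with T show "\<exists>T. open T \<and> x \<in> T \<and>
        bounded_Ck (Suc k) T {()} (\<lambda>_ _. 1) (\<lambda>_ x. frechet_derivative f (at x) v)"
      by (intro exI[of _ T] conjI) (simp_all only:)
  qed
  ultimately show ?case by simp
qed

lemma smooth_onI:
  assumes "\<And>x. x \<in> S \<Longrightarrow> \<exists>T. open T \<and> x \<in> T \<and> (\<forall>k. bounded_Ck k T {()} (\<lambda>_ _. 1) (\<lambda>_. f))"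
  shows "smooth_on S f"
  unfolding smooth_on_def
proof
  show "Ck_on k S f" for k
  proof (rule bounded_Ck_imp_Ck_on, intro ballI)
    fix x assume "x \<in> S"
    from assms[OF this] obtain T where T: "open T \<and> x \<in> T \<and> (\<forall>k. bounded_Ck k T {()} (\<lambda>_ _. 1) (\<lambda>_. f))"
      by (rule exE)
    then show "\<exists>T. open T \<and> x \<in> T \<and> bounded_Ck (Suc k) T {()} (\<lambda>_ _. 1) (\<lambda>_. f)"
      by (intro exI[of _ T] conjI) (simp_all only:)
  qed
qed

text \<open>A continuous function vanishing off a compact set is bounded, and the complement of that
  set is open, so all derivatives vanish there too and the argument repeats.\<close>

lemma compact_support_bounded_Ck:
  fixes f :: "'a::euclidean_space \<Rightarrow> real"
  assumes "smooth_on UNIV f" "compact K" "\<And>x. x \<notin> K \<Longrightarrow> f x = 0"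
  shows "bounded_Ck k UNIV {()} (\<lambda>_ _. 1) (\<lambda>_. f)"
  using assms(1,3)
proof (induction k arbitrary: f)
  have bound: "\<exists>C. \<forall>x. \<bar>f x\<bar> \<le> C" if "smooth_on UNIV f" "\<And>x. x \<notin> K \<Longrightarrow> f x = 0" for f :: "'a \<Rightarrow> real"
  proof -
    have "continuous_on UNIV f" using that(1)[unfolded smooth_on_def, rule_format, of 0] by simp
    then have bdd: "bounded (f ` K)"
      by (intro compact_imp_bounded compact_continuous_image assms(2)) (auto intro: continuous_on_subset)
    obtain C where C: "\<forall>x\<in>K. \<bar>f x\<bar> \<le> C" using bdd by (auto simp: bounded_iff)
    have "\<bar>f x\<bar> \<le> max C 0" for x using C that(2)[of x] by fastforce
    then show ?thesis by blast
  qed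
  {
    case 0
    from bound[OF this] show ?case by auto
  next
    case (Suc k)
    have d: "f differentiable (at x)" for x
      using Suc.prems(1)[unfolded smooth_on_def, rule_format, of "Suc 0"] by simp
    have "smooth_on UNIV (\<lambda>x. frechet_derivative f (at x) v)" for v
      unfolding smooth_on_def
    proof
      show "Ck_on n UNIV (\<lambda>x. frechet_derivative f (at x) v)" for n
        using Suc.prems(1)[unfolded smooth_on_def, rule_format, of "Suc n"] by simp
    qed
    moreover have "frechet_derivative f (at x) v = 0" if "x \<notin> K" for x v
    proof -
      have "frechet_derivative f (at x) = frechet_derivative (\<lambda>_. 0) (at x)"
        by (rule frechet_derivative_cong_open[of "- K"])
          (use that Suc.prems(2) assms(2) compact_imp_closed in auto)
      then show ?thesis by simp
    qed
    ultimately have "bounded_Ck k UNIV {()} (\<lambda>_ _. 1) (\<lambda>_ x. frechet_derivative f (at x) v)" for v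
      by (intro Suc.IH)
    then show ?case using d bound[OF Suc.prems] by simp
  }
qed

text \<open>Dominated convergence applied to the normalised remainder along an arbitrary sequence
  tending to 0. Sequences suffice because the limit at 0 in a Euclidean space is characterised by
  them.\<close>

lemma has_derivative_set_integral:
  fixes f :: "'th \<Rightarrow> 'a::euclidean_space \<Rightarrow> real"
  assumes S: "open S" "x \<in> S" and \<Theta>: "\<Theta> \<in> sets M"
    and d: "\<And>\<theta> y. \<theta> \<in> \<Theta> \<Longrightarrow> y \<in> S \<Longrightarrow> (f \<theta> has_derivative f' \<theta> y) (at y)"
    and b: "\<And>\<theta> y v. \<theta> \<in> \<Theta> \<Longrightarrow> y \<in> S \<Longrightarrow> \<bar>f' \<theta> y v\<bar> \<le> B \<theta> * norm v"
    and B: "set_integrable M \<Theta> B"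
    and f: "\<And>y. y \<in> S \<Longrightarrow> set_integrable M \<Theta> (\<lambda>\<theta>. f \<theta> y)"
    and m: "\<And>v. set_borel_measurable M \<Theta> (\<lambda>\<theta>. f' \<theta> x v)"
  shows "((\<lambda>y. LINT \<theta>:\<Theta>|M. f \<theta> y) has_derivative (\<lambda>v. LINT \<theta>:\<Theta>|M. f' \<theta> x v)) (at x)"
proof -
  have lin: "linear (f' \<theta> x)" if "\<theta> \<in> \<Theta>" for \<theta>
    using has_derivative_linear[OF d[OF that S(2)]] .
  have int': "set_integrable M \<Theta> (\<lambda>\<theta>. f' \<theta> x v)" for v
  proof (rule set_integrable_bound)
    show "set_integrable M \<Theta> (\<lambda>\<theta>. B \<theta> * norm v)" using B by simp
    show "AE \<theta> in M. \<theta> \<in> \<Theta> \<longrightarrow> norm (f' \<theta> x v) \<le> norm (B \<theta> * norm v)"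
      using b S(2) by (intro AE_I2) (force intro: order_trans[OF _ abs_ge_self])
  qed (rule m)
  have "bounded_linear (\<lambda>v. LINT \<theta>:\<Theta>|M. f' \<theta> x v)"
  proof (rule bounded_linear_intro)
    show "(LINT \<theta>:\<Theta>|M. f' \<theta> x (u + v)) = (LINT \<theta>:\<Theta>|M. f' \<theta> x u) + (LINT \<theta>:\<Theta>|M. f' \<theta> x v)" for u v
      using lin \<Theta> by (subst set_integral_add(2)[symmetric, OF int' int'])
        (auto intro!: set_lebesgue_integral_cong simp: linear_add)
    show "(LINT \<theta>:\<Theta>|M. f' \<theta> x (r *\<^sub>R v)) = r *\<^sub>R (LINT \<theta>:\<Theta>|M. f' \<theta> x v)" for r v
    proof -
      have "(LINT \<theta>:\<Theta>|M. f' \<theta> x (r *\<^sub>R v)) = (LINT \<theta>:\<Theta>|M. r * f' \<theta> x v)"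
        using lin \<Theta> by (intro set_lebesgue_integral_cong) (auto simp: linear_scale)
      then show ?thesis by simp
    qed
    show "norm (LINT \<theta>:\<Theta>|M. f' \<theta> x v) \<le> norm v * (LINT \<theta>:\<Theta>|M. B \<theta>)" for v
    proof -
      have "norm (LINT \<theta>:\<Theta>|M. f' \<theta> x v) \<le> (LINT \<theta>:\<Theta>|M. norm (f' \<theta> x v))"
        using int' by (rule set_integral_norm_bound)
      also have "\<dots> \<le> (LINT \<theta>:\<Theta>|M. B \<theta> * norm v)"
      proof (rule set_integral_mono)
        show "set_integrable M \<Theta> (\<lambda>\<theta>. norm (f' \<theta> x v))"
          using int' by (rule set_integrable_norm)
      qed (use B b S(2) in auto)
      finally show ?thesis by (simp add: mult.commute)
    qed
  qed
  moreover have "((\<lambda>h. norm ((LINT \<theta>:\<Theta>|M. f \<theta> (x + h)) - (LINT \<theta>:\<Theta>|M. f \<theta> x) - (LINT \<theta>:\<Theta>|M. f' \<theta> x h)) / norm h) \<longlongrightarrow> 0) (at 0)"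
    unfolding tendsto_at_iff_sequentially
  proof (intro allI impI)
    fix X :: "nat \<Rightarrow> 'a"
    assume X0: "\<forall>i. X i \<in> UNIV - {0}" and X: "X \<longlonglongrightarrow> 0"
    obtain r where r: "r > 0" "ball x r \<subseteq> S" using S open_contains_ball by blast
    obtain N where N: "\<And>i. i \<ge> N \<Longrightarrow> norm (X i) < r"
      using X r(1) LIMSEQ_iff[of X 0] by auto
    \<comment> \<open>Dropping finitely many terms keeps all points x + Y i in one ball inside
      \<open>S\<close>, where the mean value inequality is available.\<close>
    define Y where "Y i = X (i + N)" for i
    have Y0: "Y i \<noteq> 0" for i using X0 by (auto simp: Y_def)
    have Yr: "x + Y i \<in> ball x r" for i using N[of "i+N"] by (simp add: Y_def dist_norm)
    have Y: "Y \<longlonglongrightarrow> 0" unfolding Y_def using X by (rule LIMSEQ_ignore_initial_segment)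
    define q where "q i \<theta> = indicator \<Theta> \<theta> *\<^sub>R ((f \<theta> (x + Y i) - f \<theta> x - f' \<theta> x (Y i)) / norm (Y i))" for i \<theta>
    have YS: "x + Y i \<in> S" for i using Yr r(2) by blast
    have "set_integrable M \<Theta> (\<lambda>\<theta>. (f \<theta> (x + Y i) - f \<theta> x - f' \<theta> x (Y i)) / norm (Y i))" for i
      by (intro set_integrable_divide set_integral_diff(1) f int' YS S(2))
    then have qi: "integrable M (q i)" for i
      unfolding q_def set_integrable_def .
    \<comment> \<open>In the majorant 2 * B, one B bounds the increment of \<open>f \<theta>\<close>
      by the mean value inequality on the ball, the other one bounds the linear part
      \<open>f' \<theta> x\<close>.\<close>
    have "(\<lambda>i. LINT \<theta>|M. q i \<theta>) \<longlonglongrightarrow> (LINT \<theta>|M. 0)"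
    proof (rule integral_dominated_convergence[where w="\<lambda>\<theta>. indicator \<Theta> \<theta> *\<^sub>R (2 * B \<theta>)"])
      have "set_integrable M \<Theta> (\<lambda>\<theta>. 2 * B \<theta>)" using B by simp
      then show "integrable M (\<lambda>\<theta>. indicat_real \<Theta> \<theta> *\<^sub>R (2 * B \<theta>))" unfolding set_integrable_def .
      show "AE \<theta> in M. (\<lambda>i. q i \<theta>) \<longlonglongrightarrow> 0"
      proof (rule AE_I2)
        fix \<theta>
        show "(\<lambda>i. q i \<theta>) \<longlonglongrightarrow> 0"
        proof (cases "\<theta> \<in> \<Theta>")
          case True
          from d[OF this S(2)] have "((\<lambda>h. norm (f \<theta> (x + h) - f \<theta> x - f' \<theta> x h) / norm h) \<longlongrightarrow> 0) (at 0)"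
            by (simp add: has_derivative_at)
          then have "((\<lambda>h. norm (f \<theta> (x + h) - f \<theta> x - f' \<theta> x h) / norm h) \<circ> Y) \<longlonglongrightarrow> 0"
            using Y Y0 unfolding tendsto_at_iff_sequentially by auto
          then have "(\<lambda>i. norm (q i \<theta>)) \<longlonglongrightarrow> 0"
            using True by (simp add: q_def o_def)
          then show ?thesis by (rule tendsto_norm_zero_cancel)
        qed (simp add: q_def)
      qed
      show "AE \<theta> in M. norm (q i \<theta>) \<le> indicat_real \<Theta> \<theta> *\<^sub>R (2 * B \<theta>)" for i
      proof (rule AE_I2)
        fix \<theta>
        show "norm (q i \<theta>) \<le> indicat_real \<Theta> \<theta> *\<^sub>R (2 * B \<theta>)"
        proof (cases "\<theta> \<in> \<Theta>")
          case True
          have "norm (f \<theta> (x + Y i) - f \<theta> x) \<le> B \<theta> * norm ((x + Y i) - x)"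
          proof (rule differentiable_bound[where S="ball x r" and f'="f' \<theta>"])
            show "(f \<theta> has_derivative f' \<theta> y) (at y within ball x r)" if "y \<in> ball x r" for y
              using d[OF True] that r(2) has_derivative_at_withinI by blast
            show "onorm (f' \<theta> y) \<le> B \<theta>" if "y \<in> ball x r" for y
              using b[OF True, of y] that r(2) by (intro onorm_le) auto
          qed (use Yr r in auto)
          then have "norm (f \<theta> (x + Y i) - f \<theta> x) \<le> B \<theta> * norm (Y i)" by simp
          moreover have "norm (f' \<theta> x (Y i)) \<le> B \<theta> * norm (Y i)" using b[OF True S(2)] by simp
          ultimately have "norm (f \<theta> (x + Y i) - f \<theta> x - f' \<theta> x (Y i)) \<le> B \<theta> * norm (Y i) + B \<theta> * norm (Y i)"
            using norm_triangle_ineq4[of "f \<theta> (x + Y i) - f \<theta> x" "f' \<theta> x (Y i)"] by linarith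
          then show ?thesis using True Y0[of i] by (simp add: q_def divide_le_eq)
        qed (simp add: q_def)
      qed
    qed (use qi in auto)
    then have "(\<lambda>i. norm (LINT \<theta>|M. q i \<theta>)) \<longlonglongrightarrow> 0"
      by (intro tendsto_norm_zero) simp
    moreover have "(LINT \<theta>|M. q i \<theta>) = ((LINT \<theta>:\<Theta>|M. f \<theta> (x + Y i)) - (LINT \<theta>:\<Theta>|M. f \<theta> x) - (LINT \<theta>:\<Theta>|M. f' \<theta> x (Y i))) / norm (Y i)" for i
    proof -
      have "(LINT \<theta>|M. q i \<theta>) = (LINT \<theta>:\<Theta>|M. (f \<theta> (x + Y i) - f \<theta> x - f' \<theta> x (Y i)) / norm (Y i))"
        unfolding q_def set_lebesgue_integral_def ..
      also have "\<dots> = (LINT \<theta>:\<Theta>|M. f \<theta> (x + Y i) - f \<theta> x - f' \<theta> x (Y i)) / norm (Y i)"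
        by simp
      finally show ?thesis
        by (simp add: set_integral_diff f int' YS S(2))
    qed
    ultimately have "(\<lambda>i. norm ((LINT \<theta>:\<Theta>|M. f \<theta> (x + Y i)) - (LINT \<theta>:\<Theta>|M. f \<theta> x) - (LINT \<theta>:\<Theta>|M. f' \<theta> x (Y i))) / norm (Y i)) \<longlonglongrightarrow> 0"
      by simp
    then show "((\<lambda>h. norm ((LINT \<theta>:\<Theta>|M. f \<theta> (x + h)) - (LINT \<theta>:\<Theta>|M. f \<theta> x) - (LINT \<theta>:\<Theta>|M. f' \<theta> x h)) / norm h) \<circ> X) \<longlonglongrightarrow> 0"
      unfolding o_def Y_def by (rule LIMSEQ_offset)
  qed
  ultimately show ?thesis by (simp add: has_derivative_at)
qed

section \<open>Directional difference quotients and measurability of derivatives\<close>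

lemma has_derivative_direction:
  fixes f :: "'a::real_normed_vector \<Rightarrow> real"
  assumes "(f has_derivative D) (at x)"
  shows "((\<lambda>t. f (x + t *\<^sub>R v)) has_field_derivative D v) (at 0)"
proof -
  have lin: "linear D" using assms by (rule has_derivative_linear)
  have "((\<lambda>t. x + t *\<^sub>R v) has_derivative (\<lambda>t. t *\<^sub>R v)) (at 0)"
    by (auto intro!: derivative_eq_intros)
  from diff_chain_at[OF this, of f D] assms
  have "((\<lambda>t. f (x + t *\<^sub>R v)) has_derivative (\<lambda>t. D (t *\<^sub>R v))) (at 0)"
    by (simp add: o_def)
  then show ?thesis
    unfolding has_field_derivative_def using linear_scale[OF lin] by (simp add: mult_commute_abs)
qed

text \<open>Presents a directional derivative as the limit of a sequence, for use in measurability
  proofs. The offset \<open>N\<close> allows steps short enough to remain in a given open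
  set.\<close>

lemma has_derivative_quotient_LIMSEQ:
  fixes f :: "'a::euclidean_space \<Rightarrow> real"
  assumes "(f has_derivative D) (at x)"
  shows "(\<lambda>n. real (n + Suc N) * (f (x + (1 / real (n + Suc N)) *\<^sub>R v) - f x)) \<longlonglongrightarrow> D v"
proof -
  have "((\<lambda>h. (f (x + h *\<^sub>R v) - f x) / h) \<longlongrightarrow> D v) (at 0)"
    using has_derivative_direction[OF assms, of v]
    by (simp add: DERIV_def)
  moreover have "filterlim (\<lambda>n. 1 / real (n + Suc N)) (at 0) sequentially"
  proof -
    have "(\<lambda>n. 1 / real (n + Suc N)) \<longlonglongrightarrow> 0"
      using LIMSEQ_ignore_initial_segment[OF lim_1_over_n, of "Suc N"] by simp
    then show ?thesis unfolding filterlim_at by (auto simp: eventually_sequentially)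
  qed
  ultimately have "(\<lambda>n. (f (x + (1 / real (n + Suc N)) *\<^sub>R v) - f x) / (1 / real (n + Suc N))) \<longlonglongrightarrow> D v"
    by (rule filterlim_compose)
  then show ?thesis by (simp add: mult.commute)
qed

text \<open>Measurability in the parameter passes from the values to the derivative, which is a
  pointwise limit of difference quotients. Thus it need not be carried as a separate property of
  every derivative.\<close>

lemma set_borel_measurable_frechet:
  fixes f :: "'th \<Rightarrow> 'a::euclidean_space \<Rightarrow> real"
  assumes S: "open S" "x \<in> S"
    and d: "\<And>\<theta>. \<theta> \<in> \<Theta> \<Longrightarrow> (f \<theta> has_derivative f' \<theta>) (at x)"
    and f: "\<And>y. y \<in> S \<Longrightarrow> set_borel_measurable M \<Theta> (\<lambda>\<theta>. f \<theta> y)"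
  shows "set_borel_measurable M \<Theta> (\<lambda>\<theta>. f' \<theta> v)"
proof -
  have "(\<lambda>n. x + (1 / real (Suc n)) *\<^sub>R v) \<longlonglongrightarrow> x + 0 *\<^sub>R v"
    by (intro tendsto_intros LIMSEQ_inverse_real_of_nat[unfolded inverse_eq_divide])
  then have "eventually (\<lambda>n. x + (1 / real (Suc n)) *\<^sub>R v \<in> S) sequentially"
    using S by (simp add: topological_tendstoD)
  then obtain N where N: "\<And>n. n \<ge> N \<Longrightarrow> x + (1 / real (Suc n)) *\<^sub>R v \<in> S"
    unfolding eventually_sequentially by blast
  have [measurable]: "(\<lambda>\<theta>. indicator \<Theta> \<theta> *\<^sub>R f \<theta> (x + (1 / real (n + Suc N)) *\<^sub>R v)) \<in> borel_measurable M" for n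
    using f[OF N[of "n+N"]] by (simp add: set_borel_measurable_def)
  have [measurable]: "(\<lambda>\<theta>. indicator \<Theta> \<theta> *\<^sub>R f \<theta> x) \<in> borel_measurable M"
    using f[OF S(2)] by (simp add: set_borel_measurable_def)
  show ?thesis unfolding set_borel_measurable_def
  proof (rule borel_measurable_LIMSEQ_real)
    show "(\<lambda>n. real (n + Suc N) * (indicator \<Theta> \<theta> *\<^sub>R f \<theta> (x + (1 / real (n + Suc N)) *\<^sub>R v) - indicator \<Theta> \<theta> *\<^sub>R f \<theta> x))
        \<longlonglongrightarrow> indicat_real \<Theta> \<theta> *\<^sub>R f' \<theta> v" for \<theta>
      using has_derivative_quotient_LIMSEQ[OF d[of \<theta>], of N v] by (cases "\<theta> \<in> \<Theta>") auto
  qed measurable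
qed

lemma linear_bound_Basis:
  fixes D :: "'a::euclidean_space \<Rightarrow> real"
  assumes "linear D" "\<And>b. b \<in> Basis \<Longrightarrow> \<bar>D b\<bar> \<le> K b"
  shows "\<bar>D v\<bar> \<le> (\<Sum>b\<in>Basis. K b) * norm v"
proof -
  have "D v = D (\<Sum>b\<in>Basis. (v \<bullet> b) *\<^sub>R b)" by (simp add: euclidean_representation)
  also have "\<dots> = (\<Sum>b\<in>Basis. (v \<bullet> b) * D b)"
    using assms(1) by (simp add: linear_sum linear_scale)
  also have "\<bar>\<dots>\<bar> \<le> (\<Sum>b\<in>Basis. \<bar>(v \<bullet> b) * D b\<bar>)" by (rule sum_abs)
  also have "\<dots> \<le> (\<Sum>b\<in>Basis. norm v * K b)"
    by (intro sum_mono) (auto simp: abs_mult Basis_le_norm assms(2) intro!: mult_mono)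
  finally show ?thesis by (simp add: sum_distrib_left mult.commute)
qed

text \<open>In \<open>bounded_Ck\<close> the constants depend on the direction. By linearity the
  finitely many basis directions control all of them, which gives the operator bound that dominated
  convergence needs.\<close>

lemma bounded_Ck_derivative_bound:
  assumes F: "bounded_Ck (Suc k) S W w F" and w: "\<And>\<omega> x. \<omega> \<in> W \<Longrightarrow> x \<in> S \<Longrightarrow> 0 \<le> w \<omega> x"
  shows "\<exists>C. \<forall>\<omega>\<in>W. \<forall>x\<in>S. \<forall>v. \<bar>frechet_derivative (F \<omega>) (at x) v\<bar> \<le> C * w \<omega> x * norm v"
proof -
  have "\<forall>v. \<exists>C. \<forall>\<omega>\<in>W. \<forall>x\<in>S. \<bar>frechet_derivative (F \<omega>) (at x) v\<bar> \<le> C * w \<omega> x"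
    using bounded_Ck_bound[OF bounded_Ck_frechet[OF F]] by simp
  then obtain K where K: "\<And>v \<omega> x. \<omega> \<in> W \<Longrightarrow> x \<in> S \<Longrightarrow> \<bar>frechet_derivative (F \<omega>) (at x) v\<bar> \<le> K v * w \<omega> x"
    by metis
  have "\<bar>frechet_derivative (F \<omega>) (at x) v\<bar> \<le> (\<Sum>b\<in>Basis. K b) * w \<omega> x * norm v" if "\<omega> \<in> W" "x \<in> S" for \<omega> x v
  proof -
    have "linear (frechet_derivative (F \<omega>) (at x))"
      using bounded_Ck_has_derivative[OF F that] by (rule has_derivative_linear)
    from linear_bound_Basis[OF this K[OF that]] show ?thesis by (simp add: sum_distrib_right)
  qed
  then show ?thesis by blast
qed

text \<open>The weight does not depend on \<open>x\<close>, so it dominates the integrand and all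
  its derivatives at once, and its integral is the new weight. The family is assumed bounded at all
  orders so that the derivative family satisfies the same hypothesis in the induction.\<close>

lemma bounded_Ck_set_integral:
  fixes f :: "'w \<Rightarrow> 'th \<Rightarrow> 'a::euclidean_space \<Rightarrow> real"
  assumes S: "open S" and \<Theta>: "\<Theta> \<in> sets M"
    and f: "\<And>k. bounded_Ck k S (W \<times> \<Theta>) (\<lambda>p x. w (fst p) (snd p)) (\<lambda>p. f (fst p) (snd p))"
    and m: "\<And>\<omega> x. \<omega> \<in> W \<Longrightarrow> x \<in> S \<Longrightarrow> set_borel_measurable M \<Theta> (\<lambda>\<theta>. f \<omega> \<theta> x)"
    and w: "\<And>\<omega>. \<omega> \<in> W \<Longrightarrow> set_integrable M \<Theta> (w \<omega>)"
    and w0: "\<And>\<omega> \<theta>. \<omega> \<in> W \<Longrightarrow> \<theta> \<in> \<Theta> \<Longrightarrow> 0 \<le> w \<omega> \<theta>"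
    and w': "\<And>\<omega>. \<omega> \<in> W \<Longrightarrow> (LINT \<theta>:\<Theta>|M. w \<omega> \<theta>) \<le> C * w' \<omega>"
  shows "bounded_Ck k S W (\<lambda>\<omega> x. w' \<omega>) (\<lambda>\<omega> x. LINT \<theta>:\<Theta>|M. f \<omega> \<theta> x)"
  using f m
proof (induction k arbitrary: f)
  have int: "set_integrable M \<Theta> (\<lambda>\<theta>. f \<omega> \<theta> x)"
    if b: "\<And>\<omega> \<theta> x. \<omega> \<in> W \<Longrightarrow> \<theta> \<in> \<Theta> \<Longrightarrow> x \<in> S \<Longrightarrow> \<bar>f \<omega> \<theta> x\<bar> \<le> B * w \<omega> \<theta>"
      and m: "\<And>\<omega> x. \<omega> \<in> W \<Longrightarrow> x \<in> S \<Longrightarrow> set_borel_measurable M \<Theta> (\<lambda>\<theta>. f \<omega> \<theta> x)"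
      and "\<omega> \<in> W" "x \<in> S" for f :: "'w \<Rightarrow> 'th \<Rightarrow> 'a \<Rightarrow> real" and B \<omega> x
  proof (rule set_integrable_bound)
    show "set_integrable M \<Theta> (\<lambda>\<theta>. B * w \<omega> \<theta>)" using w[OF that(3)] by simp
    show "AE \<theta> in M. \<theta> \<in> \<Theta> \<longrightarrow> norm (f \<omega> \<theta> x) \<le> norm (B * w \<omega> \<theta>)"
      using b[OF that(3) _ that(4)] by (intro AE_I2) (force intro: order_trans[OF _ abs_ge_self])
  qed (rule m[OF that(3,4)])
  have bound: "\<exists>D. (\<forall>\<omega>\<in>W. \<forall>\<theta>\<in>\<Theta>. \<forall>x\<in>S. \<bar>f \<omega> \<theta> x\<bar> \<le> D * w \<omega> \<theta>)"
    if "bounded_Ck 0 S (W \<times> \<Theta>) (\<lambda>p x. w (fst p) (snd p)) (\<lambda>p. f (fst p) (snd p))"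
    for f :: "'w \<Rightarrow> 'th \<Rightarrow> 'a \<Rightarrow> real"
    using that by auto
  have ibound: "\<bar>LINT \<theta>:\<Theta>|M. f \<omega> \<theta> x\<bar> \<le> \<bar>B\<bar> * C * w' \<omega>"
    if b: "\<And>\<omega> \<theta> x. \<omega> \<in> W \<Longrightarrow> \<theta> \<in> \<Theta> \<Longrightarrow> x \<in> S \<Longrightarrow> \<bar>f \<omega> \<theta> x\<bar> \<le> B * w \<omega> \<theta>"
      and m: "\<And>\<omega> x. \<omega> \<in> W \<Longrightarrow> x \<in> S \<Longrightarrow> set_borel_measurable M \<Theta> (\<lambda>\<theta>. f \<omega> \<theta> x)"
      and "\<omega> \<in> W" "x \<in> S" for f :: "'w \<Rightarrow> 'th \<Rightarrow> 'a \<Rightarrow> real" and B \<omega> x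
  proof -
    have "norm (LINT \<theta>:\<Theta>|M. f \<omega> \<theta> x) \<le> (LINT \<theta>:\<Theta>|M. norm (f \<omega> \<theta> x))"
      by (rule set_integral_norm_bound) (rule int[OF that])
    also have "\<dots> \<le> (LINT \<theta>:\<Theta>|M. \<bar>B\<bar> * w \<omega> \<theta>)"
    proof (rule set_integral_mono)
      show "norm (f \<omega> \<theta> x) \<le> \<bar>B\<bar> * w \<omega> \<theta>" if "\<theta> \<in> \<Theta>" for \<theta>
        using b[OF \<open>\<omega> \<in> W\<close> that \<open>x \<in> S\<close>] mult_right_mono[OF abs_ge_self w0[OF \<open>\<omega> \<in> W\<close> that], of B] by simp
      show "set_integrable M \<Theta> (\<lambda>\<theta>. norm (f \<omega> \<theta> x))"
        by (rule set_integrable_norm) (rule int[OF that])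
    qed (use w[OF that(3)] in simp)
    also have "\<dots> = \<bar>B\<bar> * (LINT \<theta>:\<Theta>|M. w \<omega> \<theta>)" by simp
    also have "\<dots> \<le> \<bar>B\<bar> * (C * w' \<omega>)" using w'[OF that(3)] by (intro mult_left_mono) auto
    finally show ?thesis by (simp add: mult.assoc)
  qed
  {
    case 0
    obtain B where "\<forall>\<omega>\<in>W. \<forall>\<theta>\<in>\<Theta>. \<forall>x\<in>S. \<bar>f \<omega> \<theta> x\<bar> \<le> B * w \<omega> \<theta>"
      using bound[OF 0(1)] by (rule exE)
    then have "\<And>\<omega> x. \<omega> \<in> W \<Longrightarrow> x \<in> S \<Longrightarrow> \<bar>LINT \<theta>:\<Theta>|M. f \<omega> \<theta> x\<bar> \<le> \<bar>B\<bar> * C * w' \<omega>"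
      by (intro ibound 0(2)) auto
    then show ?case unfolding bounded_Ck.simps by (intro exI[of _ "\<bar>B\<bar> * C"] ballI)
  next
    case (Suc k)
    define f' where "f' \<omega> \<theta> x = frechet_derivative (f \<omega> \<theta>) (at x)" for \<omega> \<theta> x
    have d: "(f \<omega> \<theta> has_derivative f' \<omega> \<theta> x) (at x)" if "\<omega> \<in> W" "\<theta> \<in> \<Theta>" "x \<in> S" for \<omega> \<theta> x
      using bounded_Ck_has_derivative[OF Suc.prems(1)[of "Suc 0"], of "(\<omega>,\<theta>)" x] that by (simp add: f'_def)
    obtain B where B: "\<forall>\<omega>\<in>W. \<forall>\<theta>\<in>\<Theta>. \<forall>x\<in>S. \<bar>f \<omega> \<theta> x\<bar> \<le> B * w \<omega> \<theta>"
      using bound[OF Suc.prems(1)] by (rule exE)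
    obtain B' where B': "\<forall>p\<in>W \<times> \<Theta>. \<forall>x\<in>S. \<forall>v. \<bar>frechet_derivative (f (fst p) (snd p)) (at x) v\<bar> \<le> B' * w (fst p) (snd p) * norm v"
      using bounded_Ck_derivative_bound[OF Suc.prems(1)[of "Suc 0"]] w0 by auto
    have m': "set_borel_measurable M \<Theta> (\<lambda>\<theta>. f' \<omega> \<theta> x v)" if "\<omega> \<in> W" "x \<in> S" for \<omega> x v
      by (rule set_borel_measurable_frechet[OF S that(2) d Suc.prems(2)]) (use that in auto)
    show ?case
    proof (rule bounded_Ck_SucI[OF S])
      show "\<bar>LINT \<theta>:\<Theta>|M. f \<omega> \<theta> x\<bar> \<le> \<bar>B\<bar> * C * w' \<omega>" if "\<omega> \<in> W" "x \<in> S" for \<omega> x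
        using B by (intro ibound Suc.prems(2) that) auto
      show "((\<lambda>x. LINT \<theta>:\<Theta>|M. f \<omega> \<theta> x) has_derivative (\<lambda>v. LINT \<theta>:\<Theta>|M. f' \<omega> \<theta> x v)) (at x)"
        if "\<omega> \<in> W" "x \<in> S" for \<omega> x
      proof (rule has_derivative_set_integral[OF S that(2) \<Theta>, where B="\<lambda>\<theta>. B' * w \<omega> \<theta>"])
        show "\<bar>f' \<omega> \<theta> y v\<bar> \<le> B' * w \<omega> \<theta> * norm v" if "\<theta> \<in> \<Theta>" "y \<in> S" for \<theta> y v
          using B' that \<open>\<omega> \<in> W\<close> by (auto simp: f'_def)
        show "set_integrable M \<Theta> (\<lambda>\<theta>. f \<omega> \<theta> y)" if "y \<in> S" for y
          using B by (intro int[of f B] Suc.prems(2) that \<open>\<omega> \<in> W\<close>) auto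
      qed (use that d m' w in auto)
      show "bounded_Ck k S W (\<lambda>\<omega> x. w' \<omega>) (\<lambda>\<omega> x. LINT \<theta>:\<Theta>|M. f' \<omega> \<theta> x v)" for v
      proof (rule Suc.IH)
        show "bounded_Ck k S (W \<times> \<Theta>) (\<lambda>p x. w (fst p) (snd p)) (\<lambda>p x. f' (fst p) (snd p) x v)" for k
          unfolding f'_def by (rule bounded_Ck_frechet) (rule Suc.prems(1))
      qed (rule m')
    qed
  }
qed

section \<open>Derivatives of the kernels\<close>

text \<open>Connects the partial derivatives of the definitions, taken along lines, with total
  derivatives; all later formulas for \<open>pd\<close> come from here.\<close>

lemma pderiv_dir_has_derivative:
  "(f has_derivative D) (at x) \<Longrightarrow> pderiv_dir v f x = D v"
  unfolding pderiv_dir_def by (rule DERIV_imp_deriv[OF has_derivative_direction])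

lemma pd_has_derivative:
  "(f has_derivative D) (at x) \<Longrightarrow> pd i f x = D (unit_dir i)"
  unfolding pd_def by (rule pderiv_dir_has_derivative)

section \<open>Powers of the norm and the Laplace kernel away from the origin\<close>

lemma has_derivative_norm_powr:
  fixes y :: "'a::euclidean_space"
  assumes "y \<noteq> 0"
  shows "((\<lambda>y. norm y powr a) has_derivative (\<lambda>v. a * ((y \<bullet> v) / (norm y)\<^sup>2) * norm y powr a)) (at y)"
proof -
  have n: "norm y > 0" using assms by simp
  have "((\<lambda>z. z powr a) has_derivative (*) (a * norm y powr (a - 1))) (at (norm y))"
    using has_real_derivative_powr[OF n] unfolding has_field_derivative_def .
  from diff_chain_at[OF has_derivative_norm[OF assms] this]
  have "((\<lambda>y. norm y powr a) has_derivative (\<lambda>v. a * norm y powr (a - 1) * (sgn y \<bullet> v))) (at y)"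
    by (simp add: o_def inner_commute)
  moreover have "a * norm y powr (a - 1) * (sgn y \<bullet> v) = a * ((y \<bullet> v) / (norm y)\<^sup>2) * norm y powr a" for v
    using n by (simp add: sgn_div_norm powr_diff power2_eq_square field_simps)
  ultimately show ?thesis by simp
qed

lemma has_derivative_ln_norm:
  fixes y :: "'a::euclidean_space"
  assumes "y \<noteq> 0"
  shows "((\<lambda>y. ln (norm y)) has_derivative (\<lambda>v. (y \<bullet> v) / (norm y)\<^sup>2)) (at y)"
proof -
  have n: "norm y > 0" using assms by simp
  have "(ln has_derivative (*) (1 / norm y)) (at (norm y))"
    using DERIV_ln_divide[OF n] unfolding has_field_derivative_def .
  from diff_chain_at[OF has_derivative_norm[OF assms] this]
  have "((\<lambda>y. ln (norm y)) has_derivative (\<lambda>v. (1 / norm y) * (sgn y \<bullet> v))) (at y)"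
    by (simp add: o_def inner_commute)
  moreover have "(1 / norm y) * (sgn y \<bullet> v) = (y \<bullet> v) / (norm y)\<^sup>2" for v
    using n by (simp add: sgn_div_norm power2_eq_square field_simps)
  ultimately show ?thesis by simp
qed

lemma has_derivative_inner_div_norm2:
  fixes y :: "'a::euclidean_space"
  assumes "y \<noteq> 0"
  shows "((\<lambda>y. (y \<bullet> u) / (norm y)\<^sup>2) has_derivative
     (\<lambda>v. (u \<bullet> v) * norm y powr (- 2) + (- 2) * (((y \<bullet> u) / (norm y)\<^sup>2) * ((y \<bullet> v) / (norm y)\<^sup>2)))) (at y)"
proof -
  have n: "norm y > 0" using assms by simp
  have p: "norm z powr (-2) = 1 / (norm z)\<^sup>2" for z :: 'a
    by (simp add: powr_minus_divide powr_numeral)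
  have "((\<lambda>y. (y \<bullet> u) * norm y powr (-2)) has_derivative
     (\<lambda>v. (y \<bullet> u) * (-2 * ((y \<bullet> v) / (norm y)\<^sup>2) * norm y powr (-2)) + (v \<bullet> u) * norm y powr (-2))) (at y)"
    by (intro has_derivative_mult has_derivative_norm_powr[OF assms] has_derivative_inner_left has_derivative_ident)
  then show ?thesis using n by (simp add: p inner_commute algebra_simps)
qed

lemma norm_gt_imp_nonzero: "c > 0 \<Longrightarrow> norm y > c \<Longrightarrow> y \<noteq> 0"
  for y :: "'a::real_normed_vector"
  by auto

lemma open_norm_gt: "open {y::'a::euclidean_space. norm y > c}"
  by (intro open_Collect_less continuous_intros)

text \<open>Derivatives of these functions are polynomials in functions of the same two kinds, so
  one induction carries both claims. The functions themselves are bounded for norm y > c: the powers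
  because the exponent is not positive, the quotients because they are at most norm u / norm
  y.\<close>

lemma bounded_Ck_norm_powr_inner:
  fixes u :: "'a::euclidean_space"
  assumes c: "c > 0"
  shows "(\<forall>q\<ge>0. bounded_Ck k {y::'a. norm y > c} {()} (\<lambda>_ _. 1) (\<lambda>_ y. norm y powr (- q))) \<and>
    (\<forall>u. bounded_Ck k {y::'a. norm y > c} {()} (\<lambda>_ _. 1) (\<lambda>_ y. (y \<bullet> u) / (norm y)\<^sup>2))"
proof -
  have b1: "\<bar>norm y powr (- q)\<bar> \<le> c powr (- q) * 1" if "q \<ge> 0" "norm y > c" for y :: 'a and q
    using that c by (auto intro!: powr_mono2')
  have b2: "\<bar>(y \<bullet> u) / (norm y)\<^sup>2\<bar> \<le> norm u / c * 1" if "norm y > c" for y u :: 'a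
  proof -
    have n: "norm y > 0" using that c by linarith
    have "\<bar>(y \<bullet> u) / (norm y)\<^sup>2\<bar> \<le> (norm y * norm u) / (norm y)\<^sup>2"
      using Cauchy_Schwarz_ineq2[of y u] by (simp add: divide_right_mono)
    also have "\<dots> = norm u / norm y" using n by (simp add: power2_eq_square)
    also have "\<dots> \<le> norm u / c" using that c n by (intro divide_left_mono mult_pos_pos) auto
    finally show ?thesis by simp
  qed
  show ?thesis
  proof (induction k)
    case 0
    show ?case unfolding bounded_Ck.simps using b1 b2 by blast
  next
    case (Suc k)
    have nz: "y \<noteq> 0" if "y \<in> {y::'a. norm y > c}" for y :: 'a
      using that norm_gt_imp_nonzero[OF c] by blast
    have IH1: "bounded_Ck k {y::'a. norm y > c} {()} (\<lambda>_ _. 1) (\<lambda>_ y. norm y powr (- q))" if "q \<ge> 0" for q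
      using Suc that by simp
    have IH2: "bounded_Ck k {y::'a. norm y > c} {()} (\<lambda>_ _. 1) (\<lambda>_ y. (y \<bullet> u) / (norm y)\<^sup>2)" for u
      using Suc by simp
    note m = bounded_Ck_mult[OF open_norm_gt, where w="\<lambda>_ _. 1" and u="\<lambda>_ _. 1", simplified]
    note sc = bounded_Ck_scale[OF open_norm_gt, where w="\<lambda>_ _. 1", simplified]
    show ?case
    proof (intro conjI allI impI)
      fix q :: real assume q: "q \<ge> 0"
      show "bounded_Ck (Suc k) {y::'a. norm y > c} {()} (\<lambda>_ _. 1) (\<lambda>_ y. norm y powr (- q))"
      proof (rule bounded_Ck_SucI[OF open_norm_gt])
        show "bounded_Ck k {y::'a. norm y > c} {()} (\<lambda>_ _. 1)
          (\<lambda>_ y. - q * ((y \<bullet> v) / (norm y)\<^sup>2) * norm y powr (- q))" for v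
          by (intro sc m IH1 IH2 q)
        show "\<bar>norm y powr (- q)\<bar> \<le> c powr (- q) * 1" if "y \<in> {y. norm y > c}" for y :: 'a
          using b1 q that by auto
        show "((\<lambda>y. norm y powr (- q)) has_derivative (\<lambda>v. - q * ((y \<bullet> v) / (norm y)\<^sup>2) * norm y powr (- q))) (at y)"
          if "y \<in> {y. norm y > c}" for y :: 'a
          by (rule has_derivative_norm_powr[OF nz[OF that]])
      qed
    next
      fix u :: 'a
      show "bounded_Ck (Suc k) {y::'a. norm y > c} {()} (\<lambda>_ _. 1) (\<lambda>_ y. (y \<bullet> u) / (norm y)\<^sup>2)"
      proof (rule bounded_Ck_SucI[OF open_norm_gt])
        show "bounded_Ck k {y::'a. norm y > c} {()} (\<lambda>_ _. 1)
          (\<lambda>_ y. (u \<bullet> v) * norm y powr (- 2) + (- 2) * (((y \<bullet> u) / (norm y)\<^sup>2) * ((y \<bullet> v) / (norm y)\<^sup>2)))" for v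
          by (intro bounded_Ck_add[OF open_norm_gt] sc m IH1 IH2) simp
        show "\<bar>(y \<bullet> u) / (norm y)\<^sup>2\<bar> \<le> norm u / c * 1" if "y \<in> {y. norm y > c}" for y :: 'a
          using b2 that by simp
        show "((\<lambda>y. (y \<bullet> u) / (norm y)\<^sup>2) has_derivative
          (\<lambda>v. (u \<bullet> v) * norm y powr (- 2) + (- 2) * (((y \<bullet> u) / (norm y)\<^sup>2) * ((y \<bullet> v) / (norm y)\<^sup>2)))) (at y)"
          if "y \<in> {y. norm y > c}" for y :: 'a
          by (rule has_derivative_inner_div_norm2[OF nz[OF that]])
      qed
    qed
  qed
qed

lemmas bounded_Ck_norm_powr = bounded_Ck_norm_powr_inner[THEN conjunct1, rule_format]
  and bounded_Ck_inner_div_norm2 = bounded_Ck_norm_powr_inner[THEN conjunct2, rule_format]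

text \<open>In every dimension \<nabla>E is a multiple of y / |y|^n. Splitting off |y|^(2 - n)
  produces the generators treated above, and for n = 2 this power is 1, so that the logarithm fits
  the same formula. The value of \<kappa> is irrelevant for regularity.\<close>

lemma has_derivative_laplace_kernel:
  "\<exists>\<kappa>. \<forall>y::'a::euclidean_space. y \<noteq> 0 \<longrightarrow> (laplace_kernel has_derivative
    (\<lambda>v. \<kappa> * ((y \<bullet> v) / (norm y)\<^sup>2) * norm y powr (2 - real DIM('a)))) (at y)"
proof (cases "DIM('a) = 2")
  case True
  have "(laplace_kernel has_derivative (\<lambda>v. - (1 / (2 * pi)) * ((y \<bullet> v) / (norm y)\<^sup>2) * norm y powr (2 - real DIM('a)))) (at y)"
    if "y \<noteq> 0" for y :: 'a
    using has_derivative_mult_right[OF has_derivative_ln_norm[OF that], of "- (1 / (2 * pi))"] that True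
    by (simp add: laplace_kernel_def[abs_def])
  then show ?thesis by blast
next
  case False
  let ?C = "1 / (real DIM('a) * (real DIM('a) - 2) * measure lebesgue (ball (0::'a) 1))"
  have "(laplace_kernel has_derivative (\<lambda>v. ?C * (2 - real DIM('a)) * ((y \<bullet> v) / (norm y)\<^sup>2) * norm y powr (2 - real DIM('a)))) (at y)"
    if "y \<noteq> 0" for y :: 'a
    using has_derivative_mult_right[OF has_derivative_norm_powr[OF that], of ?C] False
    by (simp add: laplace_kernel_def[abs_def] mult.assoc)
  then show ?thesis by blast
qed

lemma pd_laplace_kernel:
  "\<exists>\<kappa>. \<forall>i (y :: 'm::finite space). y \<noteq> 0 \<longrightarrow>
    pd i laplace_kernel y = \<kappa> * ((y \<bullet> unit_dir i) / (norm y)\<^sup>2) * norm y powr (1 - real CARD('m))"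
proof -
  obtain \<kappa> where "\<And>y::'m space. y \<noteq> 0 \<Longrightarrow> (laplace_kernel has_derivative
    (\<lambda>v. \<kappa> * ((y \<bullet> v) / (norm y)\<^sup>2) * norm y powr (2 - real DIM('m space)))) (at y)"
    using has_derivative_laplace_kernel[where 'a="'m space"] by blast
  then have "pd i laplace_kernel y = \<kappa> * ((y \<bullet> unit_dir i) / (norm y)\<^sup>2) * norm y powr (1 - real CARD('m))"
    if "y \<noteq> 0" for i and y :: "'m space"
    using pd_has_derivative[of laplace_kernel _ y i] that by fastforce
  then show ?thesis by blast
qed

lemma bounded_Ck_pd_laplace_kernel:
  assumes c: "c > 0"
  shows "bounded_Ck k {y::'m::finite space. norm y > c} {()} (\<lambda>_ _. 1) (\<lambda>_. pd i laplace_kernel)"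
proof -
  obtain \<kappa> where \<kappa>: "\<And>i (y :: 'm space). y \<noteq> 0 \<Longrightarrow>
    pd i laplace_kernel y = \<kappa> * ((y \<bullet> unit_dir i) / (norm y)\<^sup>2) * norm y powr (1 - real CARD('m))"
    using pd_laplace_kernel[where 'm='m] by blast
  note m = bounded_Ck_mult[OF open_norm_gt, where w="\<lambda>_ _. 1" and u="\<lambda>_ _. 1", simplified]
  note sc = bounded_Ck_scale[OF open_norm_gt, where w="\<lambda>_ _. 1", simplified]
  \<comment> \<open>With n = CARD('m) + 1 the exponent 2 - n is the negative of CARD('m) - 1 \<ge>
    0, the form in which powers are known to be bounded.\<close>
  have "bounded_Ck k {y::'m space. norm y > c} {()} (\<lambda>_ _. 1)
     (\<lambda>_ y. \<kappa> * ((y \<bullet> unit_dir i) / (norm y)\<^sup>2) * norm y powr (- (real CARD('m) - 1)))"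
    by (intro sc m bounded_Ck_inner_div_norm2 bounded_Ck_norm_powr c) simp
  then show ?thesis
  proof (rule bounded_Ck_cong[OF open_norm_gt, rotated])
    show "\<kappa> * ((y \<bullet> unit_dir i) / (norm y)\<^sup>2) * norm y powr (- (real CARD('m) - 1)) = pd i laplace_kernel y"
      if "y \<in> {y. norm y > c}" for y
      using \<kappa>[of y i] norm_gt_imp_nonzero[OF c, of y] that by simp
  qed
qed

text \<open>The logarithm in dimension two is unbounded at infinity, so a growing weight is
  unavoidable. A linear one is crude, but it is only ever integrated against Gaussians or used on
  bounded sets.\<close>

lemma laplace_kernel_growth:
  assumes c: "c > 0" and D: "DIM('a::euclidean_space) \<ge> 2"
  obtains C where "\<And>y::'a. norm y > c \<Longrightarrow> \<bar>laplace_kernel y\<bar> \<le> C * (1 + norm y)"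
proof (cases "DIM('a) = 2")
  case True
  have "\<bar>laplace_kernel y\<bar> \<le> (1 / (2 * pi) * (1 + \<bar>ln c\<bar>)) * (1 + norm y)" if "norm y > c" for y :: 'a
  proof -
    have "\<bar>ln (norm y)\<bar> \<le> norm y + \<bar>ln c\<bar>"
      using that c ln_le_minus_one[of "norm y"] ln_less_cancel_iff[of c "norm y"] by linarith
    also have "\<dots> \<le> (1 + \<bar>ln c\<bar>) * (1 + norm y)" by (simp add: algebra_simps)
    finally show ?thesis using True
      by (simp add: laplace_kernel_def abs_mult mult.assoc divide_right_mono)
  qed
  then show ?thesis by (rule that)
next
  case False
  let ?C = "1 / (real DIM('a) * (real DIM('a) - 2) * measure lebesgue (ball (0::'a) 1))"
  have "\<bar>laplace_kernel y\<bar> \<le> (\<bar>?C\<bar> * c powr (2 - real DIM('a))) * (1 + norm y)" if "norm y > c" for y :: 'a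
  proof -
    have "norm y powr (2 - real DIM('a)) \<le> c powr (2 - real DIM('a))"
      using that c D by (intro powr_mono2') auto
    then have "\<bar>laplace_kernel y\<bar> \<le> \<bar>?C\<bar> * c powr (2 - real DIM('a))"
      using False by (simp only: laplace_kernel_def if_False abs_mult) (intro mult_left_mono, auto)
    also have "\<dots> \<le> (\<bar>?C\<bar> * c powr (2 - real DIM('a))) * (1 + norm y)"
      using mult_left_mono[of 1 "1 + norm y" "\<bar>?C\<bar> * c powr (2 - real DIM('a))"] by simp
    finally show ?thesis .
  qed
  then show ?thesis by (rule that)
qed

text \<open>Only E itself grows. Its derivatives satisfy the bound with weight 1, which is then
  enlarged to the common weight.\<close>

lemma bounded_Ck_laplace_kernel:
  assumes c: "c > 0"
  shows "bounded_Ck k {y::'m::finite space. norm y > c} {()} (\<lambda>_ y. 1 + norm y) (\<lambda>_. laplace_kernel)"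
proof (cases k)
  obtain C where C: "\<And>y::'m space. norm y > c \<Longrightarrow> \<bar>laplace_kernel y\<bar> \<le> C * (1 + norm y)"
    by (rule laplace_kernel_growth[OF c, where 'a="'m space"]) auto
  {
    case 0
    then show ?thesis using C by auto
  next
    case (Suc l)
    obtain \<kappa> where \<kappa>: "\<And>y::'m space. y \<noteq> 0 \<Longrightarrow> (laplace_kernel has_derivative
      (\<lambda>v. \<kappa> * ((y \<bullet> v) / (norm y)\<^sup>2) * norm y powr (2 - real DIM('m space)))) (at y)"
      using has_derivative_laplace_kernel[where 'a="'m space"] by blast
    note m = bounded_Ck_mult[OF open_norm_gt, where w="\<lambda>_ _. 1" and u="\<lambda>_ _. 1", simplified]
    note sc = bounded_Ck_scale[OF open_norm_gt, where w="\<lambda>_ _. 1", simplified]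
    show ?thesis unfolding Suc
    proof (rule bounded_Ck_SucI[OF open_norm_gt, where C=C])
      show "bounded_Ck l {y::'m space. norm y > c} {()} (\<lambda>_ y. 1 + norm y)
        (\<lambda>_ y. \<kappa> * ((y \<bullet> v) / (norm y)\<^sup>2) * norm y powr (2 - real DIM('m space)))" for v
      proof (rule bounded_Ck_weight[where w="\<lambda>_ _. 1" and B=1])
        have "bounded_Ck l {y::'m space. norm y > c} {()} (\<lambda>_ _. 1)
          (\<lambda>_ y. \<kappa> * ((y \<bullet> v) / (norm y)\<^sup>2) * norm y powr (- (real DIM('m space) - 2)))"
          by (intro sc m bounded_Ck_inner_div_norm2 bounded_Ck_norm_powr c) simp
        then show "bounded_Ck l {y::'m space. norm y > c} {()} (\<lambda>_ _. 1)
          (\<lambda>_ y. \<kappa> * ((y \<bullet> v) / (norm y)\<^sup>2) * norm y powr (2 - real DIM('m space)))" by simp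
      qed auto
      show "(laplace_kernel has_derivative
          (\<lambda>v. \<kappa> * ((y \<bullet> v) / (norm y)\<^sup>2) * norm y powr (2 - real DIM('m space)))) (at y)"
        if "y \<in> {y. norm y > c}" for y :: "'m space"
        by (rule \<kappa>) (use norm_gt_imp_nonzero[OF c] that in blast)
    qed (use C in auto)
  }
qed

section \<open>The heat kernel away from the origin, uniformly in small times\<close>

lemma heat_kernel_pos:
  "t > 0 \<Longrightarrow> heat_kernel (x::'a::euclidean_space) t = (4 * pi) powr (- real DIM('a) / 2) * (t powr (- real DIM('a) / 2) * exp (- (norm x)\<^sup>2 / (4 * t)))"
  by (simp add: heat_kernel_def powr_mult)

lemma has_derivative_exp_norm2:
  "((\<lambda>y::'a::euclidean_space. exp (- (norm y)\<^sup>2 / (4 * t))) has_derivative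
     (\<lambda>v. - (y \<bullet> v) / (2 * t) * exp (- (norm y)\<^sup>2 / (4 * t)))) (at y)"
proof -
  have "((\<lambda>y::'a. exp (- (y \<bullet> y) / (4 * t))) has_derivative
     (\<lambda>v. (- (y \<bullet> v + v \<bullet> y) / (4 * t)) * exp (- (y \<bullet> y) / (4 * t)))) (at y)"
  proof (rule has_derivative_exp)
    have "((\<lambda>y::'a. (- 1 / (4 * t)) * (y \<bullet> y)) has_derivative (\<lambda>v. (- 1 / (4 * t)) * (y \<bullet> v + v \<bullet> y))) (at y)"
      by (intro has_derivative_mult_right has_derivative_inner has_derivative_ident)
    then show "((\<lambda>y::'a. - (y \<bullet> y) / (4 * t)) has_derivative (\<lambda>v. - (y \<bullet> v + v \<bullet> y) / (4 * t))) (at y)"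
      by (simp add: add_divide_distrib diff_divide_distrib)
  qed
  then show ?thesis by (simp add: power2_norm_eq_inner inner_commute mult.commute)
qed

lemma has_derivative_heat_kernel:
  fixes y :: "'a::euclidean_space"
  assumes "t > 0"
  shows "((\<lambda>y. heat_kernel y t) has_derivative (\<lambda>v. - (y \<bullet> v) / (2 * t) * heat_kernel y t)) (at y)"
proof -
  have "((\<lambda>y::'a. (4 * pi) powr (- real DIM('a) / 2) * (t powr (- real DIM('a) / 2) * exp (- (norm y)\<^sup>2 / (4 * t)))) has_derivative
     (\<lambda>v. (4 * pi) powr (- real DIM('a) / 2) * (t powr (- real DIM('a) / 2) * (- (y \<bullet> v) / (2 * t) * exp (- (norm y)\<^sup>2 / (4 * t)))))) (at y)"
    by (intro has_derivative_mult_right has_derivative_exp_norm2)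
  then show ?thesis using assms by (simp add: heat_kernel_pos mult_ac)
qed

lemma pd_heat_kernel:
  fixes y :: "'m::finite space"
  assumes "t > 0"
  shows "pd None (\<lambda>y. heat_kernel y t) y = - (snd y) / (2 * t) * heat_kernel y t"
  using pd_has_derivative[OF has_derivative_heat_kernel[OF assms], of None y]
  by (simp add: inner_prod_def)

lemma pd_heat_kernel_nonpos:
  fixes y :: "'m::finite space"
  assumes "t \<le> 0"
  shows "pd i (\<lambda>y. heat_kernel y t) y = 0"
  using assms by (simp add: heat_kernel_def pd_def pderiv_dir_def)

text \<open>Raise \<delta> / t \<le> exp (\<delta> / t) to the power \<open>N\<close>; the choice
  \<delta> = a / N turns the right side into exp (a / t).\<close>

lemma powr_exp_bounded:
  fixes a N :: real
  assumes "a > 0" "N > 0"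
  shows "\<exists>C\<ge>0. \<forall>t>0. t powr (- N) * exp (- a / t) \<le> C"
proof -
  define \<delta> where "\<delta> = a / N"
  have \<delta>: "\<delta> > 0" using assms by (simp add: \<delta>_def)
  have "t powr (- N) * exp (- a / t) \<le> \<delta> powr (- N)" if t: "t > 0" for t
  proof -
    have "\<delta> / t \<le> exp (\<delta> / t)" using exp_ge_add_one_self[of "\<delta> / t"] by linarith
    then have "1 / t \<le> exp (\<delta> / t) / \<delta>" using \<delta> t by (simp add: field_simps)
    then have "(1 / t) powr N \<le> (exp (\<delta> / t) / \<delta>) powr N"
      using t assms by (intro powr_mono2) auto
    also have "\<dots> = exp (a / t) * \<delta> powr (- N)"
      using \<delta> assms by (simp add: powr_divide powr_minus_divide exp_powr_real) (simp add: \<delta>_def)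
    also have "(1 / t) powr N = t powr (- N)"
      using t by (simp add: powr_divide powr_minus_divide)
    finally have "t powr (- N) * exp (- (a / t)) \<le> exp (a / t) * \<delta> powr (- N) * exp (- (a / t))"
      by (rule mult_right_mono) simp
    also have "\<dots> = \<delta> powr (- N)" by (simp add: exp_minus)
    finally show ?thesis by simp
  qed
  then show ?thesis by (intro exI[of _ "\<delta> powr (- N)"]) auto
qed

text \<open>The device for absorbing a linear factor at the price of an arbitrarily small part
  \<epsilon> of a Gaussian exponent.\<close>

lemma linear_le_exp_square:
  fixes r :: real
  assumes "\<epsilon> > 0"
  shows "1 + r \<le> (2 + 1 / \<epsilon>) * exp (\<epsilon> * r\<^sup>2)"
proof -
  have "1 + r \<le> 2 + r\<^sup>2"
    using zero_le_power2[of "r - 1 / 2"] by (simp add: power2_eq_square algebra_simps)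
  also have "\<dots> \<le> (2 + 1 / \<epsilon>) * (1 + \<epsilon> * r\<^sup>2)"
    using assms by (simp add: algebra_simps)
  also have "\<dots> \<le> (2 + 1 / \<epsilon>) * exp (\<epsilon> * r\<^sup>2)"
    using assms by (intro mult_left_mono exp_ge_add_one_self) auto
  finally show ?thesis .
qed

lemma bounded_Ck_inner:
  assumes S: "open S"
  shows "bounded_Ck k S W (\<lambda>_ y. 1 + norm y) (\<lambda>_ y. y \<bullet> v)"
proof (cases k)
  case 0
  have "\<bar>y \<bullet> v\<bar> \<le> norm v * (1 + norm y)" for y
    using Cauchy_Schwarz_ineq2[of y v] by (simp add: algebra_simps add_increasing)
  then show ?thesis using 0 by auto
next
  case (Suc l)
  show ?thesis unfolding Suc
  proof (rule bounded_Ck_SucI[OF S, where C="norm v" and F'="\<lambda>_ _ u. u \<bullet> v"])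
    show "\<bar>y \<bullet> v\<bar> \<le> norm v * (1 + norm y)" for y
      using Cauchy_Schwarz_ineq2[of y v] by (simp add: algebra_simps add_increasing)
    show "bounded_Ck l S W (\<lambda>_ y. 1 + norm y) (\<lambda>_ _. u \<bullet> v)" for u
      by (rule bounded_Ck_const[OF S, where B="\<bar>u \<bullet> v\<bar>"])
        (auto simp: algebra_simps add_increasing2)
  qed (auto intro!: derivative_eq_intros)
qed

text \<open>Half of the exponent beats the negative power of \<open>t\<close> because norm y > c;
  the other half is at least (norm y)^2 / 8 because t < 1. A derivative brings in a factor y / t,
  which raises \<open>N\<close> by one and costs a little decay. Hence the claim is made for all
  \<open>N\<close> and all \<beta> below the limit 1/8, never at it.\<close>

lemma bounded_Ck_gaussian:
  assumes c: "c > 0"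
  shows "N > 0 \<Longrightarrow> \<beta> < 1/8 \<Longrightarrow> bounded_Ck k {y::'a::euclidean_space. norm y > c} {0<..<1}
    (\<lambda>t y. exp (- \<beta> * (norm y)\<^sup>2)) (\<lambda>t y. t powr (- N) * exp (- (norm y)\<^sup>2 / (4 * t)))"
proof (induction k arbitrary: N \<beta>)
  have bound: "\<exists>C. \<forall>t\<in>{0<..<1}. \<forall>y\<in>{y::'a. norm y > c}.
      \<bar>t powr (- N) * exp (- (norm y)\<^sup>2 / (4 * t))\<bar> \<le> C * exp (- \<beta> * (norm y)\<^sup>2)"
    if "N > 0" "\<beta> < 1/8" for N \<beta>
  proof -
    obtain C where "C \<ge> 0" and C: "\<And>t. t > 0 \<Longrightarrow> t powr (- N) * exp (- (c\<^sup>2 / 8) / t) \<le> C"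
      using powr_exp_bounded[of "c\<^sup>2 / 8" N] c \<open>N > 0\<close> by auto
    have "\<bar>t powr (- N) * exp (- (norm y)\<^sup>2 / (4 * t))\<bar> \<le> C * exp (- \<beta> * (norm y)\<^sup>2)"
      if t: "t \<in> {0<..<1}" and y: "norm y > c" for t and y :: 'a
    proof -
      have "c\<^sup>2 \<le> (norm y)\<^sup>2" using y c by (intro power_mono) auto
      then have "c\<^sup>2 / 8 / t \<le> (norm y)\<^sup>2 / 8 / t" using t by (simp add: divide_right_mono)
      moreover have "\<beta> * (norm y)\<^sup>2 \<le> (norm y)\<^sup>2 / 8 / t"
      proof -
        have "\<beta> * (norm y)\<^sup>2 \<le> (1/8) * (norm y)\<^sup>2" using \<open>\<beta> < 1/8\<close> by (intro mult_right_mono) auto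
        also have "\<dots> \<le> (norm y)\<^sup>2 / 8 / t" using t by (simp add: field_simps mult_left_le_one_le)
        finally show ?thesis .
      qed
      moreover have "(norm y)\<^sup>2 / (4 * t) = (norm y)\<^sup>2 / 8 / t + (norm y)\<^sup>2 / 8 / t"
        using t by (simp add: field_simps)
      ultimately have "- (norm y)\<^sup>2 / (4 * t) \<le> - (c\<^sup>2 / 8) / t + - \<beta> * (norm y)\<^sup>2"
        by simp
      then have "exp (- (norm y)\<^sup>2 / (4 * t)) \<le> exp (- (c\<^sup>2 / 8) / t + - \<beta> * (norm y)\<^sup>2)"
        by (simp only: exp_le_cancel_iff)
      then have "t powr (- N) * exp (- (norm y)\<^sup>2 / (4 * t)) \<le> t powr (- N) * (exp (- (c\<^sup>2 / 8) / t) * exp (- \<beta> * (norm y)\<^sup>2))"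
        unfolding exp_add by (intro mult_left_mono) simp_all
      also have "\<dots> \<le> C * exp (- \<beta> * (norm y)\<^sup>2)"
        using C[of t] t by (simp add: mult.assoc[symmetric])
      finally show ?thesis by simp
    qed
    then show ?thesis by (intro exI[of _ C]) auto
  qed
  {
    case 0
    show ?case using bound[OF 0] by simp
  next
    case (Suc k)
    obtain C where C: "\<forall>t\<in>{0<..<1}. \<forall>y\<in>{y::'a. norm y > c}.
      \<bar>t powr (- N) * exp (- (norm y)\<^sup>2 / (4 * t))\<bar> \<le> C * exp (- \<beta> * (norm y)\<^sup>2)"
      using bound[OF Suc.prems] by (rule exE)
    \<comment> \<open>The induction hypothesis is used with the faster decay \<gamma>, and the gap
      \<gamma> - \<beta> pays for the linear factor coming from y \<bullet> v.\<close>
    define \<gamma> where "\<gamma> = (\<beta> + 1/8) / 2"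
    have \<gamma>: "\<beta> < \<gamma>" "\<gamma> < 1/8" using Suc.prems by (auto simp: \<gamma>_def)
    show ?case
    proof (rule bounded_Ck_SucI[OF open_norm_gt, where C=C])
      show "((\<lambda>y. t powr (- N) * exp (- (norm y)\<^sup>2 / (4 * t))) has_derivative
          (\<lambda>v. t powr (- N) * (- (y \<bullet> v) / (2 * t) * exp (- (norm y)\<^sup>2 / (4 * t))))) (at y)" for t and y :: 'a
        by (intro has_derivative_mult_right has_derivative_exp_norm2)
      fix v :: 'a
      have "bounded_Ck k {y::'a. norm y > c} {0<..<1}
        (\<lambda>t y. (1 + norm y) * exp (- \<gamma> * (norm y)\<^sup>2))
        (\<lambda>t y. (y \<bullet> ((- 1 / 2) *\<^sub>R v)) * (t powr (- (N + 1)) * exp (- (norm y)\<^sup>2 / (4 * t))))"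
        by (intro bounded_Ck_mult[OF open_norm_gt] bounded_Ck_inner[OF open_norm_gt] Suc.IH)
          (use Suc.prems \<gamma> in auto)
      then have "bounded_Ck k {y::'a. norm y > c} {0<..<1}
        (\<lambda>t y. exp (- \<beta> * (norm y)\<^sup>2))
        (\<lambda>t y. (y \<bullet> ((- 1 / 2) *\<^sub>R v)) * (t powr (- (N + 1)) * exp (- (norm y)\<^sup>2 / (4 * t))))"
      proof (rule bounded_Ck_weight[where B="2 + 1 / (\<gamma> - \<beta>)"])
        fix t and y :: 'a
        have "(1 + norm y) * exp (- \<gamma> * (norm y)\<^sup>2) \<le> (2 + 1 / (\<gamma> - \<beta>)) * exp ((\<gamma> - \<beta>) * (norm y)\<^sup>2) * exp (- \<gamma> * (norm y)\<^sup>2)"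
          using \<gamma> by (intro mult_right_mono linear_le_exp_square) auto
        also have "\<dots> = (2 + 1 / (\<gamma> - \<beta>)) * exp (- \<beta> * (norm y)\<^sup>2)"
          by (simp add: mult.assoc exp_add[symmetric] algebra_simps)
        finally show "0 \<le> (1 + norm y) * exp (- \<gamma> * (norm y)\<^sup>2) \<and>
          (1 + norm y) * exp (- \<gamma> * (norm y)\<^sup>2) \<le> (2 + 1 / (\<gamma> - \<beta>)) * exp (- \<beta> * (norm y)\<^sup>2)" by simp
      qed
      then show "bounded_Ck k {y::'a. norm y > c} {0<..<1} (\<lambda>t y. exp (- \<beta> * (norm y)\<^sup>2))
        (\<lambda>t y. t powr (- N) * (- (y \<bullet> v) / (2 * t) * exp (- (norm y)\<^sup>2 / (4 * t))))"
        by (rule bounded_Ck_cong[OF open_norm_gt, rotated]) (auto simp: powr_diff powr_minus_divide field_simps powr_add)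
    qed (use C in blast)
  }
qed

lemma bounded_Ck_pd_heat_kernel:
  assumes c: "c > 0"
  shows "bounded_Ck k {y::'m::finite space. norm y > c} {0<..<1}
    (\<lambda>t y. exp (- (norm y)\<^sup>2 / 16)) (\<lambda>t. pd None (\<lambda>y. heat_kernel y t))"
proof -
  define n where "n = real DIM('m space)"
  \<comment> \<open>Writes the normal derivative - y_n / (2 t) * \<Gamma> as a linear function times
    a Gaussian: the constants sit in the vector, the power of \<open>t\<close> drops by one. The
    rate 1/10 lies strictly between the target 1/16 and the limit 1/8.\<close>
  have "bounded_Ck k {y::'m space. norm y > c} {0<..<1}
    (\<lambda>t y. (1 + norm y) * exp (- (1 / 10) * (norm y)\<^sup>2))
    (\<lambda>t y. (y \<bullet> (- (1/2) * (4 * pi) powr (- n / 2)) *\<^sub>R (0, 1)) * (t powr (- (n / 2 + 1)) * exp (- (norm y)\<^sup>2 / (4 * t))))"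
    by (intro bounded_Ck_mult[OF open_norm_gt] bounded_Ck_inner[OF open_norm_gt] bounded_Ck_gaussian[OF c])
      (auto simp: n_def add_pos_pos)
  then have "bounded_Ck k {y::'m space. norm y > c} {0<..<1} (\<lambda>t y. exp (- (norm y)\<^sup>2 / 16))
    (\<lambda>t y. (y \<bullet> (- (1/2) * (4 * pi) powr (- n / 2)) *\<^sub>R (0, 1)) * (t powr (- (n / 2 + 1)) * exp (- (norm y)\<^sup>2 / (4 * t))))"
  proof (rule bounded_Ck_weight[where B="2 + 1 / (1 / 10 - 1 / 16)"])
    fix t and y :: "'m space"
    have "(1 + norm y) * exp (- (1 / 10) * (norm y)\<^sup>2) \<le> (2 + 1 / (1 / 10 - 1 / 16)) * exp ((1 / 10 - 1 / 16) * (norm y)\<^sup>2) * exp (- (1 / 10) * (norm y)\<^sup>2)"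
      by (intro mult_right_mono linear_le_exp_square) auto
    also have "\<dots> = (2 + 1 / (1 / 10 - 1 / 16)) * exp (- (norm y)\<^sup>2 / 16)"
      unfolding mult.assoc exp_add[symmetric] by (simp add: algebra_simps)
    finally show "0 \<le> (1 + norm y) * exp (- (1 / 10) * (norm y)\<^sup>2) \<and>
      (1 + norm y) * exp (- (1 / 10) * (norm y)\<^sup>2) \<le> (2 + 1 / (1 / 10 - 1 / 16)) * exp (- (norm y)\<^sup>2 / 16)" by simp
  qed
  then show ?thesis
  proof (rule bounded_Ck_cong[OF open_norm_gt, rotated])
    fix t :: real and y :: "'m space" assume t: "t \<in> {0<..<1}"
    have "pd None (\<lambda>y. heat_kernel y t) y = - (snd y) / (2 * t) * ((4 * pi) powr (- n / 2) * (t powr (- n / 2) * exp (- (norm y)\<^sup>2 / (4 * t))))"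
      using pd_heat_kernel[of t y] heat_kernel_pos[of t y] t by (simp add: n_def)
    moreover have "t powr (- (n / 2 + 1)) = t powr (- n / 2) / t"
      using t by (simp add: powr_diff)
    ultimately show "(y \<bullet> (- (1/2) * (4 * pi) powr (- n / 2)) *\<^sub>R (0, 1)) * (t powr (- (n / 2 + 1)) * exp (- (norm y)\<^sup>2 / (4 * t)))
      = pd None (\<lambda>y. heat_kernel y t) y"
      by (simp add: inner_prod_def)
  qed
qed

section \<open>A smooth cutoff\<close>

text \<open>The classical flat function exp (- 1 / t), extended by zero. The polynomial in 1 / t is
  included because the class is then closed under differentiation, so smoothness across 0 follows by
  induction.\<close>

definition flat_exp :: "real poly \<Rightarrow> real \<Rightarrow> real" where
  "flat_exp p t = (if t \<le> 0 then 0 else poly p (1 / t) * exp (- (1 / t)))"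

lemma flat_exp_tendsto: "((\<lambda>t. poly p (1 / t) * exp (- (1 / t))) \<longlongrightarrow> 0) (at_right (0::real))"
proof -
  have "((\<lambda>s::real. poly p s * exp (- s)) \<longlongrightarrow> 0) at_top"
  proof -
    have "((\<lambda>s::real. \<Sum>i\<le>degree p. coeff p i * (s ^ i / exp s)) \<longlongrightarrow> (\<Sum>i\<le>degree p. coeff p i * 0)) at_top"
      by (intro tendsto_intros tendsto_power_div_exp_0)
    then show ?thesis by (simp add: poly_altdef sum_distrib_right exp_minus divide_inverse mult.assoc)
  qed
  moreover have "filterlim (\<lambda>t::real. 1 / t) at_top (at_right 0)"
    by real_asymp
  ultimately show ?thesis by (rule filterlim_compose)
qed

text \<open>In the variable s = 1 / t differentiation in \<open>t\<close> is - s^2 times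
  differentiation in \<open>s\<close>, which sends p * exp (- s) to (p - p') * s^2 * exp (-
  s).\<close>

lemma has_real_derivative_flat_exp:
  "(flat_exp p has_real_derivative flat_exp ((p - pderiv p) * monom 1 2) t) (at t)"
proof -
  let ?q = "(p - pderiv p) * monom 1 2"
  consider "t < 0" | "t = 0" | "t > 0" by linarith
  then show ?thesis
  proof cases
    case 1
    have "((\<lambda>_. 0) has_real_derivative 0) (at t)" by simp
    then have "(flat_exp p has_real_derivative 0) (at t)"
      by (rule DERIV_cong_ev[THEN iffD1, rotated -1])
        (use 1 in \<open>auto simp: flat_exp_def intro!: eventually_mono[OF eventually_nhds_in_open[of "{..<0}"]]\<close>)
    then show ?thesis using 1 by (simp add: flat_exp_def)
  next
    case 3
    have "((\<lambda>t. poly p (1 / t) * exp (- (1 / t))) has_real_derivative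
        poly (pderiv p) (1 / t) * (- 1 / t\<^sup>2) * exp (- (1 / t)) + poly p (1 / t) * (exp (- (1 / t)) * (1 / t\<^sup>2))) (at t)"
      using 3 by (auto intro!: derivative_eq_intros simp: power2_eq_square field_simps)
    also have "poly (pderiv p) (1 / t) * (- 1 / t\<^sup>2) * exp (- (1 / t)) + poly p (1 / t) * (exp (- (1 / t)) * (1 / t\<^sup>2))
      = flat_exp ?q t"
      using 3 by (simp add: flat_exp_def poly_monom power_divide algebra_simps)
    finally have "((\<lambda>t. poly p (1 / t) * exp (- (1 / t))) has_real_derivative flat_exp ?q t) (at t)" .
    then show ?thesis
      by (rule DERIV_cong_ev[THEN iffD1, rotated -1])
        (use 3 in \<open>auto simp: flat_exp_def intro!: eventually_mono[OF eventually_nhds_in_open[of "{0<..}"]]\<close>)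
  next
    case 2
    have "((\<lambda>h. (flat_exp p (0 + h) - flat_exp p 0) / h) \<longlongrightarrow> 0) (at 0)"
    proof (rule filterlim_split_at)
      show "((\<lambda>h. (flat_exp p (0 + h) - flat_exp p 0) / h) \<longlongrightarrow> 0) (at_left 0)"
        by (rule tendsto_eventually) (auto simp: flat_exp_def eventually_at_filter)
      \<comment> \<open>The difference quotient at 0 is again of this type, with the polynomial
        multiplied by its variable 1 / t.\<close>
      have "((\<lambda>t. poly (p * monom 1 1) (1 / t) * exp (- (1 / t))) \<longlongrightarrow> 0) (at_right (0::real))"
        by (rule flat_exp_tendsto)
      then show "((\<lambda>h. (flat_exp p (0 + h) - flat_exp p 0) / h) \<longlongrightarrow> 0) (at_right 0)"
        by (rule Lim_transform_eventually) (auto simp: flat_exp_def eventually_at_filter poly_monom)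
    qed
    then show ?thesis using 2 by (simp add: DERIV_def flat_exp_def)
  qed
qed

lemma bounded_Ck_flat_exp: "bounded_Ck k {- R<..<R} {()} (\<lambda>_ _. 1) (\<lambda>_. flat_exp p)"
proof (induction k arbitrary: p)
  have bound: "\<exists>C. \<forall>x\<in>{- R<..<R}. \<bar>flat_exp p x\<bar> \<le> C" for p
  proof -
    have "continuous_on {-R..R} (flat_exp p)"
      using has_real_derivative_flat_exp by (intro continuous_at_imp_continuous_on ballI DERIV_isCont)
    then have "bounded (flat_exp p ` {-R..R})"
      by (intro compact_imp_bounded compact_continuous_image) auto
    then show ?thesis by (force simp: bounded_iff)
  qed
  {
    case 0
    show ?case using bound by simp
  next
    case (Suc k)
    obtain C where C: "\<forall>x\<in>{- R<..<R}. \<bar>flat_exp p x\<bar> \<le> C" using bound by blast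
    show ?case
    proof (rule bounded_Ck_SucI[where C=C])
      show "(flat_exp p has_derivative (\<lambda>v. v * flat_exp ((p - pderiv p) * monom 1 2) x)) (at x)" for x
        using has_real_derivative_flat_exp[of p x] by (simp add: has_field_derivative_def mult_commute_abs)
      show "bounded_Ck k {- R<..<R} {()} (\<lambda>_ _. 1) (\<lambda>_ x. v * flat_exp ((p - pderiv p) * monom 1 2) x)" for v
        by (rule bounded_Ck_scale[OF _ Suc]) auto
    qed (use C in auto)
  }
qed

lemma smooth_bump:
  fixes a b :: real
  assumes "a < b"
  shows "\<exists>\<phi> :: real \<Rightarrow> real. (\<forall>s. if s \<in> {a<..<b} then \<phi> s > 0 else \<phi> s = 0) \<and>
    (\<forall>k. bounded_Ck k UNIV {()} (\<lambda>_ _. 1) (\<lambda>_. \<phi>))"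
proof -
  define \<phi> where "\<phi> s = flat_exp 1 (s - a) * flat_exp 1 (b - s)" for s
  \<comment> \<open>\<open>flat_exp\<close> is controlled on bounded intervals only. This interval
    contains [a, b], and the arguments s - a and b - s stay below 2 * R in absolute value on it;
    elsewhere \<phi> is zero.\<close>
  define R where "R = \<bar>a\<bar> + \<bar>b\<bar> + 1"
  have out: "\<phi> s = 0" if "s \<notin> {a<..<b}" for s
    using that by (auto simp: \<phi>_def flat_exp_def)
  have "bounded_Ck k UNIV {()} (\<lambda>_ _. 1) (\<lambda>_. \<phi>)" for k
  proof -
    have 1: "bounded_Ck k {- R<..<R} {()} (\<lambda>_ _. 1) (\<lambda>_ s. flat_exp 1 (s + (- a)))"
      by (rule bounded_Ck_affine[OF bounded_Ck_flat_exp[of _ "2 * R"] _ bounded_linear_ident])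
         (auto simp: R_def)
    have 2: "bounded_Ck k {- R<..<R} {()} (\<lambda>_ _. 1) (\<lambda>_ s. flat_exp 1 (- s + b))"
      by (rule bounded_Ck_affine[OF bounded_Ck_flat_exp[of _ "2 * R"] _ bounded_linear_minus[OF bounded_linear_ident]])
         (auto simp: R_def)
    have "bounded_Ck k {- R<..<R} {()} (\<lambda>_ _. 1) (\<lambda>_. \<phi>)"
      using bounded_Ck_mult[OF _ 1 2] by (simp add: \<phi>_def[abs_def])
    moreover have "bounded_Ck k (- {a..b}) {()} (\<lambda>_ _. 1) (\<lambda>_. \<phi>)"
      by (rule bounded_Ck_cong[OF _ _ bounded_Ck_const[where m="\<lambda>_. 0" and B=0]]) (auto simp: out)
    ultimately have "bounded_Ck k ({- R<..<R} \<union> - {a..b}) {()} (\<lambda>_ _. 1) (\<lambda>_. \<phi>)"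
      by (rule bounded_Ck_Un) auto
    moreover have "{- R<..<R} \<union> - {a..b} = UNIV" by (auto simp: R_def)
    ultimately show ?thesis by simp
  qed
  moreover have "if s \<in> {a<..<b} then \<phi> s > 0 else \<phi> s = 0" for s
    by (simp add: \<phi>_def flat_exp_def)
  ultimately show ?thesis by (intro exI[of _ \<phi>]) simp
qed

text \<open>A normalised primitive of the bump, whose derivatives are multiples of the bump and its
  derivatives.\<close>

lemma smooth_step:
  fixes a b :: real
  assumes ab: "a < b"
  shows "\<exists>\<eta> :: real \<Rightarrow> real. (\<forall>s\<le>a. \<eta> s = 0) \<and> (\<forall>s\<ge>b. \<eta> s = 1) \<and>
    (\<forall>k. bounded_Ck k UNIV {()} (\<lambda>_ _. 1) (\<lambda>_. \<eta>))"
proof -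
  obtain \<phi> :: "real \<Rightarrow> real" where \<phi>: "(\<forall>s. if s \<in> {a<..<b} then \<phi> s > 0 else \<phi> s = 0) \<and>
    (\<forall>k. bounded_Ck k UNIV {()} (\<lambda>_ _. 1) (\<lambda>_. \<phi>))"
    using smooth_bump[OF ab] by (rule exE)
  have pos: "\<phi> s > 0" if "s \<in> {a<..<b}" for s using conjunct1[OF \<phi>] that by metis
  have out: "\<phi> s = 0" if "s \<notin> {a<..<b}" for s using conjunct1[OF \<phi>] that by metis
  note smooth = conjunct2[OF \<phi>, rule_format]
  have cont: "continuous_on S \<phi>" for S
    using bounded_Ck_has_derivative[OF smooth[of "Suc 0"]]
    by (intro continuous_at_imp_continuous_on ballI has_derivative_continuous) auto
  \<comment> \<open>Starting to the left of \<open>a\<close> makes every x \<ge> a an interior point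
    of {a - 1..x + 1}, so the fundamental theorem yields a two-sided derivative.\<close>
  define B where "B x = integral {a - 1..x} \<phi>" for x
  have B0: "B x = 0" if "x \<le> a" for x
  proof -
    have "B x = integral {a - 1..x} (\<lambda>_. 0)"
      unfolding B_def by (rule integral_cong) (use that out in auto)
    then show ?thesis by simp
  qed
  have dB: "(B has_real_derivative \<phi> x) (at x)" for x
  proof (cases "x < a")
    case True
    have "((\<lambda>_. 0) has_real_derivative 0) (at x)" by simp
    then have "(B has_real_derivative 0) (at x)"
      by (rule DERIV_cong_ev[THEN iffD1, rotated -1])
        (use True in \<open>auto simp: B0 intro!: eventually_mono[OF eventually_nhds_in_open[of "{..<a}"]]\<close>)
    then show ?thesis using out[of x] True by simp
  next
    case False
    have "(B has_real_derivative \<phi> x) (at x within {a - 1..x + 1})"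
      unfolding B_def by (rule integral_has_real_derivative) (use cont False in auto)
    moreover have "at x within {a - 1..x + 1} = at x"
      using False by (intro at_within_interior) auto
    ultimately show ?thesis by simp
  qed
  have phi0: "\<phi> x \<ge> 0" for x using pos[of x] out[of x] by (cases "x \<in> {a<..<b}") auto
  have mono: "B x \<le> B y" if "x \<le> y" for x y
    by (rule DERIV_nonneg_imp_nondecreasing[OF that]) (use dB phi0 in blast)
  \<comment> \<open>The mean value theorem produces a point where the bump is positive, hence a
    positive normalising constant \<open>B b\<close>.\<close>
  obtain z where z: "a < z" "z < b" "B b - B a = (b - a) * \<phi> z"
    using MVT2[OF ab, of B \<phi>] dB by blast
  have Bb: "B b > 0" using z pos[of z] ab B0[of a] by simp
  have B1: "B x = B b" if "x \<ge> b" for x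
  proof (cases "x = b")
    case False
    then have "b < x" using that by simp
    then obtain z where "b < z" "B x - B b = (x - b) * \<phi> z"
      using MVT2[of b x B \<phi>] dB by blast
    then show ?thesis using out[of z] by simp
  qed simp
  have bound: "\<bar>B x / B b\<bar> \<le> 1 * 1" for x
  proof -
    have "0 \<le> B x" using mono[of "min a x" x] B0[of "min a x"] by simp
    moreover have "B x \<le> B b" using mono[of x "max x b"] B1[of "max x b"] by simp
    ultimately show ?thesis using Bb by simp
  qed
  have "bounded_Ck k UNIV {()} (\<lambda>_ _. 1) (\<lambda>_ x. B x / B b)" for k
  proof (cases k)
    case 0
    show ?thesis unfolding 0 using bound by auto
  next
    case (Suc l)
    show ?thesis unfolding Suc
    proof (rule bounded_Ck_SucI[where C=1])
      show "((\<lambda>x. B x / B b) has_derivative (\<lambda>v. (v / B b) * \<phi> x)) (at x)" for x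
        using DERIV_cdivide[OF dB[of x], of "B b"] unfolding has_field_derivative_def
        by (rule has_derivative_eq_rhs) (auto simp: mult.commute)
      show "bounded_Ck l UNIV {()} (\<lambda>_ _. 1) (\<lambda>_ x. (v / B b) * \<phi> x)" for v
        by (rule bounded_Ck_scale[OF _ smooth]) auto
    qed (use bound in auto)
  qed
  moreover have "B s / B b = 0" if "s \<le> a" for s using B0[OF that] by simp
  moreover have "B s / B b = 1" if "s \<ge> b" for s using B1[OF that] Bb by simp
  ultimately show ?thesis by (intro exI[of _ "\<lambda>x. B x / B b"] conjI allI impI)
qed

section \<open>Integrability\<close>

lemma
  fixes f :: "real \<Rightarrow> real"
  assumes f: "integrable lborel f" and f0: "\<And>x. f x \<ge> 0"
  shows integrable_prod_Basis: "integrable lborel (\<lambda>x::'a::euclidean_space. \<Prod>b\<in>Basis. f (x \<bullet> b))"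
    and integral_prod_Basis: "integral\<^sup>L lborel (\<lambda>x::'a::euclidean_space. \<Prod>b\<in>Basis. f (x \<bullet> b)) = (integral\<^sup>L lborel f) ^ DIM('a)"
proof -
  have [measurable]: "f \<in> borel_measurable borel" using f by (simp add: borel_measurable_integrable)
  have "(\<integral>\<^sup>+x. ennreal (\<Prod>b\<in>Basis. f (x \<bullet> b)) \<partial>(lborel :: 'a measure)) = (\<integral>\<^sup>+x. (\<Prod>b\<in>Basis. ennreal (f (x \<bullet> b))) \<partial>(lborel :: 'a measure))"
    using f0 by (simp add: prod_ennreal)
  also have "\<dots> = (\<Prod>b\<in>(Basis::'a set). (\<integral>\<^sup>+x. ennreal (f x) \<partial>lborel))"
    by (rule nn_integral_lborel_prod) auto
  also have "\<dots> = ennreal ((integral\<^sup>L lborel f) ^ DIM('a))"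
    using f f0 by (simp add: nn_integral_eq_integral ennreal_power)
  finally have "has_bochner_integral lborel (\<lambda>x::'a. \<Prod>b\<in>Basis. f (x \<bullet> b)) ((integral\<^sup>L lborel f) ^ DIM('a))"
    using f0 by (intro has_bochner_integral_nn_integral) (auto intro!: prod_nonneg)
  then show "integrable lborel (\<lambda>x::'a::euclidean_space. \<Prod>b\<in>Basis. f (x \<bullet> b))"
    "integral\<^sup>L lborel (\<lambda>x::'a::euclidean_space. \<Prod>b\<in>Basis. f (x \<bullet> b)) = (integral\<^sup>L lborel f) ^ DIM('a)"
    by (auto simp: has_bochner_integral_iff)
qed

lemma
  assumes s: "s > 0"
  shows integrable_gaussian_real: "integrable lborel (\<lambda>x::real. exp (- x\<^sup>2 / s))"
    and integral_gaussian_real: "integral\<^sup>L lborel (\<lambda>x::real. exp (- x\<^sup>2 / s)) = sqrt (pi * s)"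
proof -
  \<comment> \<open>Variance s / 2 gives the normal density exactly the exponent - x^2 / s.\<close>
  have "(\<lambda>x::real. exp (- x\<^sup>2 / s)) = (\<lambda>x. sqrt (pi * s) * normal_density 0 (sqrt (s / 2)) x)"
    using s by (auto simp: normal_density_def)
  then show "integrable lborel (\<lambda>x::real. exp (- x\<^sup>2 / s))" "integral\<^sup>L lborel (\<lambda>x::real. exp (- x\<^sup>2 / s)) = sqrt (pi * s)"
    using s by auto
qed

lemma exp_norm2_prod: "exp (- (norm x)\<^sup>2 / s) = (\<Prod>b\<in>Basis. exp (- (x \<bullet> b)\<^sup>2 / s))"
  for x :: "'a::euclidean_space"
proof -
  have "(norm x)\<^sup>2 = (\<Sum>b\<in>Basis. (x \<bullet> b)\<^sup>2)"
    by (simp add: norm_eq_sqrt_inner euclidean_inner[of x x] power2_eq_square sum_nonneg)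
  then show ?thesis by (simp add: exp_sum[symmetric] sum_negf sum_divide_distrib)
qed

lemma
  assumes s: "s > 0"
  shows integrable_gaussian: "integrable lborel (\<lambda>x::'a::euclidean_space. exp (- (norm x)\<^sup>2 / s))"
    and integral_gaussian: "integral\<^sup>L lborel (\<lambda>x::'a::euclidean_space. exp (- (norm x)\<^sup>2 / s)) = (pi * s) powr (real DIM('a) / 2)"
proof -
  have "sqrt (pi * s) ^ DIM('a) = (pi * s) powr (real DIM('a) / 2)"
    using s by (simp add: powr_half_sqrt[symmetric] powr_power)
  then show "integrable lborel (\<lambda>x::'a. exp (- (norm x)\<^sup>2 / s))"
    "integral\<^sup>L lborel (\<lambda>x::'a. exp (- (norm x)\<^sup>2 / s)) = (pi * s) powr (real DIM('a) / 2)"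
    unfolding exp_norm2_prod using integrable_prod_Basis[OF integrable_gaussian_real[OF s], where 'a='a]
      integral_prod_Basis[OF integrable_gaussian_real[OF s], where 'a='a]
    by (simp_all only: integral_gaussian_real[OF s] exp_ge_zero)
qed

text \<open>The majorant is the power on [0, 1], its mirror image on [-1, 0], and the Gaussian
  elsewhere, where the power is at most 1.\<close>

lemma integrable_abs_powr_gaussian_real:
  fixes a s :: real
  assumes a: "a > -1" "a \<le> 0" and s: "s > 0"
  shows "integrable lborel (\<lambda>x::real. \<bar>x\<bar> powr a * exp (- x\<^sup>2 / s))"
proof -
  have "set_integrable lebesgue {0..1} (\<lambda>x::real. x powr a)"
    by (rule nonnegative_absolutely_integrable_1[OF integrable_on_powr_from_0[OF a(1)]]) auto
  then have "integrable lborel (\<lambda>x::real. indicator {0..1} x *\<^sub>R x powr a)"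
    unfolding set_integrable_def by (subst (asm) integrable_completion) auto
  note pos = this
  have neg: "integrable lborel (\<lambda>x::real. indicator {0..1} (0 + (-1) * x) *\<^sub>R (0 + (-1) * x) powr a)"
    using lborel_integrable_real_affine[OF pos, of "-1" 0] by simp
  show ?thesis
  proof (rule Bochner_Integration.integrable_bound[OF Bochner_Integration.integrable_add[OF
        Bochner_Integration.integrable_add[OF pos neg] integrable_gaussian_real[OF s]]])
    show "AE x in lborel. norm (\<bar>x\<bar> powr a * exp (- x\<^sup>2 / s))
      \<le> norm (indicator {0..1} x *\<^sub>R x powr a + indicator {0..1} (0 + (-1) * x) *\<^sub>R (0 + (-1) * x) powr a + exp (- x\<^sup>2 / s))"
    proof (rule AE_I2)
      fix x :: real
      have e: "exp (- x\<^sup>2 / s) \<le> 1" using s by simp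
      consider "0 \<le> x \<and> x \<le> 1" | "-1 \<le> x \<and> x < 0" | "\<bar>x\<bar> > 1" by linarith
      then have "\<bar>x\<bar> powr a * exp (- x\<^sup>2 / s)
        \<le> indicator {0..1} x *\<^sub>R x powr a + indicator {0..1} (0 + (-1) * x) *\<^sub>R (0 + (-1) * x) powr a + exp (- x\<^sup>2 / s)"
      proof cases
        case 1
        then show ?thesis using mult_left_mono[OF e, of "\<bar>x\<bar> powr a"] by (auto simp: indicator_def add_increasing2)
      next
        case 2
        then show ?thesis using mult_left_mono[OF e, of "\<bar>x\<bar> powr a"] by (auto simp: indicator_def add_increasing2)
      next
        case 3
        then have "\<bar>x\<bar> powr a \<le> 1" using a powr_mono[of a 0 "\<bar>x\<bar>"] by (simp split: if_splits)
        then have "\<bar>x\<bar> powr a * exp (- x\<^sup>2 / s) \<le> 1 * exp (- x\<^sup>2 / s)" by (intro mult_right_mono) auto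
        then show ?thesis using 3 by (auto simp: indicator_def)
      qed
      then show "norm (\<bar>x\<bar> powr a * exp (- x\<^sup>2 / s))
        \<le> norm (indicator {0..1} x *\<^sub>R x powr a + indicator {0..1} (0 + (-1) * x) *\<^sub>R (0 + (-1) * x) powr a + exp (- x\<^sup>2 / s))"
        by simp
    qed
  qed auto
qed

text \<open>Coordinate hyperplanes are null sets. They must be excluded because
  \<open>0 powr a\<close> is 0, which spoils lower bounds for negative powers of the
  coordinates.\<close>

lemma AE_lborel_inner_nonzero:
  "AE x in (lborel :: 'a::euclidean_space measure). \<forall>b\<in>Basis. x \<bullet> b \<noteq> 0"
proof -
  have "AE x in (lborel :: 'a measure). x \<bullet> b \<noteq> 0" if "b \<in> Basis" for b
  proof -
    have "{x::'a. x \<bullet> b = 0} \<in> null_sets lebesgue"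
      using negligible_standard_hyperplane[OF that, of 0] by (simp add: negligible_iff_null_sets)
    then have "{x::'a. x \<bullet> b = 0} \<in> null_sets lborel"
      by (subst (asm) null_sets_completion_iff) auto
    from AE_not_in[OF this] show ?thesis by simp
  qed
  then show ?thesis by (subst AE_finite_all) auto
qed

text \<open>Instead of polar coordinates, the power |x|^(1 - n) is distributed over the n
  coordinates as a product of |x|^a with a = (1 - n) / n. As a \<le> 0 and |x_b| \<le> |x|, each
  factor is at most |x_b|^a, and a > -1 makes the one-dimensional integrals finite. This is the
  integrable singularity of \<nabla>E.\<close>

lemma integrable_norm_powr_gaussian:
  assumes s: "s > 0"
  shows "integrable lborel (\<lambda>x::'a::euclidean_space. norm x powr (1 - real DIM('a)) * exp (- (norm x)\<^sup>2 / s))"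
proof -
  define n where "n = real DIM('a)"
  have n: "n \<ge> 1" using DIM_positive[where 'a='a] by (simp add: n_def Suc_le_eq del: DIM_positive)
  define a where "a = (1 - n) / n"
  have a: "a > -1" "a \<le> 0" using n by (auto simp: a_def field_simps)
  show ?thesis
  proof (rule Bochner_Integration.integrable_bound[OF integrable_prod_Basis[OF integrable_abs_powr_gaussian_real[OF a s]]])
    show "AE x::'a in lborel. norm (norm x powr (1 - real DIM('a)) * exp (- (norm x)\<^sup>2 / s))
      \<le> norm (\<Prod>b\<in>Basis. \<bar>x \<bullet> b\<bar> powr a * exp (- (x \<bullet> b)\<^sup>2 / s))"
      using AE_lborel_inner_nonzero
    proof eventually_elim
      case (elim x)
      obtain b :: 'a where b: "b \<in> Basis" using nonempty_Basis by blast
      then have x: "x \<noteq> 0" using elim by auto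
      have "norm x powr (1 - real DIM('a)) = (\<Prod>b\<in>(Basis::'a set). norm x powr a)"
        using x n by (simp add: powr_power a_def n_def[symmetric])
      also have "\<dots> \<le> (\<Prod>b\<in>Basis. \<bar>x \<bullet> b\<bar> powr a)"
        using elim a by (intro prod_mono conjI powr_mono2' Basis_le_norm) auto
      finally have "norm x powr (1 - real DIM('a)) * exp (- (norm x)\<^sup>2 / s) \<le> (\<Prod>b\<in>Basis. \<bar>x \<bullet> b\<bar> powr a) * exp (- (norm x)\<^sup>2 / s)"
        by (rule mult_right_mono) simp
      also have "\<dots> = (\<Prod>b\<in>Basis. \<bar>x \<bullet> b\<bar> powr a * exp (- (x \<bullet> b)\<^sup>2 / s))"
        by (simp only: exp_norm2_prod prod.distrib)
      finally show ?case by (auto simp: intro!: order_trans[OF _ abs_ge_self])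
    qed
  qed auto
qed

section \<open>Convolution kernels with an integrable singularity at time zero\<close>

text \<open>Every point of the half space has such a neighbourhood. The bound c keeps the distance
  to the boundary, and shifting by a boundary point (y, 0) leaves c unchanged and only enlarges
  R.\<close>

definition upper_box :: "real \<Rightarrow> real \<Rightarrow> 'm::finite space set" where
  "upper_box c R = {x. snd x > c \<and> norm x < R}"

lemma open_upper_box: "open (upper_box c R)"
  unfolding upper_box_def by (intro open_Collect_conj open_Collect_less continuous_intros)

lemma snd_le_norm: "\<bar>snd x\<bar> \<le> norm (x :: 'm::finite space)"
  by (cases x) (simp add: norm_snd_le[of _ "fst x", simplified] norm_Pair real_le_rsqrt)

lemma upper_box_subset_norm_gt: "upper_box c R \<subseteq> {x. norm x > c}"
proof
  fix x :: "'a space" assume "x \<in> upper_box c R"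
  then show "x \<in> {x. norm x > c}" using snd_le_norm[of x] by (auto simp: upper_box_def)
qed

text \<open>The region in which the kernels are controlled. Joint Borel measurability is required on
  it because the inner integrals over the boundary must be measurable functions of time.\<close>

definition half_slab :: "('m::finite space \<times> real) set" where
  "half_slab = {x. snd x > 0} \<times> {0<..<1}"

lemma half_slab_borel [measurable]: "(half_slab :: ('m::finite space \<times> real) set) \<in> sets borel"
  unfolding half_slab_def
  by (intro borel_open open_Times open_greaterThanLessThan open_Collect_less continuous_intros)

text \<open>The weight \<open>t\<^sup>-\<^sup>1\<^sup>/\<^sup>2\<close> is integrable at zero, so that in a convolution in time the time
  derivatives can be put on the other factor.\<close>

definition admissible_kernel :: "('m::finite space \<Rightarrow> real \<Rightarrow> real) \<Rightarrow> bool" where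
  "admissible_kernel k \<longleftrightarrow> (\<forall>x t. t \<le> 0 \<longrightarrow> k x t = 0) \<and>
     (\<forall>n c R. c > 0 \<longrightarrow>
        bounded_Ck n (upper_box c R) {0<..<1} (\<lambda>t _. t powr (- 1 / 2)) (\<lambda>t x. k x t)) \<and>
     set_borel_measurable borel half_slab (\<lambda>p. k (fst p) (snd p))"

lemma admissible_kernel_nonpos: "admissible_kernel k \<Longrightarrow> t \<le> 0 \<Longrightarrow> k x t = 0"
  unfolding admissible_kernel_def by blast

lemma admissible_kernel_bounded_Ck:
  assumes "admissible_kernel k" "c > 0"
  shows "bounded_Ck n (upper_box c R) {0<..<1} (\<lambda>t _. t powr (- 1 / 2)) (\<lambda>t x. k x t)"
  using assms(1)[unfolded admissible_kernel_def, THEN conjunct2, THEN conjunct1, rule_format, OF assms(2)] .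

lemma admissible_kernel_measurable:
  "admissible_kernel k \<Longrightarrow> set_borel_measurable borel half_slab (\<lambda>p. k (fst p) (snd p))"
  unfolding admissible_kernel_def by (elim conjE)

lemma in_upper_box:
  assumes "snd x > 0"
  shows "x \<in> upper_box (snd x / 2) (norm x + 1)"
  using assms by (simp add: upper_box_def)

lemma admissible_kernel_has_derivative:
  assumes k: "admissible_kernel k" and x: "snd x > 0" and t: "t \<in> {0<..<1}"
  shows "((\<lambda>x. k x t) has_derivative frechet_derivative (\<lambda>x. k x t) (at x)) (at x)"
  by (rule bounded_Ck_has_derivative[OF admissible_kernel_bounded_Ck[OF k, of "snd x / 2" "Suc 0" "norm x + 1"] t])
    (use x in_upper_box[OF x] in auto)

text \<open>Nothing is lost in the weight, since the bounds for \<open>k\<close> already cover its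
  derivatives of every order. Joint measurability survives as a limit of difference
  quotients.\<close>

lemma admissible_kernel_pd:
  assumes k: "admissible_kernel k"
  shows "admissible_kernel (\<lambda>x t. pd j (\<lambda>y. k y t) x)"
proof -
  have pd: "pd j (\<lambda>y. k y t) x = frechet_derivative (\<lambda>y. k y t) (at x) (unit_dir j)"
    if "snd x > 0" "t \<in> {0<..<1}" for x t
    by (rule pd_has_derivative[OF admissible_kernel_has_derivative[OF k that]])
  have 1: "pd j (\<lambda>y. k y t) x = 0" if "t \<le> 0" for t x
    using admissible_kernel_nonpos[OF k that] by (simp add: pd_def pderiv_dir_def)
  have 2: "bounded_Ck n (upper_box c R) {0<..<1} (\<lambda>t _. t powr (- 1 / 2)) (\<lambda>t x. pd j (\<lambda>y. k y t) x)"
    if c: "c > 0" for n c R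
  proof (rule bounded_Ck_cong[OF open_upper_box _ bounded_Ck_frechet[OF admissible_kernel_bounded_Ck[OF k c]]])
    show "frechet_derivative (\<lambda>x. k x t) (at x) (unit_dir j) = pd j (\<lambda>y. k y t) x"
      if "t \<in> {0<..<1}" "x \<in> upper_box c R" for t x
      using pd[of x t] that c by (simp add: upper_box_def)
  qed
  \<comment> \<open>Coordinate directions are tangential or point inwards, so the shifted points of
    the difference quotients remain in \<open>half_slab\<close>.\<close>
  have snd_dir: "snd (unit_dir j) \<ge> 0" by (cases j) auto
  define e where "e n = (1 / real (n + Suc 0)) *\<^sub>R (unit_dir j :: 'a space)" for n
  have e: "snd (x + e n) > 0" if "snd x > 0" for x n
    using that snd_dir by (simp add: e_def add_pos_nonneg)
  have m: "(\<lambda>p. indicat_real half_slab p *\<^sub>R k (fst p) (snd p)) \<in> borel_measurable borel"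
    using admissible_kernel_measurable[OF k] by (simp add: set_borel_measurable_def)
  have me [measurable]: "(\<lambda>p. indicat_real half_slab (fst p + e n, snd p) *\<^sub>R k (fst p + e n) (snd p)) \<in> borel_measurable borel" for n
    using measurable_compose[OF _ m, of "\<lambda>p. (fst p + e n, snd p)" borel]
    by (simp add: borel_measurable_continuous_onI continuous_intros)
  note m [measurable]
  have 3: "set_borel_measurable borel half_slab (\<lambda>p. pd j (\<lambda>y. k y (snd p)) (fst p))"
    unfolding set_borel_measurable_def
  proof (rule borel_measurable_LIMSEQ_real)
    fix p :: "'a space \<times> real"
    show "(\<lambda>n. indicator half_slab p * (real (n + Suc 0) * (indicator half_slab (fst p + e n, snd p) *\<^sub>R k (fst p + e n) (snd p)
        - indicator half_slab p *\<^sub>R k (fst p) (snd p)))) \<longlonglongrightarrow> indicat_real half_slab p *\<^sub>R pd j (\<lambda>y. k y (snd p)) (fst p)"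
    proof (cases "p \<in> half_slab")
      case True
      then have p: "snd (fst p) > 0" "snd p \<in> {0<..<1}" by (auto simp: half_slab_def)
      have "(fst p + e n, snd p) \<in> half_slab" for n using e[OF p(1)] p by (auto simp: half_slab_def)
      then show ?thesis
        using has_derivative_quotient_LIMSEQ[OF admissible_kernel_has_derivative[OF k p], of 0 "unit_dir j"] True
        by (simp add: e_def pd[OF p])
    qed simp
  qed measurable
  show ?thesis unfolding admissible_kernel_def using 1 2 3 by simp
qed

lemma admissible_kernel_add:
  assumes k: "admissible_kernel k" and l: "admissible_kernel l"
  shows "admissible_kernel (\<lambda>x t. k x t + l x t)"
proof -
  have "set_borel_measurable borel half_slab (\<lambda>p. k (fst p) (snd p) + l (fst p) (snd p))"
    using borel_measurable_add[OF admissible_kernel_measurable[OF k, unfolded set_borel_measurable_def]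
      admissible_kernel_measurable[OF l, unfolded set_borel_measurable_def]]
    by (simp add: set_borel_measurable_def distrib_left)
  then show ?thesis
    unfolding admissible_kernel_def
    by (intro conjI allI impI bounded_Ck_add open_upper_box admissible_kernel_bounded_Ck k l)
      (simp_all add: admissible_kernel_nonpos k l)
qed

lemma admissible_kernel_scale:
  assumes k: "admissible_kernel k"
  shows "admissible_kernel (\<lambda>x t. a * k x t)"
proof -
  have "set_borel_measurable borel half_slab (\<lambda>p. a * k (fst p) (snd p))"
    using borel_measurable_times[OF borel_measurable_const[of a] admissible_kernel_measurable[OF k, unfolded set_borel_measurable_def]]
    by (simp add: set_borel_measurable_def mult_ac)
  then show ?thesis
    unfolding admissible_kernel_def
    by (intro conjI allI impI bounded_Ck_scale open_upper_box admissible_kernel_bounded_Ck k)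
      (simp_all add: admissible_kernel_nonpos k)
qed

text \<open>Bounds that are uniform in \<open>t\<close> thereby also fit the singular
  weight.\<close>

lemma powr_minus_half_ge_1: "t \<in> {0<..<1} \<Longrightarrow> 1 \<le> t powr (- 1 / 2)" for t :: real
  using powr_mono2'[of "-1/2" t 1] by simp

lemma heat_kernel_measurable [measurable]:
  "(\<lambda>p::'a::euclidean_space \<times> real. heat_kernel (fst p) (snd p)) \<in> borel_measurable borel"
  unfolding heat_kernel_def borel_prod[symmetric] by measurable

lemma pd_heat_kernel_eq:
  "pd None (\<lambda>y. heat_kernel y t) y = (if t > 0 then - (snd y) / (2 * t) * heat_kernel y t else 0)"
  for y :: "'m::finite space"
  using pd_heat_kernel[of t y] pd_heat_kernel_nonpos[of t None y] by auto

lemma pd_heat_kernel_measurable [measurable]: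
  "(\<lambda>p::'m::finite space \<times> real. pd None (\<lambda>y. heat_kernel y (snd p)) (fst p)) \<in> borel_measurable borel"
  unfolding pd_heat_kernel_eq
proof (rule measurable_If)
  have [measurable]: "(\<lambda>p::'m space \<times> real. snd (fst p)) \<in> borel_measurable borel"
    "(\<lambda>p::'m space \<times> real. snd p) \<in> borel_measurable borel"
    by (intro borel_measurable_continuous_onI continuous_intros)+
  show "(\<lambda>p::'m space \<times> real. - snd (fst p) / (2 * snd p) * heat_kernel (fst p) (snd p)) \<in> borel_measurable borel"
    by measurable
  show "{p \<in> space borel. 0 < snd (p :: 'm space \<times> real)} \<in> sets borel" by measurable
qed auto

lemma admissible_kernel_pd_heat_kernel:
  "admissible_kernel (\<lambda>(x::'m::finite space) t. pd None (\<lambda>y. heat_kernel y t) x)"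
proof -
  have "bounded_Ck n (upper_box c R) {0<..<1} (\<lambda>t _. t powr (- 1 / 2)) (\<lambda>t (x::'m space). pd None (\<lambda>y. heat_kernel y t) x)"
    if "c > 0" for n c R
  proof (rule bounded_Ck_weight[where B=1])
    show "bounded_Ck n (upper_box c R) {0<..<1} (\<lambda>t y. exp (- (norm y)\<^sup>2 / 16)) (\<lambda>t (x::'m space). pd None (\<lambda>y. heat_kernel y t) x)"
      by (rule bounded_Ck_subset[OF bounded_Ck_pd_heat_kernel[OF that] upper_box_subset_norm_gt]) simp
    show "0 \<le> exp (- (norm y)\<^sup>2 / 16) \<and> exp (- (norm y)\<^sup>2 / 16) \<le> 1 * t powr (- 1 / 2)"
      if "t \<in> {0<..<1}" for t :: real and y :: "'m space"
      using powr_minus_half_ge_1[OF that] by (auto intro: order_trans[of _ 1])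
  qed
  moreover have "set_borel_measurable borel half_slab (\<lambda>p::'m space \<times> real. pd None (\<lambda>y. heat_kernel y (snd p)) (fst p))"
    unfolding set_borel_measurable_def by measurable
  ultimately show ?thesis
    unfolding admissible_kernel_def by (simp add: pd_heat_kernel_nonpos)
qed

text \<open>The data are merely Lebesgue measurable, while the measurability arguments for the
  potentials are carried out with Borel functions. Multiplying a Borel representative by the
  indicator of a ball makes it vanish outside everywhere, not just almost everywhere.\<close>

lemma integrable_lebesgue_borel_version:
  fixes gS :: "'a::euclidean_space \<Rightarrow> real"
  assumes g: "integrable lebesgue gS" and Y: "AE y in lebesgue. norm y > Y \<longrightarrow> gS y = 0"
  shows "\<exists>g0. integrable lborel g0 \<and> (AE y in lebesgue. gS y = g0 y) \<and> (\<forall>y. norm y > Y \<longrightarrow> g0 y = 0)"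
proof -
  obtain g1 where g1[measurable]: "g1 \<in> borel_measurable lborel" and eq: "AE y in lborel. gS y = g1 y"
    using completion_ex_borel_measurable_real[OF borel_measurable_integrable[OF g]] by blast
  define g0 where "g0 y = indicat_real (cball 0 Y) y * g1 y" for y
  have m: "g0 \<in> borel_measurable lborel" unfolding g0_def by (intro borel_measurable_times borel_measurable_indicator g1) auto
  have AE: "AE y in lebesgue. gS y = g0 y"
    using AE_completion[OF eq] Y by eventually_elim (auto simp: g0_def indicator_def)
  have "integrable lebesgue g0"
    by (rule integrable_cong_AE_imp[OF g _ AE[THEN AE_mp]]) (use m in \<open>auto intro: measurable_completion\<close>)
  then have "integrable lborel g0" using integrable_completion[OF m] by simp
  then show ?thesis using AE by (intro exI[of _ g0]) (auto simp: g0_def)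
qed

lemma set_integrable_powr_minus_half: "set_integrable lborel {0<..<1} (\<lambda>s::real. s powr (- 1 / 2))"
proof -
  have "set_integrable lebesgue {0..1} (\<lambda>s::real. s powr (- 1 / 2))"
    by (rule nonnegative_absolutely_integrable_1[OF integrable_on_powr_from_0]) auto
  then have "set_integrable lborel {0..1} (\<lambda>s::real. s powr (- 1 / 2))"
    unfolding set_integrable_def by (subst (asm) integrable_completion) auto
  then show ?thesis by (rule set_integrable_subset) auto
qed

text \<open>The function |g0 y| * w \<omega> dominates: for |y| \<le> Y the point x - (y, 0) lies in
  the box with radius R + Y and the same c. The parameter set is a time interval for the
  convolutions and a single point for the instantaneous terms.\<close>

lemma bounded_Ck_boundary_potential:
  fixes k :: "'w \<Rightarrow> 'm::finite space \<Rightarrow> real"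
  assumes k: "\<And>n c R. c > 0 \<Longrightarrow> bounded_Ck n (upper_box c R) W (\<lambda>\<omega> _. w \<omega>) k"
    and w: "\<And>\<omega>. \<omega> \<in> W \<Longrightarrow> 0 \<le> w \<omega>"
    and m: "\<And>\<omega> x. \<omega> \<in> W \<Longrightarrow> snd x > 0 \<Longrightarrow> (\<lambda>y. k \<omega> (x - (y, 0))) \<in> borel_measurable borel"
    and g0: "integrable lborel g0" and Y: "\<And>y. norm y > Y \<Longrightarrow> g0 y = 0" and c: "c > 0"
  shows "bounded_Ck n (upper_box c R) W (\<lambda>\<omega> _. w \<omega>)
    (\<lambda>\<omega> x. LINT y|lborel. k \<omega> (x - (y, 0)) * g0 y)"
proof -
  have [measurable]: "g0 \<in> borel_measurable borel" using g0 by (simp add: borel_measurable_integrable)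
  have "bounded_Ck n (upper_box c R) W (\<lambda>\<omega> _. w \<omega>)
    (\<lambda>\<omega> x. LINT y:cball 0 Y|lborel. g0 y * k \<omega> (x - (y, 0)))"
  proof (rule bounded_Ck_set_integral[where w="\<lambda>\<omega> y. \<bar>g0 y\<bar> * w \<omega>" and C="LINT y:cball 0 Y|lborel. \<bar>g0 y\<bar>"])
    fix n
    have "bounded_Ck n (upper_box c R) (W \<times> cball 0 Y) (\<lambda>p _. w (fst p)) (\<lambda>p x. k (fst p) (x - (snd p, 0)))"
    proof (rule bounded_Ck_translate[OF k[OF c, of n "R + Y"] open_upper_box])
      fix p :: "'w \<times> (real ^ 'm)" and x :: "'m space"
      assume "p \<in> W \<times> cball 0 Y" "x \<in> upper_box c R"
      moreover have "norm (x - (snd p, 0)) \<le> norm x + norm (snd p)"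
        using norm_triangle_ineq4[of x "(snd p, 0)"] by (simp add: norm_Pair)
      ultimately show "fst p \<in> W \<and> x - (snd p, 0) \<in> upper_box c (R + Y)"
        by (auto simp: upper_box_def)
    qed
    from bounded_Ck_cmult[OF open_upper_box this, of "\<lambda>p. g0 (snd p)"] w
    show "bounded_Ck n (upper_box c R) (W \<times> cball 0 Y) (\<lambda>p x. \<bar>g0 (snd p)\<bar> * w (fst p)) (\<lambda>p x. g0 (snd p) * k (fst p) (x - (snd p, 0)))"
      by auto
  next
    fix \<omega> and x :: "'m space" assume "\<omega> \<in> W" "x \<in> upper_box c R"
    then have [measurable]: "(\<lambda>y. k \<omega> (x - (y, 0))) \<in> borel_measurable borel"
      using m c by (auto simp: upper_box_def)
    have "(\<lambda>y. g0 y * k \<omega> (x - (y, 0))) \<in> borel_measurable borel" by measurable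
    then show "set_borel_measurable lborel (cball 0 Y) (\<lambda>y. g0 y * k \<omega> (x - (y, 0)))"
      unfolding set_borel_measurable_def by (intro borel_measurable_scaleR borel_measurable_indicator) auto
  next
    have "set_integrable lborel (cball 0 Y) (\<lambda>y. \<bar>g0 y\<bar>)"
      by (rule set_integrable_subset[of _ UNIV]) (use g0 in \<open>auto simp: set_integrable_def\<close>)
    then show "set_integrable lborel (cball 0 Y) (\<lambda>y. \<bar>g0 y\<bar> * w \<omega>)" for \<omega>
      by simp
  qed (use w open_upper_box in auto)
  moreover have "(LINT y:cball 0 Y|lborel. g0 y * k \<omega> (x - (y, 0))) = (LINT y|lborel. k \<omega> (x - (y, 0)) * g0 y)" for \<omega> x
    unfolding set_lebesgue_integral_def using Y
    by (intro Bochner_Integration.integral_cong) (auto simp: indicator_def)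
  ultimately show ?thesis by simp
qed

lemma admissible_kernel_section_measurable:
  fixes k :: "'m::finite space \<Rightarrow> real \<Rightarrow> real"
  assumes "admissible_kernel k" "snd x > 0"
  shows "(\<lambda>p. indicator {0<..<1} (snd p) * k (x - (fst p, 0)) (snd p)) \<in> borel_measurable borel"
proof -
  have "(\<lambda>p. (x - (fst p, 0), snd p)) \<in> (borel :: ((real ^ 'm) \<times> real) measure) \<rightarrow>\<^sub>M borel"
    by (intro borel_measurable_continuous_onI continuous_intros)
  from measurable_compose[OF this admissible_kernel_measurable[OF assms(1), unfolded set_borel_measurable_def]]
  show ?thesis
    by (rule back_subst[of "\<lambda>f. f \<in> borel_measurable borel"])
      (use assms(2) in \<open>auto simp: indicator_def half_slab_def fun_eq_iff\<close>)
qed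

lemma lebesgue_integral_reflect:
  fixes f :: "real \<Rightarrow> real"
  assumes "f \<in> borel_measurable borel"
  shows "(LINT s|lebesgue. f (t - s)) = (LINT r|lborel. f r)"
proof -
  have "(LINT s|lebesgue. f (t - s)) = (LINT s|lborel. f (t - s))"
    by (rule integral_completion) (use assms in measurable)
  then show ?thesis using lborel_integral_real_affine[of "-1" f t] by simp
qed

lemma lebesgue_integral_borel_version:
  fixes f g0 gS :: "'a::euclidean_space \<Rightarrow> real"
  assumes f: "f \<in> borel_measurable borel" and g0: "integrable lborel g0" and gS: "integrable lebesgue gS"
    and AE: "AE y in lebesgue. gS y = g0 y"
  shows "(LINT y|lebesgue. f y * gS y) = (LINT y|lborel. f y * g0 y)"
proof -
  have [measurable]: "g0 \<in> borel_measurable lborel" "f \<in> borel_measurable lborel" 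
    "gS \<in> borel_measurable lebesgue"
    using g0 gS f by (simp_all add: borel_measurable_integrable)
  have [measurable]: "g0 \<in> borel_measurable lebesgue" "f \<in> borel_measurable lebesgue"
    by (simp_all add: measurable_completion)
  have "(LINT y|lebesgue. f y * gS y) = (LINT y|lebesgue. f y * g0 y)"
    by (rule integral_cong_AE) (use AE in auto)
  also have "\<dots> = (LINT y|lborel. f y * g0 y)"
    by (rule integral_completion) measurable
  finally show ?thesis .
qed

text \<open>In the variable r = t - s the integrand is a function of (r, x) times \<open>gT\<close>
  (t - r). Space derivatives act on the first factor, time derivatives on the second, and all of
  them are dominated by r powr (- 1 / 2), which is integrable on (0, 1).\<close>

lemma bounded_Ck_convolution:
  fixes k :: "'m::finite space \<Rightarrow> real \<Rightarrow> real"
  assumes k: "admissible_kernel k"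
    and gS: "integrable lebesgue gS" and gSY: "AE y in lebesgue. norm y > Y \<longrightarrow> gS y = 0"
    and gT: "\<And>n. bounded_Ck n UNIV {()} (\<lambda>_ _. 1) (\<lambda>_. gT)"
    and gT0: "\<And>s. s \<notin> {0<..<1} \<Longrightarrow> gT s = 0"
    and c: "c > 0"
  shows "bounded_Ck n (upper_box c R \<times> {0<..<1}) {()} (\<lambda>_ _. 1)
    (\<lambda>_ q. LINT s|lebesgue. LINT y|lebesgue. k (fst q - (y, 0)) (snd q - s) * (a * gS y * gT s))"
proof -
  obtain g0 where g0: "integrable lborel g0" and g0_eq: "AE y in lebesgue. gS y = g0 y"
    and g0_Y: "\<And>y. norm y > Y \<Longrightarrow> g0 y = 0"
    using integrable_lebesgue_borel_version[OF gS gSY] by blast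
  have [measurable]: "g0 \<in> borel_measurable borel" using g0 by (simp add: borel_measurable_integrable)
  have "continuous_on UNIV gT"
    using bounded_Ck_has_derivative[OF gT[of "Suc 0"]]
    by (intro continuous_at_imp_continuous_on ballI has_derivative_continuous) auto
  then have [measurable]: "gT \<in> borel_measurable borel" by (rule borel_measurable_continuous_onI)
  \<comment> \<open>The potential of the boundary data with the kernel frozen at time lag
    \<open>s\<close>; it inherits the weight of the kernel.\<close>
  define \<kappa> where "\<kappa> s x = (LINT y|lborel. k (x - (y, 0)) s * g0 y)" for s x
  have sec: "(\<lambda>p. indicator {0<..<1} (snd p) * k (x - (fst p, 0)) (snd p)) \<in> borel_measurable borel"
    if "snd x > 0" for x
    by (rule admissible_kernel_section_measurable[OF k that])
  have km: "(\<lambda>y. k (x - (y, 0)) t) \<in> borel_measurable borel" if "t \<in> {0<..<1}" "snd x > 0" for t x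
    using measurable_compose[OF _ sec[OF that(2)], of "\<lambda>y. (y, t)" borel] that(1)
    by (simp add: borel_measurable_continuous_onI continuous_intros)
  have \<kappa>: "bounded_Ck n (upper_box c R) {0<..<1} (\<lambda>t _. t powr (- 1 / 2)) \<kappa>" for n
    unfolding \<kappa>_def[abs_def]
    by (rule bounded_Ck_boundary_potential[OF admissible_kernel_bounded_Ck[OF k] _ km g0 g0_Y c]) auto
  have \<kappa>m: "(\<lambda>s. indicator {0<..<1} s * \<kappa> s x) \<in> borel_measurable borel" if "snd x > 0" for x
  proof -
    have "(\<lambda>s. LINT y|lborel. indicator {0<..<1} s * k (x - (y, 0)) s * g0 y) \<in> borel_measurable borel"
    proof (rule lborel.borel_measurable_lebesgue_integral)
      have "(\<lambda>(s, y). (y, s)) \<in> (borel :: (real \<times> (real ^ 'm)) measure) \<rightarrow>\<^sub>M borel"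
        by (intro borel_measurable_continuous_onI) (simp add: case_prod_unfold continuous_intros)
      from measurable_compose[OF this sec[OF that]]
      have "(\<lambda>(s, y). indicator {0<..<1} s * k (x - (y, 0)) s) \<in> borel_measurable (borel \<Otimes>\<^sub>M borel)"
        by (simp add: case_prod_unfold borel_prod)
      then show "(\<lambda>(s, y). indicator {0<..<1} s * k (x - (y, 0)) s * g0 y) \<in> borel_measurable (borel \<Otimes>\<^sub>M lborel)"
        by (simp add: case_prod_unfold) 
    qed
    then show ?thesis by (simp add: \<kappa>_def mult.assoc)
  qed
  have "bounded_Ck n (upper_box c R \<times> {0<..<1}) {()} (\<lambda>_ _. 1)
    (\<lambda>_ q. LINT s:{0<..<1}|lborel. \<kappa> s (fst q) * gT (snd q - s))"
  proof (rule bounded_Ck_set_integral[where w="\<lambda>_ s. s powr (- 1 / 2)" and C="LINT s:{0<..<1::real}|lborel. s powr (- 1 / 2)"])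
    fix n
    let ?S = "upper_box c R \<times> {0<..<1} :: ('m space \<times> real) set" and ?W = "{()} \<times> {0<..<1::real}"
    have S: "open ?S" by (intro open_Times open_upper_box) auto
    have 1: "bounded_Ck n ?S ?W (\<lambda>p _. snd p powr (- 1 / 2)) (\<lambda>p q. \<kappa> (snd p) (fst q + 0))"
      by (rule bounded_Ck_affine[OF \<kappa> S bounded_linear_fst, where z="\<lambda>_. 0"]) auto
    have 2: "bounded_Ck n ?S ?W (\<lambda>p _. 1) (\<lambda>p q. gT (snd q + (- snd p)))"
      by (rule bounded_Ck_affine[OF gT S bounded_linear_snd, where \<phi>="\<lambda>_. ()" and z="\<lambda>p. - snd p"]) auto
    show "bounded_Ck n ?S ?W (\<lambda>p _. snd p powr (- 1 / 2)) (\<lambda>p q. \<kappa> (snd p) (fst q) * gT (snd q - snd p))"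
      using bounded_Ck_mult[OF S 1 2] by simp
  next
    fix q :: "'m space \<times> real" assume "q \<in> upper_box c R \<times> {0<..<1}"
    then have [measurable]: "(\<lambda>s. indicator {0<..<1} s * \<kappa> s (fst q)) \<in> borel_measurable borel"
      using c by (intro \<kappa>m) (auto simp: upper_box_def)
    have "(\<lambda>s. (indicator {0<..<1} s * \<kappa> s (fst q)) * gT (snd q - s)) \<in> borel_measurable borel" by measurable
    then show "set_borel_measurable lborel {0<..<1} (\<lambda>s. \<kappa> s (fst q) * gT (snd q - s))"
      by (simp add: set_borel_measurable_def mult.assoc)
  qed (use set_integrable_powr_minus_half in \<open>auto intro!: open_Times open_upper_box\<close>)
  then have "bounded_Ck n (upper_box c R \<times> {0<..<1}) {()} (\<lambda>_ _. 1)
    (\<lambda>_ q. a * (LINT s:{0<..<1}|lborel. \<kappa> s (fst q) * gT (snd q - s)))"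
    by (intro bounded_Ck_scale) (auto intro!: open_Times open_upper_box)
  then show ?thesis
  proof (rule bounded_Ck_cong[rotated 2])
    fix q :: "'m space \<times> real" assume "q \<in> upper_box c R \<times> {0<..<1}"
    then obtain x t where q: "q = (x, t)" and x: "snd x > 0" and t: "0 < t" "t < 1"
      using c by (cases q) (auto simp: upper_box_def)
    define G where "G r = (indicator {0<..<1} r * \<kappa> r x) * (a * gT (t - r))" for r
    have [measurable]: "G \<in> borel_measurable borel"
      unfolding G_def using \<kappa>m[OF x] by measurable
    have "(LINT y|lebesgue. k (x - (y, 0)) (t - s) * (a * gS y * gT s)) = G (t - s)" for s
    proof (cases "t - s \<in> {0<..<1}")
      case True
      have "(LINT y|lebesgue. k (x - (y, 0)) (t - s) * (a * gS y * gT s)) = (LINT y|lebesgue. (a * gT s) * (k (x - (y, 0)) (t - s) * gS y))"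
        by (simp add: mult_ac)
      also have "\<dots> = (a * gT s) * (LINT y|lebesgue. k (x - (y, 0)) (t - s) * gS y)"
        by (rule integral_mult_right_zero)
      also have "(LINT y|lebesgue. k (x - (y, 0)) (t - s) * gS y) = \<kappa> (t - s) x"
        unfolding \<kappa>_def by (rule lebesgue_integral_borel_version[OF km[OF True x] g0 gS g0_eq])
      finally show ?thesis using True by (simp add: G_def)
    next
      \<comment> \<open>For t - s \<le> 0 the kernel vanishes. For t - s \<ge> 1 one has s < 0, as t
        < 1, and the time factor vanishes. So restricting the lag to (0, 1) changes nothing.\<close>
      case False
      then have "k (x - (y, 0)) (t - s) * gT s = 0" for y
        using admissible_kernel_nonpos[OF k, of "t - s"] gT0[of s] t by (cases "t - s \<le> 0") auto
      then have "k (x - (y, 0)) (t - s) * (a * gS y * gT s) = 0" for y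
        by (metis mult.commute mult.left_commute mult_zero_right)
      then have "(LINT y|lebesgue. k (x - (y, 0)) (t - s) * (a * gS y * gT s)) = 0"
        by (simp only: integral_zero)
      then show ?thesis using False by (auto simp: G_def)
    qed
    then have "(LINT s|lebesgue. LINT y|lebesgue. k (x - (y, 0)) (t - s) * (a * gS y * gT s)) = (LINT r|lborel. G r)"
      by (simp add: lebesgue_integral_reflect)
    also have "\<dots> = (LINT r|lborel. a * (indicator {0<..<1} r *\<^sub>R (\<kappa> r x * gT (t - r))))"
      by (simp add: G_def mult_ac)
    also have "\<dots> = a * (LINT s:{0<..<1}|lborel. \<kappa> s x * gT (t - s))"
      unfolding set_lebesgue_integral_def by (rule integral_mult_right_zero)
    finally show "a * (LINT s:{0<..<1}|lborel. \<kappa> s (fst q) * gT (snd q - s)) =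
      (LINT s|lebesgue. LINT y|lebesgue. k (fst q - (y, 0)) (snd q - s) * (a * gS y * gT s))"
      by (simp add: q)
  qed (auto intro!: open_Times open_upper_box)
qed

section \<open>The kernels of the representation formula are admissible\<close>

lemma laplace_kernel_measurable [measurable]:
  "(laplace_kernel :: 'a::euclidean_space \<Rightarrow> real) \<in> borel_measurable borel"
  unfolding laplace_kernel_def[abs_def] by measurable

lemma pd_laplace_kernel_measurable [measurable]:
  "(pd i laplace_kernel :: 'm::finite space \<Rightarrow> real) \<in> borel_measurable borel"
proof -
  obtain \<kappa> where \<kappa>: "\<And>i (y :: 'm space). y \<noteq> 0 \<Longrightarrow>
    pd i laplace_kernel y = \<kappa> * ((y \<bullet> unit_dir i) / (norm y)\<^sup>2) * norm y powr (1 - real CARD('m))"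
    using pd_laplace_kernel[where 'm='m] by blast
  have "pd i laplace_kernel = (\<lambda>y :: 'm space. if y = 0 then pd i laplace_kernel 0
      else \<kappa> * ((y \<bullet> unit_dir i) / (norm y)\<^sup>2) * norm y powr (1 - real CARD('m)))"
    using \<kappa> by (auto simp: fun_eq_iff)
  also have "\<dots> \<in> borel_measurable borel"
    by measurable
  finally show ?thesis .
qed

lemma norm_unit_dir [simp]: "norm (unit_dir i) = 1"
  by (cases i) (auto simp: norm_Pair)

lemma pd_laplace_kernel_bound:
  "\<exists>C\<ge>0. \<forall>i (y :: 'm::finite space). y \<noteq> 0 \<longrightarrow> \<bar>pd i laplace_kernel y\<bar> \<le> C * norm y powr (1 - real DIM('m space))"
proof -
  obtain \<kappa> where \<kappa>: "\<And>i (y :: 'm space). y \<noteq> 0 \<Longrightarrow>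
    pd i laplace_kernel y = \<kappa> * ((y \<bullet> unit_dir i) / (norm y)\<^sup>2) * norm y powr (1 - real CARD('m))"
    using pd_laplace_kernel[where 'm='m] by blast
  have "\<bar>pd i laplace_kernel y\<bar> \<le> \<bar>\<kappa>\<bar> * norm y powr (1 - real DIM('m space))"
    if y: "y \<noteq> 0" for i and y :: "'m space"
  proof -
    have "\<bar>y \<bullet> unit_dir i\<bar> \<le> norm y"
      using Cauchy_Schwarz_ineq2[of y "unit_dir i"] by simp
    then have "\<bar>y \<bullet> unit_dir i\<bar> / (norm y)\<^sup>2 \<le> norm y / (norm y)\<^sup>2"
      by (rule divide_right_mono) simp
    also have "\<dots> = norm y powr (- 1)" using y by (simp add: powr_minus_divide power2_eq_square)
    finally have "\<bar>y \<bullet> unit_dir i\<bar> / (norm y)\<^sup>2 * norm y powr (1 - real CARD('m)) \<le> norm y powr (- 1) * norm y powr (1 - real CARD('m))"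
      by (rule mult_right_mono) simp
    also have "\<dots> = norm y powr (1 - real DIM('m space))" unfolding powr_add[symmetric] by simp
    finally have "\<bar>\<kappa>\<bar> * (\<bar>y \<bullet> unit_dir i\<bar> / (norm y)\<^sup>2 * norm y powr (1 - real CARD('m))) \<le> \<bar>\<kappa>\<bar> * norm y powr (1 - real DIM('m space))"
      by (rule mult_left_mono) simp
    then show ?thesis by (simp add: \<kappa>[OF y] abs_mult mult.assoc)
  qed
  then show ?thesis by (intro exI[of _ "\<bar>\<kappa>\<bar>"]) auto
qed

section \<open>Integral bounds for the heat kernel, and the kernel \<A>\<close>

lemma heat_kernel_nonneg: "heat_kernel x t \<ge> 0"
  by (simp add: heat_kernel_def)

text \<open>The linear factor costs half of the Gaussian exponent; 10 is 2 + 1 / \<epsilon> for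
  \<epsilon> = 1 / 8.\<close>

lemma heat_kernel_linear_bound:
  fixes z :: "'a::euclidean_space"
  assumes t: "t \<in> {0<..<1}"
  shows "heat_kernel z t * (1 + norm z) \<le> 10 * (4 * pi * t) powr (- real DIM('a) / 2) * exp (- (norm z)\<^sup>2 / (8 * t))"
proof -
  have "(norm z)\<^sup>2 / 8 \<le> (norm z)\<^sup>2 / (8 * t)"
    using t by (intro divide_left_mono) auto
  then have "exp ((1 / 8) * (norm z)\<^sup>2) \<le> exp ((norm z)\<^sup>2 / (8 * t))" by simp
  moreover have "1 + norm z \<le> 10 * exp ((1 / 8) * (norm z)\<^sup>2)"
    using linear_le_exp_square[of "1/8" "norm z"] by simp
  ultimately have "1 + norm z \<le> 10 * exp ((norm z)\<^sup>2 / (8 * t))" by linarith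
  then have "heat_kernel z t * (1 + norm z) \<le> heat_kernel z t * (10 * exp ((norm z)\<^sup>2 / (8 * t)))"
    by (intro mult_left_mono) (auto simp: heat_kernel_def)
  also have "\<dots> = 10 * (4 * pi * t) powr (- real DIM('a) / 2) * (exp (- (norm z)\<^sup>2 / (4 * t)) * exp ((norm z)\<^sup>2 / (8 * t)))"
    using t by (simp add: heat_kernel_def)
  also have "exp (- (norm z)\<^sup>2 / (4 * t)) * exp ((norm z)\<^sup>2 / (8 * t)) = exp (- (norm z)\<^sup>2 / (8 * t))"
    unfolding exp_add[symmetric] using t by (simp add: field_simps)
  finally show ?thesis .
qed

text \<open>In the scaled variable r = |z| / sqrt t the factor |z_n| / (2 t) is at most t powr (- 1
  / 2) * r / 2, and r is absorbed by half of the exponent. The constant 5 is 10 / 2.\<close>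

lemma pd_heat_kernel_bound:
  fixes z :: "'m::finite space"
  assumes t: "t \<in> {0<..<1}"
  shows "\<bar>pd None (\<lambda>y. heat_kernel y t) z\<bar>
    \<le> 5 * t powr (- 1 / 2) * (4 * pi * t) powr (- real DIM('m space) / 2) * exp (- (norm z)\<^sup>2 / (8 * t))"
proof -
  define r where "r = norm z / sqrt t"
  have "r \<le> 10 * exp ((1 / 8) * r\<^sup>2)" using linear_le_exp_square[of "1/8" r] by simp
  also have "r\<^sup>2 = (norm z)\<^sup>2 / t" using t by (simp add: r_def power_divide)
  finally have "norm z \<le> 10 * exp ((norm z)\<^sup>2 / (8 * t)) * sqrt t"
    using t by (simp add: r_def field_simps)
  moreover have "\<bar>snd z\<bar> \<le> norm z" by (rule snd_le_norm)
  ultimately have z: "\<bar>snd z\<bar> \<le> 10 * exp ((norm z)\<^sup>2 / (8 * t)) * sqrt t" by linarith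
  have "\<bar>pd None (\<lambda>y. heat_kernel y t) z\<bar> = \<bar>snd z\<bar> * (heat_kernel z t / (2 * t))"
    using t by (simp add: pd_heat_kernel abs_mult heat_kernel_nonneg)
  also have "\<dots> \<le> (10 * exp ((norm z)\<^sup>2 / (8 * t)) * sqrt t) * (heat_kernel z t / (2 * t))"
    using t by (intro mult_right_mono z) (auto simp: heat_kernel_def)
  also have "\<dots> = 5 * (sqrt t / t) * (4 * pi * t) powr (- real DIM('m space) / 2) * (exp (- (norm z)\<^sup>2 / (4 * t)) * exp ((norm z)\<^sup>2 / (8 * t)))"
    using t by (simp add: heat_kernel_def)
  also have "exp (- (norm z)\<^sup>2 / (4 * t)) * exp ((norm z)\<^sup>2 / (8 * t)) = exp (- (norm z)\<^sup>2 / (8 * t))"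
    unfolding exp_add[symmetric] using t by (simp add: field_simps)
  also have "sqrt t / t = t powr (- 1 / 2)"
    using t by (simp add: powr_half_sqrt[symmetric] powr_minus_divide field_simps powr_mult_base[symmetric])
       (simp add: powr_half_sqrt)
  finally show ?thesis .
qed

text \<open>Collects the powers of \<open>t\<close> when a heat kernel prefactor meets the integral
  of exp (- |z|^2 / (8 t)). They cancel for a = b and leave t powr (- 1 / 2) when the integration is
  one dimension short.\<close>

lemma gaussian_constant:
  assumes "t > 0"
  shows "(4 * pi * t) powr (- a) * (pi * (8 * t)) powr b = (4 * pi) powr (- a) * (8 * pi) powr b * t powr (b - a)"
proof -
  have "(4 * pi * t) powr (- a) = (4 * pi) powr (- a) * t powr (- a)" using assms by (simp add: powr_mult)
  moreover have "(pi * (8 * t)) powr b = (8 * pi) powr b * t powr b"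
    using assms powr_mult[of "8 * pi" t b] by (simp add: mult_ac)
  moreover have "t powr (b - a) = t powr b * t powr (- a)" by (simp add: powr_add[symmetric])
  ultimately show ?thesis by simp
qed

lemma lborel_integral_reflect:
  fixes f :: "'a::euclidean_space \<Rightarrow> real"
  assumes [measurable]: "f \<in> borel_measurable borel"
  shows "(LINT z|lborel. f (x - z)) = (LINT z|lborel. f z)"
proof -
  have "(lborel :: 'a measure) = density (distr lborel borel (\<lambda>z. x + (-1) *\<^sub>R z)) (\<lambda>_. 1)"
    using lborel_affine[of "-1" x] by simp
  then have "(LINT z|lborel. f z) = (LINT z|distr lborel borel (\<lambda>z. x - z). f z)"
    by (simp add: density_1)
  also have "\<dots> = (LINT z|lborel. f (x - z))" by (subst integral_distr) auto
  finally show ?thesis ..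
qed

lemma kernel_A_lborel: "kernel_A x t = (LINT z'|lborel. heat_kernel (z' :: real ^ 'm, 0 :: real) t * laplace_kernel (x - (z', 0)))"
  for x :: "'m::finite space"
proof -
  have [measurable]: "(\<lambda>z'. (z', 0)) \<in> borel \<rightarrow>\<^sub>M (borel :: 'm space measure)" "(\<lambda>z'. x - (z', 0)) \<in> borel \<rightarrow>\<^sub>M (borel :: 'm space measure)"
    by (intro borel_measurable_continuous_onI continuous_intros)+
  have [measurable]: "(\<lambda>z :: 'm space. heat_kernel z t) \<in> borel_measurable borel"
    unfolding heat_kernel_def by measurable
  show ?thesis unfolding kernel_A_def
    by (rule integral_completion) measurable
qed

text \<open>All derivatives in \<open>x\<close> fall on E(x - z'), which is smooth with at most
  linear growth as long as x_n > c. The heat kernel, being independent of \<open>x\<close>, serves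
  as the weight.\<close>

lemma admissible_kernel_kernel_A: "admissible_kernel (kernel_A :: 'm::finite space \<Rightarrow> real \<Rightarrow> real)"
proof -
  let ?n = "real DIM('m space)" and ?d = "real DIM(real ^ 'm)"
  have nd: "?n = ?d + 1" by simp
  have [measurable]: "(\<lambda>z :: 'm space. heat_kernel z t) \<in> borel_measurable borel" for t
    unfolding heat_kernel_def by measurable
  have mp [measurable]: "(\<lambda>z'. (z', 0)) \<in> borel \<rightarrow>\<^sub>M (borel :: 'm space measure)"
    "(\<lambda>z'. x - (z', 0)) \<in> borel \<rightarrow>\<^sub>M (borel :: 'm space measure)" for x
    by (intro borel_measurable_continuous_onI continuous_intros)+
  have "bounded_Ck n (upper_box c R) {0<..<1} (\<lambda>t _. t powr (- 1 / 2)) (\<lambda>t (x :: 'm space). kernel_A x t)"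
    if c: "c > 0" for n c R
  proof -
    let ?w = "\<lambda>t (z' :: real ^ 'm). heat_kernel (z', 0 :: real) t * (1 + norm z')"
    have w: "?w t z' \<le> 10 * (4 * pi * t) powr (- ?n / 2) * exp (- (norm z')\<^sup>2 / (8 * t))" and w0: "0 \<le> ?w t z'"
      if "t \<in> {0<..<1}" for t z'
      using heat_kernel_linear_bound[OF that, of "(z', 0 :: real)"] by (auto simp: norm_Pair heat_kernel_def)
    have wi: "integrable lborel (?w t)" if t: "t \<in> {0<..<1}" for t
    proof (rule Bochner_Integration.integrable_bound)
      show "integrable lborel (\<lambda>z' :: real ^ 'm. 10 * (4 * pi * t) powr (- ?n / 2) * exp (- (norm z')\<^sup>2 / (8 * t)))"
        using t by (intro integrable_mult_right integrable_gaussian) auto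
      show "AE z' in lborel. norm (?w t z') \<le> norm (10 * (4 * pi * t) powr (- ?n / 2) * exp (- (norm z')\<^sup>2 / (8 * t)))"
        using w[OF t] w0[OF t] by (intro AE_I2) (simp add: abs_mult heat_kernel_nonneg)
    qed measurable
    have "bounded_Ck n (upper_box c R) {0<..<1} (\<lambda>t _. t powr (- 1 / 2))
      (\<lambda>t (x :: 'm space). LINT z':UNIV|lborel. heat_kernel (z', 0 :: real) t * laplace_kernel (x - (z', 0)))"
    proof (rule bounded_Ck_set_integral[where w="?w" and C="10 * ((4 * pi) powr (- (?n / 2)) * (8 * pi) powr (?d / 2))"])
      fix n
      let ?S = "upper_box c R :: 'm space set" and ?W = "{0<..<1::real} \<times> (UNIV :: (real ^ 'm) set)"
      have "bounded_Ck n ?S ?W (\<lambda>p x. 1 + norm (x - (snd p, 0))) (\<lambda>p x. laplace_kernel (x - (snd p, 0)))"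
      proof (rule bounded_Ck_translate[OF bounded_Ck_laplace_kernel[OF c] open_upper_box, where \<phi>="\<lambda>_. ()"])
        fix p :: "real \<times> (real ^ 'm)" and x :: "'m space" assume "x \<in> ?S"
        then show "() \<in> {()} \<and> x - (snd p, 0) \<in> {y. norm y > c}"
          using snd_le_norm[of "x - (snd p, 0)"] by (auto simp: upper_box_def)
      qed
      \<comment> \<open>Removes \<open>x\<close> from the weight, using that the box bounds norm x
        by R; the dominating function has to depend on z' alone.\<close>
      then have "bounded_Ck n ?S ?W (\<lambda>p x. 1 + norm (snd p)) (\<lambda>p x. laplace_kernel (x - (snd p, 0)))"
      proof (rule bounded_Ck_weight[where B="1 + \<bar>R\<bar>"])
        fix p :: "real \<times> (real ^ 'm)" and x :: "'m space" assume "x \<in> ?S"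
        then have "norm (x - (snd p, 0)) \<le> \<bar>R\<bar> + norm (snd p)"
          using norm_triangle_ineq4[of x "(snd p, 0)"] by (auto simp: norm_Pair upper_box_def)
        also have "1 + (\<bar>R\<bar> + norm (snd p)) \<le> (1 + \<bar>R\<bar>) * (1 + norm (snd p))" by (simp add: algebra_simps)
        finally show "0 \<le> 1 + norm (x - (snd p, 0)) \<and> 1 + norm (x - (snd p, 0)) \<le> (1 + \<bar>R\<bar>) * (1 + norm (snd p))"
          by simp
      qed
      from bounded_Ck_cmult[OF open_upper_box this, of "\<lambda>p. heat_kernel (snd p, 0 :: real) (fst p)"]
      show "bounded_Ck n ?S ?W (\<lambda>p x. ?w (fst p) (snd p)) (\<lambda>p x. heat_kernel (snd p, 0 :: real) (fst p) * laplace_kernel (x - (snd p, 0)))"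
        by (simp add: heat_kernel_def)
    next
      fix t :: real assume t: "t \<in> {0<..<1}"
      show "set_integrable lborel UNIV (?w t)" using wi[OF t] by (simp add: set_integrable_def)
      have "(LINT z'|lborel. ?w t z') \<le> (LINT z'|lborel. 10 * (4 * pi * t) powr (- ?n / 2) * exp (- (norm (z' :: real ^ 'm))\<^sup>2 / (8 * t)))"
        using t by (intro integral_mono wi w integrable_mult_right integrable_gaussian) auto
      also have "\<dots> = 10 * ((4 * pi * t) powr (- (?n / 2)) * (pi * (8 * t)) powr (?d / 2))"
      proof -
        have "(LINT z|lborel. exp (- (norm (z :: real ^ 'm))\<^sup>2 / (8 * t))) = (pi * (8 * t)) powr (?d / 2)"
          by (rule integral_gaussian) (use t in simp)
        then show ?thesis by (simp only: integral_mult_right_zero minus_divide_left mult.assoc)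
      qed
      also have "\<dots> = 10 * ((4 * pi) powr (- (?n / 2)) * (8 * pi) powr (?d / 2) * t powr (?d / 2 - ?n / 2))"
        using gaussian_constant[of t "?n / 2" "?d / 2"] t by simp
      \<comment> \<open>The dimension d = n - 1 of the hyperplane against the dimension n in the
        prefactor is what leaves the exponent - 1 / 2.\<close>
      also have "?d / 2 - ?n / 2 = - 1 / 2" unfolding nd by (simp add: field_simps)
      finally show "(LINT z':UNIV|lborel. ?w t z') \<le> 10 * ((4 * pi) powr (- (?n / 2)) * (8 * pi) powr (?d / 2)) * t powr (- 1 / 2)"
        by (simp add: set_lebesgue_integral_def mult.assoc)
    next
      fix x :: "'m space" and t :: real
      show "set_borel_measurable lborel UNIV (\<lambda>z'. heat_kernel (z', 0 :: real) t * laplace_kernel (x - (z', 0)))"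
        unfolding set_borel_measurable_def by measurable
    qed (use w0 open_upper_box in auto)
    then show ?thesis by (simp add: kernel_A_lborel set_lebesgue_integral_def)
  qed
  moreover have "set_borel_measurable borel half_slab (\<lambda>p :: 'm space \<times> real. kernel_A (fst p) (snd p))"
  proof -
    have 1: "(\<lambda>q. ((snd q, 0), snd (fst q))) \<in> (borel :: (('m space \<times> real) \<times> (real ^ 'm)) measure) \<rightarrow>\<^sub>M (borel :: ('m space \<times> real) measure)"
      and 2: "(\<lambda>q. fst (fst q) - (snd q, 0)) \<in> (borel :: (('m space \<times> real) \<times> (real ^ 'm)) measure) \<rightarrow>\<^sub>M (borel :: 'm space measure)"
      by (intro borel_measurable_continuous_onI continuous_intros)+
    have "(\<lambda>(p, z'). heat_kernel (z', 0 :: real) (snd p) * laplace_kernel (fst p - (z', 0)))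
      \<in> borel_measurable ((borel :: ('m space \<times> real) measure) \<Otimes>\<^sub>M lborel)"
      using borel_measurable_times[OF measurable_compose[OF 1 heat_kernel_measurable] measurable_compose[OF 2 laplace_kernel_measurable]]
      by (subst measurable_cong_sets[OF sets_pair_measure_cong[OF refl sets_lborel] refl], subst borel_prod)
        (simp add: case_prod_unfold)
    then have "(\<lambda>p :: 'm space \<times> real. kernel_A (fst p) (snd p)) \<in> borel_measurable borel"
      unfolding kernel_A_lborel by (rule lborel.borel_measurable_lebesgue_integral)
    then show ?thesis unfolding set_borel_measurable_def by measurable
  qed
  moreover have "kernel_A x t = 0" if "t \<le> 0" for x :: "'m space" and t
    using that by (simp add: kernel_A_def heat_kernel_def)
  ultimately show ?thesis unfolding admissible_kernel_def by simp
qed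

lemma integrable_pd_heat_kernel:
  assumes t: "t \<in> {0<..<1}"
  shows "integrable lborel (\<lambda>z::'m::finite space. pd None (\<lambda>y. heat_kernel y t) z)"
    and "(LINT z|lborel. \<bar>pd None (\<lambda>y. heat_kernel y t) (z :: 'm space)\<bar>)
      \<le> 5 * ((4 * pi) powr (- (real DIM('m space) / 2)) * (8 * pi) powr (real DIM('m space) / 2)) * t powr (- 1 / 2)"
proof -
  let ?n = "real DIM('m space)"
  have m [measurable]: "(\<lambda>z::'m space. pd None (\<lambda>y. heat_kernel y t) z) \<in> borel_measurable borel"
    using measurable_compose[OF _ pd_heat_kernel_measurable, of "\<lambda>z. (z, t)" borel]
    by (simp add: borel_measurable_continuous_onI continuous_intros)
  have g: "integrable lborel (\<lambda>z::'m space. 5 * t powr (- 1 / 2) * (4 * pi * t) powr (- ?n / 2) * exp (- (norm z)\<^sup>2 / (8 * t)))"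
    using t by (intro integrable_mult_right integrable_gaussian) auto
  show int: "integrable lborel (\<lambda>z::'m space. pd None (\<lambda>y. heat_kernel y t) z)"
    by (rule Bochner_Integration.integrable_bound[OF g])
      (use pd_heat_kernel_bound[OF t, where 'm='m] in \<open>auto intro!: AE_I2 order_trans[OF _ abs_ge_self]\<close>)
  have "(LINT z|lborel. \<bar>pd None (\<lambda>y. heat_kernel y t) (z :: 'm space)\<bar>)
    \<le> (LINT z|lborel. 5 * t powr (- 1 / 2) * (4 * pi * t) powr (- ?n / 2) * exp (- (norm (z :: 'm space))\<^sup>2 / (8 * t)))"
    by (intro integral_mono g integrable_abs int pd_heat_kernel_bound t)
  also have "\<dots> = 5 * t powr (- 1 / 2) * ((4 * pi * t) powr (- (?n / 2)) * (pi * (8 * t)) powr (?n / 2))"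
  proof -
    have "(LINT z|lborel. exp (- (norm (z :: 'm space))\<^sup>2 / (8 * t))) = (pi * (8 * t)) powr (?n / 2)"
      by (rule integral_gaussian) (use t in simp)
    then show ?thesis by (simp only: integral_mult_right_zero minus_divide_left mult.assoc)
  qed
  also have "\<dots> = 5 * t powr (- 1 / 2) * ((4 * pi) powr (- (?n / 2)) * (8 * pi) powr (?n / 2))"
    using gaussian_constant[of t "?n / 2" "?n / 2"] t by simp
  finally show "(LINT z|lborel. \<bar>pd None (\<lambda>y. heat_kernel y t) (z :: 'm space)\<bar>)
      \<le> 5 * ((4 * pi) powr (- (?n / 2)) * (8 * pi) powr (?n / 2)) * t powr (- 1 / 2)"
    by (simp only: mult_ac)
qed

text \<open>Trades Gaussian decay in x - z for half as much decay in z, up to a factor depending on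
  norm x only.\<close>

lemma norm_diff_square_ge: "(norm z)\<^sup>2 / 2 - (norm x)\<^sup>2 \<le> (norm (x - z))\<^sup>2"
  for x z :: "'a::real_normed_vector"
proof -
  have "norm z \<le> norm x + norm (x - z)" using norm_triangle_ineq4[of x "x - z"] by simp
  then have "(norm z)\<^sup>2 \<le> (norm x + norm (x - z))\<^sup>2" by (intro power_mono) auto
  also have "\<dots> \<le> 2 * (norm x)\<^sup>2 + 2 * (norm (x - z))\<^sup>2"
    using zero_le_power2[of "norm x - norm (x - z)"] by (simp add: power2_eq_square algebra_simps)
  finally show ?thesis by simp
qed

lemma integrable_gaussian_pd_laplace_kernel:
  assumes "s > 0"
  shows "integrable lborel (\<lambda>z::'m::finite space. exp (- (norm z)\<^sup>2 / s) * pd i laplace_kernel z)"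
proof -
  obtain C where C: "C \<ge> 0" "\<And>i (y :: 'm space). y \<noteq> 0 \<Longrightarrow> \<bar>pd i laplace_kernel y\<bar> \<le> C * norm y powr (1 - real DIM('m space))"
    using pd_laplace_kernel_bound[where 'm='m] by blast
  show ?thesis
  proof (rule Bochner_Integration.integrable_bound[OF integrable_mult_right[OF integrable_norm_powr_gaussian[OF assms]]])
    show "AE z::'m space in lborel. norm (exp (- (norm z)\<^sup>2 / s) * pd i laplace_kernel z)
      \<le> norm (C * (norm z powr (1 - real DIM('m space)) * exp (- (norm z)\<^sup>2 / s)))"
      using AE_lborel_inner_nonzero
    proof eventually_elim
      case (elim z)
      obtain b :: "'m space" where "b \<in> Basis" using nonempty_Basis by blast
      then have "z \<noteq> 0" using elim by auto
      from mult_left_mono[OF C(2)[OF this], of "exp (- (norm z)\<^sup>2 / s)" i]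
      show ?case using C(1) by (simp add: abs_mult mult_ac)
    qed
  qed measurable
qed

section \<open>The kernels C_i\<close>

lemma kernel_C_integrand_measurable:
  "(\<lambda>q. pd None (\<lambda>y. heat_kernel y (snd (fst q))) (fst (fst q) - snd q) * pd i laplace_kernel (snd q))
    \<in> borel_measurable (borel :: (('m::finite space \<times> real) \<times> 'm space) measure)"
proof -
  have 1: "(\<lambda>q. (fst (fst q) - snd q, snd (fst q))) \<in> (borel :: (('m space \<times> real) \<times> 'm space) measure) \<rightarrow>\<^sub>M borel"
    and 2: "(\<lambda>q. snd q) \<in> (borel :: (('m space \<times> real) \<times> 'm space) measure) \<rightarrow>\<^sub>M borel"
    by (intro borel_measurable_continuous_onI continuous_intros)+
  show ?thesis
    using borel_measurable_times[OF measurable_compose[OF 1 pd_heat_kernel_measurable] measurable_compose[OF 2 pd_laplace_kernel_measurable]]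
    by simp
qed

lemma kernel_C_integrand_measurable':
  "(\<lambda>z. pd None (\<lambda>y. heat_kernel y t) (x - z) * pd i laplace_kernel z) \<in> borel_measurable (borel :: 'm::finite space measure)"
  using measurable_compose[OF _ kernel_C_integrand_measurable, of "\<lambda>z. ((x, t), z)" borel]
  by (simp add: borel_measurable_continuous_onI continuous_intros)

text \<open>Qualitative only: the constant contains exp (|x|^2 / (8 t)) and degenerates as t tends
  to 0. It justifies Fubini and the splitting of the integral at fixed \<open>t\<close>; the uniform
  bounds are proved for the pieces.\<close>

lemma kernel_C_integrable:
  fixes x :: "'m::finite space"
  assumes t: "t \<in> {0<..<1}"
  shows "integrable lborel (\<lambda>z. pd None (\<lambda>y. heat_kernel y t) (x - z) * pd i laplace_kernel z)"
proof -
  let ?n = "real DIM('m space)"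
  let ?K = "5 * t powr (- 1 / 2) * (4 * pi * t) powr (- ?n / 2) * exp ((norm x)\<^sup>2 / (8 * t))"
  show ?thesis
  proof (rule Bochner_Integration.integrable_bound[OF integrable_mult_right[OF integrable_gaussian_pd_laplace_kernel[of "16 * t" i]]])
    show "AE z in lborel. norm (pd None (\<lambda>y. heat_kernel y t) (x - z) * pd i laplace_kernel z)
      \<le> norm (?K * (exp (- (norm z)\<^sup>2 / (16 * t)) * pd i laplace_kernel z))"
    proof (rule AE_I2)
      fix z :: "'m space"
      have "((norm z)\<^sup>2 / 2 - (norm x)\<^sup>2) / (8 * t) \<le> (norm (x - z))\<^sup>2 / (8 * t)"
        using t norm_diff_square_ge[of z x] by (intro divide_right_mono) auto
      then have "- (norm (x - z))\<^sup>2 / (8 * t) \<le> (norm x)\<^sup>2 / (8 * t) + - (norm z)\<^sup>2 / (16 * t)"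
        by (simp add: diff_divide_distrib)
      then have "exp (- (norm (x - z))\<^sup>2 / (8 * t)) \<le> exp ((norm x)\<^sup>2 / (8 * t)) * exp (- (norm z)\<^sup>2 / (16 * t))"
        unfolding exp_add[symmetric] by (simp only: exp_le_cancel_iff)
      then have "5 * t powr (- 1 / 2) * (4 * pi * t) powr (- ?n / 2) * exp (- (norm (x - z))\<^sup>2 / (8 * t))
        \<le> 5 * t powr (- 1 / 2) * (4 * pi * t) powr (- ?n / 2) * (exp ((norm x)\<^sup>2 / (8 * t)) * exp (- (norm z)\<^sup>2 / (16 * t)))"
        by (rule mult_left_mono) simp
      from order_trans[OF pd_heat_kernel_bound[OF t, of "x - z"] this]
      have "\<bar>pd None (\<lambda>y. heat_kernel y t) (x - z)\<bar> \<le> ?K * exp (- (norm z)\<^sup>2 / (16 * t))"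
        by (simp only: mult.assoc)
      from mult_right_mono[OF this, of "\<bar>pd i laplace_kernel z\<bar>"]
      show "norm (pd None (\<lambda>y. heat_kernel y t) (x - z) * pd i laplace_kernel z)
        \<le> norm (?K * (exp (- (norm z)\<^sup>2 / (16 * t)) * pd i laplace_kernel z))"
        by (simp add: abs_mult mult.assoc)
    qed
    show "(\<lambda>z. pd None (\<lambda>y. heat_kernel y t) (x - z) * pd i laplace_kernel z) \<in> borel_measurable lborel"
      using kernel_C_integrand_measurable'[of t x i] by simp
  qed (use t in auto)
qed

text \<open>Fubini turns the iterated Lebesgue integral into one Borel integral over a slab, the
  form in which the integral can be cut and reflected. The normal variable is the outer one but the
  second component of the pair, hence the swap.\<close>

lemma kernel_C_lborel:
  fixes x :: "'m::finite space"
  assumes t: "t \<in> {0<..<1}"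
  shows "kernel_C i x t = (LINT z:{z. 0 \<le> snd z \<and> snd z \<le> snd x}|lborel.
    pd None (\<lambda>y. heat_kernel y t) (x - z) * pd i laplace_kernel z)"
proof -
  let ?h = "\<lambda>z. pd None (\<lambda>y. heat_kernel y t) (x - z) * pd i laplace_kernel z"
  let ?f = "\<lambda>z. indicator {z. 0 \<le> snd z \<and> snd z \<le> snd x} z *\<^sub>R ?h z"
  have meas: "{z :: 'm space. 0 \<le> snd z \<and> snd z \<le> snd x} \<in> sets borel"
    by (intro borel_closed closed_Collect_conj closed_Collect_le continuous_intros)
  have hm [measurable]: "?h \<in> borel_measurable borel" by (rule kernel_C_integrand_measurable')
  have int: "integrable lborel ?f"
    by (rule integrable_mult_indicator[OF _ kernel_C_integrable[OF t]]) (use meas in simp)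
  have fm: "?f \<in> borel_measurable (borel \<Otimes>\<^sub>M borel)"
    unfolding borel_prod by (intro borel_measurable_scaleR borel_measurable_indicator meas hm)
  have h1: "(\<lambda>z'. ?h (z', zn)) \<in> borel_measurable borel" for zn
    using measurable_compose[OF _ hm, of "\<lambda>z'. (z', zn)" borel]
    by (simp add: borel_measurable_continuous_onI continuous_intros)
  have "kernel_C i x t = (LINT zn|lebesgue. indicator {0..snd x} zn *\<^sub>R (LINT z'|lborel. ?h (z', zn)))"
    unfolding kernel_C_def set_lebesgue_integral_def
    by (intro Bochner_Integration.integral_cong refl arg_cong2[where f="(*\<^sub>R)"] integral_completion) (use h1 in simp)
  also have "\<dots> = (LINT zn|lebesgue. LINT z'|lborel. ?f (z', zn))"
    by (intro Bochner_Integration.integral_cong refl) (auto simp: indicator_def)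
  also have "\<dots> = (LINT zn|lborel. LINT z'|lborel. ?f (z', zn))"
  proof (rule integral_completion)
    have "(\<lambda>(zn, z'). ?f (z', zn)) \<in> borel_measurable (borel \<Otimes>\<^sub>M borel)"
      using measurable_compose[OF measurable_pair_swap' fm] by (simp add: case_prod_unfold)
    then have "(\<lambda>(zn, z'). ?f (z', zn)) \<in> borel_measurable (lborel \<Otimes>\<^sub>M lborel)"
      by (simp cong: measurable_cong_sets sets_pair_measure_cong)
    then show "(\<lambda>zn. LINT z'|lborel. ?f (z', zn)) \<in> borel_measurable lborel"
      by (rule lborel.borel_measurable_lebesgue_integral)
  qed
  also have "\<dots> = integral\<^sup>L (lborel \<Otimes>\<^sub>M lborel) (\<lambda>(z', zn). ?f (z', zn))"
    by (rule lborel_pair.integral_snd) (use int in \<open>simp add: lborel_prod case_prod_unfold\<close>)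
  also have "\<dots> = integral\<^sup>L lborel ?f" by (simp add: lborel_prod case_prod_unfold)
  finally show ?thesis by (simp add: set_lebesgue_integral_def)
qed

lemma kernel_C_measurable:
  "set_borel_measurable borel half_slab (\<lambda>p. kernel_C i (fst p) (snd p) :: real)"
  for i :: "'m::finite option"
proof -
  let ?h = "\<lambda>(p :: 'm space \<times> real, z). pd None (\<lambda>y. heat_kernel y (snd p)) (fst p - z) * pd i laplace_kernel z"
  \<comment> \<open>The slab depends on \<open>x\<close>, so it enters as a closed set in the joint
    variables (x, t, z).\<close>
  let ?A = "{q :: ('m space \<times> real) \<times> 'm space. 0 \<le> snd (snd q) \<and> snd (snd q) \<le> snd (fst (fst q))}"
  have A: "?A \<in> sets borel"
    by (intro borel_closed closed_Collect_conj closed_Collect_le continuous_intros)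
  have "(\<lambda>q. indicator ?A q *\<^sub>R ?h q) \<in> borel_measurable borel"
    using kernel_C_integrand_measurable[of i]
    by (intro borel_measurable_scaleR borel_measurable_indicator A) (simp add: case_prod_unfold)
  then have "(\<lambda>(p, z). indicator ?A (p, z) *\<^sub>R ?h (p, z)) \<in> borel_measurable (borel \<Otimes>\<^sub>M lborel)"
    by (subst measurable_cong_sets[OF sets_pair_measure_cong[OF refl sets_lborel] refl], subst borel_prod)
      (simp add: case_prod_unfold)
  then have "(\<lambda>p. LINT z|lborel. indicator ?A (p, z) *\<^sub>R ?h (p, z)) \<in> borel_measurable borel"
    by (rule lborel.borel_measurable_lebesgue_integral)
  from borel_measurable_times[OF borel_measurable_indicator[OF half_slab_borel] this]
  have "(\<lambda>p. indicator half_slab p * (LINT z|lborel. indicator ?A (p, z) *\<^sub>R ?h (p, z))) \<in> borel_measurable borel" .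
  moreover have "indicator half_slab p * (LINT z|lborel. indicator ?A (p, z) *\<^sub>R ?h (p, z)) = indicator half_slab p *\<^sub>R kernel_C i (fst p) (snd p)" for p
  proof (cases "p \<in> half_slab")
    case True
    then have "snd p \<in> {0<..<1}" by (auto simp: half_slab_def)
    from kernel_C_lborel[OF this, of i "fst p"] show ?thesis
      by (simp add: set_lebesgue_integral_def indicator_def)
  qed simp
  ultimately show ?thesis unfolding set_borel_measurable_def by (simp only:)
qed

text \<open>In the integral defining \<open>C\<^sub>i\<close>, a cutoff in the normal variable separates the singularity of
  \<open>\<nabla>E\<close> at the origin, where the derivatives are put on \<open>\<partial>\<^sub>n\<Gamma>\<close>, from the one of \<open>\<partial>\<^sub>n\<Gamma>\<close> at time zero,
  where they are put on \<open>\<nabla>E\<close>.\<close>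

lemma bounded_Ck_kernel_C:
  assumes c: "c > 0"
  shows "bounded_Ck n (upper_box (3 * c) R) {0<..<1} (\<lambda>t _. t powr (- 1 / 2)) (\<lambda>t (x :: 'm::finite space). kernel_C i x t)"
proof -
  \<comment> \<open>The thresholds suit x_n > 3 c: where z_n \<le> 2 c, the difference x_n - z_n
    exceeds c and the heat kernel is regular; where z_n > c, \<nabla>E is regular. Both hold on the
    transition layer.\<close>
  obtain \<eta> :: "real \<Rightarrow> real" where \<eta>: "(\<forall>s\<le>c. \<eta> s = 0) \<and> (\<forall>s\<ge>2 * c. \<eta> s = 1) \<and>
    (\<forall>k. bounded_Ck k UNIV {()} (\<lambda>_ _. 1) (\<lambda>_. \<eta>))"
    using smooth_step[of c "2 * c"] c by auto
  have \<eta>0: "\<eta> s = 0" if "s \<le> c" for s using \<eta> that by blast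
  have \<eta>1: "\<eta> s = 1" if "s \<ge> 2 * c" for s using \<eta> that by blast
  note \<eta>_smooth = \<eta>[THEN conjunct2, THEN conjunct2, rule_format]
  obtain D where D: "\<And>s. \<bar>\<eta> s\<bar> \<le> D" using \<eta>_smooth[of 0] by auto
  have "continuous_on UNIV \<eta>"
    using bounded_Ck_has_derivative[OF \<eta>_smooth[of "Suc 0"]]
    by (intro continuous_at_imp_continuous_on ballI has_derivative_continuous) auto
  then have \<eta>m: "\<eta> \<in> borel_measurable borel" by (rule borel_measurable_continuous_onI)
  define P where "P t z = pd None (\<lambda>y. heat_kernel y t) z" for t and z :: "'m space"
  define E where "E = (pd i laplace_kernel :: 'm space \<Rightarrow> real)"
  \<comment> \<open>The parts of \<partial>_i E away from the boundary and near it; they add up to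
    \<partial>_i E.\<close>
  define \<Psi> where "\<Psi> z = \<eta> (snd z) * E z" for z
  define \<psi> where "\<psi> z = (1 - \<eta> (snd z)) * E z" for z
  let ?S = "upper_box (3 * c) R :: 'm space set"
  have snd_m: "snd \<in> (borel :: 'm space measure) \<rightarrow>\<^sub>M borel"
    by (intro borel_measurable_continuous_onI continuous_intros)
  have \<eta>s [measurable]: "(\<lambda>z :: 'm space. \<eta> (snd z)) \<in> borel_measurable borel"
    using measurable_compose[OF snd_m \<eta>m] .
  have Em [measurable]: "E \<in> borel_measurable borel" unfolding E_def by measurable
  have \<Psi>m [measurable]: "\<Psi> \<in> borel_measurable borel" unfolding \<Psi>_def[abs_def] by measurable
  have \<psi>m [measurable]: "\<psi> \<in> borel_measurable borel" unfolding \<psi>_def[abs_def] by measurable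
  have Pm [measurable]: "P t \<in> borel_measurable borel" for t
    using measurable_compose[OF _ pd_heat_kernel_measurable, of "\<lambda>z. (z, t)" borel]
    by (simp add: borel_measurable_continuous_onI continuous_intros P_def[abs_def])
  have slab: "{z :: 'm space. 0 \<le> snd z \<and> snd z \<le> b} \<in> sets borel" for b
    by (intro borel_closed closed_Collect_conj closed_Collect_le continuous_intros)
  have upper [measurable]: "{z :: 'm space. 0 \<le> snd z} \<in> sets borel"
    by (intro borel_closed closed_Collect_le continuous_intros)

  have P_smooth: "bounded_Ck n {y. norm y > c} {0<..<1} (\<lambda>t y. exp (- (norm y)\<^sup>2 / 16)) P" for n
    using bounded_Ck_pd_heat_kernel[OF c, of n] by (simp add: P_def[abs_def])
  have \<Psi>_smooth: "bounded_Ck n UNIV {()} (\<lambda>_ _. 1) (\<lambda>_. \<Psi>)" for n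
  proof -
    \<comment> \<open>Two overlapping open half spaces cover everything: on the first E is smooth,
      on the second the cutoff vanishes.\<close>
    let ?A = "{y :: 'm space. snd y > c / 2}" and ?B = "{y :: 'm space. snd y < c}"
    have A: "open ?A" and B: "open ?B" by (intro open_Collect_less continuous_intros)+
    have 1: "bounded_Ck n ?A {()} (\<lambda>_ _. 1) (\<lambda>_ y. \<eta> (snd y + 0))"
      by (rule bounded_Ck_affine[OF \<eta>_smooth A bounded_linear_snd, where \<phi>="\<lambda>_. ()" and z="\<lambda>_. 0"]) auto
    have 2: "bounded_Ck n ?A {()} (\<lambda>_ _. 1) (\<lambda>_. E)"
      unfolding E_def
    proof (rule bounded_Ck_subset[OF bounded_Ck_pd_laplace_kernel])
      show "?A \<subseteq> {y. norm y > c / 2}"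
      proof
        show "y \<in> {y. norm y > c / 2}" if "y \<in> ?A" for y
          using that snd_le_norm[of y] by auto
      qed
    qed (use c in auto)
    have "bounded_Ck n ?A {()} (\<lambda>_ _. 1) (\<lambda>_. \<Psi>)"
      using bounded_Ck_mult[OF A 1 2] by (simp add: \<Psi>_def[abs_def])
    moreover have "bounded_Ck n ?B {()} (\<lambda>_ _. 1) (\<lambda>_. \<Psi>)"
      by (rule bounded_Ck_cong[OF B _ bounded_Ck_const[OF B, where m="\<lambda>_. 0" and B=0]]) (auto simp: \<Psi>_def \<eta>0)
    ultimately have "bounded_Ck n (?A \<union> ?B) {()} (\<lambda>_ _. 1) (\<lambda>_. \<Psi>)"
      by (rule bounded_Ck_Un) auto
    moreover have "?A \<union> ?B = UNIV" using c by (auto simp: not_less)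
    ultimately show ?thesis by simp
  qed

  \<comment> \<open>The far piece after reflection. The domain z_n \<ge> 0 is fixed,
    \<open>x\<close> occurs only in the bounded smooth function \<Psi>, and the weight |P t z| has
    integral of order t powr (- 1 / 2).\<close>
  have C2: "bounded_Ck n ?S {0<..<1} (\<lambda>t _. t powr (- 1 / 2))
    (\<lambda>t x. LINT z:UNIV|lborel. (indicator {z. 0 \<le> snd z} z * P t z) * \<Psi> (x - z))"
  proof (rule bounded_Ck_set_integral[where w="\<lambda>t z. \<bar>indicator {z. 0 \<le> snd z} z * P t z\<bar>"])
    fix n
    have "bounded_Ck n ?S ({0<..<1::real} \<times> UNIV) (\<lambda>_ _. 1) (\<lambda>p x. \<Psi> (x - snd p))"
      by (rule bounded_Ck_translate[OF \<Psi>_smooth open_upper_box, where \<phi>="\<lambda>_. ()"]) auto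
    from bounded_Ck_cmult[OF open_upper_box this, of "\<lambda>p. indicator {z. 0 \<le> snd z} (snd p) * P (fst p) (snd p)"]
    show "bounded_Ck n ?S ({0<..<1::real} \<times> UNIV)
      (\<lambda>p x. \<bar>indicator {z. 0 \<le> snd z} (snd p) * P (fst p) (snd p)\<bar>)
      (\<lambda>p x. (indicator {z. 0 \<le> snd z} (snd p) * P (fst p) (snd p)) * \<Psi> (x - snd p))" by simp
  next
    fix t :: real assume t: "t \<in> {0<..<1}"
    have Pi: "integrable lborel (P t)"
      using integrable_pd_heat_kernel(1)[OF t, where 'm='m] by (simp add: P_def[abs_def])
    have wi: "integrable lborel (\<lambda>z. \<bar>indicator {z. 0 \<le> snd z} z * P t z\<bar>)"
    proof (rule Bochner_Integration.integrable_bound[OF Pi])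
      show "AE z in lborel. norm \<bar>indicator {z. 0 \<le> snd z} z * P t z\<bar> \<le> norm (P t z)"
        by (auto simp: indicator_def)
    qed measurable
    then show "set_integrable lborel UNIV (\<lambda>z. \<bar>indicator {z. 0 \<le> snd z} z * P t z\<bar>)"
      by (simp add: set_integrable_def)
    have "(LINT z|lborel. \<bar>indicator {z. 0 \<le> snd z} z * P t z\<bar>) \<le> (LINT z|lborel. \<bar>P t z\<bar>)"
      by (intro integral_mono wi integrable_abs Pi) (auto simp: indicator_def)
    also note integrable_pd_heat_kernel(2)[OF t, where 'm='m, folded P_def]
    finally show "(LINT z:UNIV|lborel. \<bar>indicator {z. 0 \<le> snd z} z * P t z\<bar>)
      \<le> 5 * ((4 * pi) powr (- (real DIM('m space) / 2)) * (8 * pi) powr (real DIM('m space) / 2)) * t powr (- 1 / 2)"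
      by (simp only: set_lebesgue_integral_def indicator_UNIV scaleR_one)
  next
    show "set_borel_measurable lborel UNIV (\<lambda>z. (indicator {z. 0 \<le> snd z} z * P t z) * \<Psi> (x - z))" for t and x :: "'m space"
      unfolding set_borel_measurable_def by measurable
  qed (auto intro: open_upper_box)

  \<comment> \<open>The near piece lives on a slab not depending on \<open>x\<close>, since \<psi>
    vanishes for z_n \<ge> 2 c.\<close>
  let ?\<Theta> = "{z :: 'm space. 0 \<le> snd z \<and> snd z \<le> 2 * c}"
  have Ei: "integrable lborel (\<lambda>z. exp (- (norm z)\<^sup>2 / 32) * E z)"
    unfolding E_def by (rule integrable_gaussian_pd_laplace_kernel) simp
  have wi: "integrable lborel (\<lambda>z. \<bar>\<psi> z\<bar> * exp (- (norm z)\<^sup>2 / 32))"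
  proof (rule Bochner_Integration.integrable_bound[OF integrable_mult_right[OF Ei, of "1 + D"]])
    show "AE z in lborel. norm (\<bar>\<psi> z\<bar> * exp (- (norm z)\<^sup>2 / 32)) \<le> norm ((1 + D) * (exp (- (norm z)\<^sup>2 / 32) * E z))"
    proof (rule AE_I2)
      fix z :: "'m space"
      have "\<bar>1 - \<eta> (snd z)\<bar> \<le> \<bar>1 + D\<bar>" using D[of "snd z"] by linarith
      then have "\<bar>1 - \<eta> (snd z)\<bar> * (\<bar>E z\<bar> * exp (- (norm z)\<^sup>2 / 32)) \<le> \<bar>1 + D\<bar> * (\<bar>E z\<bar> * exp (- (norm z)\<^sup>2 / 32))"
        by (rule mult_right_mono) simp
      then show "norm (\<bar>\<psi> z\<bar> * exp (- (norm z)\<^sup>2 / 32)) \<le> norm ((1 + D) * (exp (- (norm z)\<^sup>2 / 32) * E z))"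
        by (simp add: \<psi>_def abs_mult mult_ac)
    qed
  qed measurable
  have wi': "set_integrable lborel ?\<Theta> (\<lambda>z. \<bar>\<psi> z\<bar> * exp (- (norm z)\<^sup>2 / 32))"
    by (rule set_integrable_subset[of _ UNIV]) (use wi slab in \<open>auto simp: set_integrable_def\<close>)
  have C1: "bounded_Ck n ?S {0<..<1} (\<lambda>t _. t powr (- 1 / 2)) (\<lambda>t x. LINT z:?\<Theta>|lborel. \<psi> z * P t (x - z))"
  proof (rule bounded_Ck_set_integral[where w="\<lambda>t z. \<bar>\<psi> z\<bar> * exp (- (norm z)\<^sup>2 / 32)"
        and C="LINT z:?\<Theta>|lborel. \<bar>\<psi> z\<bar> * exp (- (norm z)\<^sup>2 / 32)"])
    fix n
    have "bounded_Ck n ?S ({0<..<1} \<times> ?\<Theta>) (\<lambda>p x. exp (- (norm (x - snd p))\<^sup>2 / 16)) (\<lambda>p x. P (fst p) (x - snd p))"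
    proof (rule bounded_Ck_translate[OF P_smooth open_upper_box])
      fix p :: "real \<times> 'm space" and x :: "'m space"
      assume p: "p \<in> {0<..<1} \<times> ?\<Theta>" and "x \<in> ?S"
      then have "snd (x - snd p) > c" by (auto simp: upper_box_def)
      then show "fst p \<in> {0<..<1} \<and> x - snd p \<in> {y. norm y > c}"
        using p snd_le_norm[of "x - snd p"] by auto
    qed
    then have "bounded_Ck n ?S ({0<..<1} \<times> ?\<Theta>) (\<lambda>p x. exp (- (norm (snd p))\<^sup>2 / 32)) (\<lambda>p x. P (fst p) (x - snd p))"
    \<comment> \<open>The factor depending on norm x < R becomes the constant, and half of the decay
      rate 1/16 remains in z. That is enough to integrate \<psi> over the unbounded slab.\<close>
    proof (rule bounded_Ck_weight[where B="exp (R\<^sup>2 / 16)"])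
      fix p :: "real \<times> 'm space" and x :: "'m space"
      assume "x \<in> ?S"
      then have "(norm x)\<^sup>2 \<le> R\<^sup>2" by (intro power_mono) (auto simp: upper_box_def)
      with norm_diff_square_ge[of "snd p" x]
      have "- (norm (x - snd p))\<^sup>2 / 16 \<le> R\<^sup>2 / 16 + - (norm (snd p))\<^sup>2 / 32" by simp
      then show "0 \<le> exp (- (norm (x - snd p))\<^sup>2 / 16) \<and>
        exp (- (norm (x - snd p))\<^sup>2 / 16) \<le> exp (R\<^sup>2 / 16) * exp (- (norm (snd p))\<^sup>2 / 32)"
        unfolding exp_add[symmetric] by (simp only: exp_le_cancel_iff exp_ge_zero)
    qed
    from bounded_Ck_cmult[OF open_upper_box this, of "\<lambda>p. \<psi> (snd p)"]
    show "bounded_Ck n ?S ({0<..<1} \<times> ?\<Theta>) (\<lambda>p x. \<bar>\<psi> (snd p)\<bar> * exp (- (norm (snd p))\<^sup>2 / 32)) (\<lambda>p x. \<psi> (snd p) * P (fst p) (x - snd p))"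
      by simp
  next
    fix t :: real assume t: "t \<in> {0<..<1}"
    have "0 \<le> (LINT z:?\<Theta>|lborel. \<bar>\<psi> z\<bar> * exp (- (norm z)\<^sup>2 / 32))"
      unfolding set_lebesgue_integral_def by (rule integral_nonneg_AE) auto
    \<comment> \<open>This piece is bounded uniformly in \<open>t\<close>; the singular factor is
      inserted only to match the weight of the other piece.\<close>
    from mult_left_mono[OF powr_minus_half_ge_1[OF t] this]
    show "(LINT z:?\<Theta>|lborel. \<bar>\<psi> z\<bar> * exp (- (norm z)\<^sup>2 / 32)) \<le> (LINT z:?\<Theta>|lborel. \<bar>\<psi> z\<bar> * exp (- (norm z)\<^sup>2 / 32)) * t powr (- 1 / 2)"
      by simp
  next
    show "set_borel_measurable lborel ?\<Theta> (\<lambda>z. \<psi> z * P t (x - z))" for t x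
    proof -
      have "(\<lambda>z. \<psi> z * P t (x - z)) \<in> borel_measurable borel" by measurable
      then show ?thesis unfolding set_borel_measurable_def
        by (intro borel_measurable_scaleR borel_measurable_indicator) (use slab in auto)
    qed
  qed (use wi' slab open_upper_box in auto)

  show ?thesis
  proof (rule bounded_Ck_cong[OF open_upper_box _ bounded_Ck_add[OF open_upper_box C1 C2]])
    fix t :: real and x :: "'m space" assume t: "t \<in> {0<..<1}" and "x \<in> ?S"
    then have x: "snd x > 2 * c" using c by (auto simp: upper_box_def)
    define h where "h z = P t (x - z) * E z" for z
    define F where "F z = (indicator {z. 0 \<le> snd z} z * P t z) * \<Psi> (x - z)" for z
    have hi: "integrable lborel h"
      unfolding h_def P_def E_def by (rule kernel_C_integrable[OF t])
    have [measurable]: "F \<in> borel_measurable borel" unfolding F_def[abs_def] by measurable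
    \<comment> \<open>Each piece equals the integrable function \<open>h\<close> times a bounded
      function, which gives the separate integrability needed to split the integral.\<close>
    have bi: "integrable lborel (\<lambda>z. m z * h z)" if m [measurable]: "m \<in> borel_measurable borel" and B: "\<And>z. \<bar>m z\<bar> \<le> B" for m B
    proof (rule Bochner_Integration.integrable_bound[OF integrable_mult_right[OF hi, of B]])
      have "\<bar>m z * h z\<bar> \<le> \<bar>B * h z\<bar>" for z
        using mult_right_mono[OF order_trans[OF B abs_ge_self], of "\<bar>h z\<bar>"] by (simp add: abs_mult)
      then show "AE z in lborel. norm (m z * h z) \<le> norm (B * h z)" by simp
      have [measurable]: "h \<in> borel_measurable borel" using hi by (simp add: borel_measurable_integrable)
      show "(\<lambda>z. m z * h z) \<in> borel_measurable lborel" by measurable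
    qed
    have 1: "indicator ?\<Theta> z *\<^sub>R (\<psi> z * P t (x - z)) = (indicator ?\<Theta> z * (1 - \<eta> (snd z))) * h z" for z
      by (simp add: h_def \<psi>_def)
    have 2: "F (x - z) = (indicator {z. snd z \<le> snd x} z * \<eta> (snd z)) * h z" for z
      by (auto simp: h_def \<Psi>_def F_def indicator_def)
    have i1: "integrable lborel (\<lambda>z. indicator ?\<Theta> z *\<^sub>R (\<psi> z * P t (x - z)))"
      unfolding 1
    proof (rule bi)
      show "(\<lambda>z. indicator ?\<Theta> z * (1 - \<eta> (snd z))) \<in> borel_measurable borel"
        by (intro borel_measurable_times borel_measurable_indicator slab borel_measurable_diff \<eta>s borel_measurable_const)
      show "\<bar>indicator ?\<Theta> z * (1 - \<eta> (snd z))\<bar> \<le> 1 + D" for z :: "'m space"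
        using D[of "snd z"] by (auto simp: indicator_def)
    qed
    have i2: "integrable lborel (\<lambda>z. F (x - z))"
      unfolding 2
    proof (rule bi)
      have "{z :: 'm space. snd z \<le> snd x} \<in> sets borel"
        by (intro borel_closed closed_Collect_le continuous_intros)
      then show "(\<lambda>z :: 'm space. indicator {z. snd z \<le> snd x} z * \<eta> (snd z)) \<in> borel_measurable borel"
        by (intro borel_measurable_times borel_measurable_indicator \<eta>s)
      show "\<bar>indicator {z. snd z \<le> snd x} z * \<eta> (snd z)\<bar> \<le> D" for z :: "'m space"
        using D[of "snd z"] by (auto simp: indicator_def)
    qed
    \<comment> \<open>Off the slab 0 \<le> z_n \<le> x_n both terms vanish: below it through the
      cutoff in \<Psi>, above it through the indicator in \<open>F\<close>. Inside it they recombine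
      to \<open>h\<close>, and for z_n > 2 c the second term alone is \<open>h\<close>.\<close>
    have split: "indicator {z. 0 \<le> snd z \<and> snd z \<le> snd x} z *\<^sub>R h z
      = indicator ?\<Theta> z *\<^sub>R (\<psi> z * P t (x - z)) + F (x - z)" for z
    proof -
      consider "snd z < 0" | "0 \<le> snd z \<and> snd z \<le> 2 * c" | "2 * c < snd z \<and> snd z \<le> snd x" | "snd z > snd x"
        by linarith
      then show ?thesis
      proof cases
        case 1 then show ?thesis using x c \<eta>0[of "snd z"] by (simp add: F_def \<Psi>_def)
      next
        case 2 then show ?thesis using x by (simp add: F_def \<Psi>_def \<psi>_def h_def algebra_simps)
      next
        case 3 then show ?thesis using x c \<eta>1[of "snd z"] by (simp add: F_def \<Psi>_def \<psi>_def h_def)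
      next
        case 4 then show ?thesis using x by (simp add: F_def)
      qed
    qed
    have "kernel_C i x t = (LINT z|lborel. indicator {z. 0 \<le> snd z \<and> snd z \<le> snd x} z *\<^sub>R h z)"
      using kernel_C_lborel[OF t, of i x] by (simp add: set_lebesgue_integral_def h_def P_def E_def)
    also have "\<dots> = (LINT z|lborel. indicator ?\<Theta> z *\<^sub>R (\<psi> z * P t (x - z))) + (LINT z|lborel. F (x - z))"
      unfolding split by (rule Bochner_Integration.integral_add[OF i1 i2])
    also have "(LINT z|lborel. F (x - z)) = (LINT z|lborel. F z)"
      by (rule lborel_integral_reflect) measurable
    finally show "(LINT z:?\<Theta>|lborel. \<psi> z * P t (x - z)) +
      (LINT z:UNIV|lborel. (indicator {z. 0 \<le> snd z} z * P t z) * \<Psi> (x - z)) = kernel_C i x t"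
      by (simp add: set_lebesgue_integral_def F_def)
  qed
qed

lemma admissible_kernel_kernel_C: "admissible_kernel (kernel_C i)"
  for i :: "'m::finite option"
proof -
  have "bounded_Ck n (upper_box c R) {0<..<1} (\<lambda>t _. t powr (- 1 / 2)) (\<lambda>t (x :: 'm space). kernel_C i x t)"
    if "c > 0" for n c R
    using bounded_Ck_kernel_C[of "c / 3" n R i] that by simp
  moreover have "kernel_C i x t = 0" if "t \<le> 0" for x t
    using that by (simp add: kernel_C_def pd_heat_kernel_nonpos)
  ultimately show ?thesis
    unfolding admissible_kernel_def by (intro conjI allI impI kernel_C_measurable)
qed

section \<open>Velocity and pressure\<close>

lemma admissible_kernel_golovkin_regular: "admissible_kernel (golovkin_regular i j)"
  for i j :: "'m::finite option"
proof -
  have "golovkin_regular i j = (\<lambda>(x :: 'm space) t. (- 2 * (if i = j then 1 else 0)) * pd None (\<lambda>y. heat_kernel y t) x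
      + (- 4) * pd j (\<lambda>y. kernel_C i y t) x)"
    by (auto simp: golovkin_regular_def fun_eq_iff)
  then show ?thesis
    by (simp only: admissible_kernel_add admissible_kernel_scale admissible_kernel_pd
        admissible_kernel_pd_heat_kernel admissible_kernel_kernel_C)
qed

text \<open>A partial derivative at frozen time is one component of the total derivative in space
  and time, hence again jointly smooth. This handles the nested derivatives in the pressure.\<close>

lemma bounded_Ck_slice_pd:
  fixes U :: "'m::finite space \<times> real \<Rightarrow> real"
  assumes T: "open T" and U: "\<And>n. bounded_Ck n T {()} (\<lambda>_ _. 1) (\<lambda>_. U)"
  shows "bounded_Ck n T {()} (\<lambda>_ _. 1) (\<lambda>_ q. pd j (\<lambda>z. U (z, snd q)) (fst q))"
proof (rule bounded_Ck_cong[OF T _ bounded_Ck_frechet[OF U[of "Suc n"]]])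
  fix q assume "q \<in> T"
  have "((\<lambda>z. (z, snd q)) has_derivative (\<lambda>v. (v, 0))) (at (fst q))"
    by (auto intro!: derivative_eq_intros)
  from diff_chain_at[OF this, of U "frechet_derivative U (at q)"]
    bounded_Ck_has_derivative[OF U[of "Suc 0"], of "()" q] \<open>q \<in> T\<close>
  have "((\<lambda>z. U (z, snd q)) has_derivative (\<lambda>v. frechet_derivative U (at q) (v, 0))) (at (fst q))"
    by (simp add: o_def)
  from pd_has_derivative[OF this, of j]
  show "frechet_derivative U (at q) (unit_dir j, 0) = pd j (\<lambda>z. U (z, snd q)) (fst q)" by simp
qed

lemma bounded_Ck_slice_deriv:
  fixes U :: "'m::finite space \<times> real \<Rightarrow> real"
  assumes T: "open T" and U: "\<And>n. bounded_Ck n T {()} (\<lambda>_ _. 1) (\<lambda>_. U)"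
  shows "bounded_Ck n T {()} (\<lambda>_ _. 1) (\<lambda>_ q. deriv (\<lambda>\<tau>. U (fst q, \<tau>)) (snd q))"
proof (rule bounded_Ck_cong[OF T _ bounded_Ck_frechet[OF U[of "Suc n"]]])
  fix q assume "q \<in> T"
  have d: "(U has_derivative frechet_derivative U (at q)) (at q)"
    using bounded_Ck_has_derivative[OF U[of "Suc 0"], of "()" q] \<open>q \<in> T\<close> by simp
  have "((\<lambda>\<tau>. (fst q, \<tau>)) has_derivative (\<lambda>v. (0, v))) (at (snd q))"
    by (auto intro!: derivative_eq_intros)
  from diff_chain_at[OF this, of U "frechet_derivative U (at q)"] d
  have "((\<lambda>\<tau>. U (fst q, \<tau>)) has_derivative (\<lambda>v. frechet_derivative U (at q) (0, v))) (at (snd q))"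
    by (simp add: o_def)
  moreover have "(\<lambda>v. frechet_derivative U (at q) (0, v)) = (*) (frechet_derivative U (at q) (0, 1))"
  proof
    fix v :: real
    have "(0, v) = v *\<^sub>R (0 :: 'm space, 1 :: real)" by simp
    then show "frechet_derivative U (at q) (0, v) = frechet_derivative U (at q) (0, 1) * v"
      by (simp only: linear_scale[OF has_derivative_linear[OF d]] real_scaleR_def mult.commute)
  qed
  ultimately have "((\<lambda>\<tau>. U (fst q, \<tau>)) has_real_derivative frechet_derivative U (at q) (0, 1)) (at (snd q))"
    unfolding has_field_derivative_def by (simp only:)
  then show "frechet_derivative U (at q) (0, 1) = deriv (\<lambda>\<tau>. U (fst q, \<tau>)) (snd q)"
    by (simp add: DERIV_imp_deriv)
qed

text \<open>The variables separate: a fixed boundary potential in space times a smooth function of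
  time.\<close>

lemma bounded_Ck_instant_potential:
  fixes k :: "'m::finite space \<Rightarrow> real" and \<theta> :: "real \<Rightarrow> real"
  assumes k: "\<And>n c R. c > 0 \<Longrightarrow> bounded_Ck n (upper_box c R) {()} (\<lambda>_ _. 1) (\<lambda>_. k)"
    and km [measurable]: "k \<in> borel_measurable borel"
    and gS: "integrable lebesgue gS" and gSY: "AE y in lebesgue. norm y > Y \<longrightarrow> gS y = 0"
    and \<theta>: "\<And>n. bounded_Ck n UNIV {()} (\<lambda>_ _. 1) (\<lambda>_. \<theta>)"
    and c: "c > 0"
  shows "bounded_Ck n (upper_box c R \<times> {0<..<1}) {()} (\<lambda>_ _. 1)
    (\<lambda>_ q. LINT y|lebesgue. k (fst q - (y, 0)) * (a * gS y * \<theta> (snd q)))"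
proof -
  let ?T = "upper_box c R \<times> {0<..<1} :: ('m space \<times> real) set"
  have T: "open ?T" by (intro open_Times open_upper_box) auto
  obtain g0 where g0: "integrable lborel g0" and g0_eq: "AE y in lebesgue. gS y = g0 y"
    and g0_Y: "\<And>y. norm y > Y \<Longrightarrow> g0 y = 0"
    using integrable_lebesgue_borel_version[OF gS gSY] by blast
  have km': "(\<lambda>y. k (x - (y, 0))) \<in> borel_measurable borel" for x
    using measurable_compose[OF _ km, of "\<lambda>y. x - (y, 0)" borel]
    by (simp add: borel_measurable_continuous_onI continuous_intros)
  have 1: "bounded_Ck n (upper_box c R) {()} (\<lambda>_ _. 1) (\<lambda>_ x. LINT y|lborel. k (x - (y, 0)) * g0 y)"
    by (rule bounded_Ck_boundary_potential[OF k _ km' g0 g0_Y c]) auto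
  have 2: "bounded_Ck n ?T {()} (\<lambda>_ _. 1) (\<lambda>_ q. LINT y|lborel. k (fst q + 0 - (y, 0)) * g0 y)"
    by (rule bounded_Ck_affine[OF 1 T bounded_linear_fst, where \<phi>="\<lambda>_. ()" and z="\<lambda>_. 0"]) auto
  have 3: "bounded_Ck n ?T {()} (\<lambda>_ _. 1) (\<lambda>_ q. \<theta> (snd q + 0))"
    by (rule bounded_Ck_affine[OF \<theta> T bounded_linear_snd, where \<phi>="\<lambda>_. ()" and z="\<lambda>_. 0"]) auto
  have "bounded_Ck n ?T {()} (\<lambda>_ _. 1) (\<lambda>_ q. a * ((LINT y|lborel. k (fst q - (y, 0)) * g0 y) * \<theta> (snd q)))"
    using bounded_Ck_scale[OF T bounded_Ck_mult[OF T 2 3]] by simp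
  then show ?thesis
  proof (rule bounded_Ck_cong[OF T, rotated])
    fix q :: "'m space \<times> real"
    have "(LINT y|lebesgue. k (fst q - (y, 0)) * (a * gS y * \<theta> (snd q)))
      = (LINT y|lebesgue. (a * \<theta> (snd q)) * (k (fst q - (y, 0)) * gS y))" by (simp add: mult_ac)
    also have "\<dots> = (a * \<theta> (snd q)) * (LINT y|lebesgue. k (fst q - (y, 0)) * gS y)"
      by (rule integral_mult_right_zero)
    also have "(LINT y|lebesgue. k (fst q - (y, 0)) * gS y) = (LINT y|lborel. k (fst q - (y, 0)) * g0 y)"
      by (rule lebesgue_integral_borel_version[OF km' g0 gS g0_eq])
    finally show "a * ((LINT y|lborel. k (fst q - (y, 0)) * g0 y) * \<theta> (snd q))
      = (LINT y|lebesgue. k (fst q - (y, 0)) * (a * gS y * \<theta> (snd q)))" by simp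
  qed
qed

text \<open>The complement of the support is a union of possibly uncountably many open sets, each
  with its own exceptional null set; by Lindelof countably many of them suffice.\<close>

lemma ess_support_AE_zero:
  fixes f :: "'a::euclidean_space \<Rightarrow> real"
  shows "AE x in lebesgue. x \<notin> ess_support f \<longrightarrow> f x = 0"
proof -
  define \<U> where "\<U> = {U :: 'a set. open U \<and> (AE x in lebesgue. x \<in> U \<longrightarrow> f x = 0)}"
  obtain \<V> where \<V>: "\<V> \<subseteq> \<U>" "countable \<V>" "\<Union>\<V> = \<Union>\<U>"
    using Lindelof[of \<U>] by (auto simp: \<U>_def)
  have "AE x in lebesgue. \<forall>U\<in>\<V>. x \<in> U \<longrightarrow> f x = 0"
    using \<V>(1) by (subst AE_ball_countable[OF \<V>(2)]) (auto simp: \<U>_def)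
  then show ?thesis
  proof eventually_elim
    case (elim x)
    then show ?case using \<V>(3) by (auto simp: ess_support_def \<U>_def[symmetric])
  qed
qed

theorem theorem1:
  fixes a :: "'m::finite option \<Rightarrow> real"
    and gS :: "'m option \<Rightarrow> real ^ 'm \<Rightarrow> real"
    and gT :: "'m option \<Rightarrow> real \<Rightarrow> real"
    and g :: "'m option \<Rightarrow> real ^ 'm \<Rightarrow> real \<Rightarrow> real"
  assumes g_eq: "\<And>j y s. g j y s = a j * gS j y * gT j s"
    and gS_integrable: "\<And>j. integrable lebesgue (gS j)"
    and gS_nonneg: "\<And>j. AE y in lebesgue. gS j y \<ge> 0"
    and gS_supp: "\<And>j. ess_support (gS j) \<subseteq> boundary_region"
    and gT_smooth: "\<And>j. smooth_on UNIV (gT j)"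
    and gT_compact: "\<And>j. compact (support (gT j))"
    and gT_nonneg: "\<And>j s. gT j s \<ge> 0"
    and gT_supp: "\<And>j. support (gT j) \<subseteq> {3/4<..<7/8}"
  shows "(\<forall>i. smooth_on half_cylinder (\<lambda>(x, t). stokes_velocity g i x t)) \<and>
         smooth_on half_cylinder (\<lambda>(x, t). stokes_pressure g x t)"
proof -
  define Y where "Y = 4 * sqrt (real (CARD('m) + 1))"
  have gS_Y: "AE y in lebesgue. norm y > Y \<longrightarrow> gS j y = 0" for j
    using ess_support_AE_zero[of "gS j"]
    by eventually_elim (use gS_supp[of j] in \<open>auto simp: boundary_region_def Y_def\<close>)
  have gT_0: "gT j s = 0" if "s \<notin> support (gT j)" for j s
    using that closure_subset[of "{s. gT j s \<noteq> 0}"] by (auto simp: support_def)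
  then have gT_0': "gT j s = 0" if "s \<notin> {0<..<1}" for j s
    using that gT_supp[of j] by force
  have gT: "bounded_Ck n UNIV {()} (\<lambda>_ _. 1) (\<lambda>_. gT j)" for n j
    by (rule compact_support_bounded_Ck[OF gT_smooth gT_compact[of j] gT_0])
  have gT_deriv: "(gT j has_real_derivative deriv (gT j) s) (at s)"
    and gT_frechet: "frechet_derivative (gT j) (at s) 1 = deriv (gT j) s" for j s
  proof -
    have "(gT j has_derivative frechet_derivative (gT j) (at s)) (at s)"
      using bounded_Ck_has_derivative[OF gT[of "Suc 0" j], of "()" s] by simp
    then have "gT j differentiable (at s)" by (rule differentiableI)
    then show d: "(gT j has_real_derivative deriv (gT j) s) (at s)"
      by (simp add: DERIV_deriv_iff_real_differentiable)
    then show "frechet_derivative (gT j) (at s) 1 = deriv (gT j) s"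
      using frechet_derivative_at[of "gT j" "(*) (deriv (gT j) s)" s]
      by (simp add: has_field_derivative_def) (metis mult.right_neutral)
  qed
  \<comment> \<open>The pressure also contains the time derivative of the normal datum, whose time
    factor is this derivative.\<close>
  have gT': "bounded_Ck n UNIV {()} (\<lambda>_ _. 1) (\<lambda>_. deriv (gT j))" for n j
    using bounded_Ck_frechet[OF gT[of "Suc n" j], of 1] by (simp add: gT_frechet)
  have E: "bounded_Ck n (upper_box c R) {()} (\<lambda>_ _. 1) (\<lambda>_. laplace_kernel :: 'm space \<Rightarrow> real)"
    if "c > 0" for n c R
  proof (rule bounded_Ck_weight[OF bounded_Ck_subset[OF bounded_Ck_laplace_kernel[OF that] upper_box_subset_norm_gt order_refl], where B="1 + R"])
    show "0 \<le> 1 + norm y \<and> 1 + norm y \<le> (1 + R) * 1" if "y \<in> upper_box c R" for y :: "'m space"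
      using that by (simp add: upper_box_def)
  qed
  have dE: "bounded_Ck n (upper_box c R) {()} (\<lambda>_ _. 1) (\<lambda>_. pd i laplace_kernel :: 'm space \<Rightarrow> real)"
    if "c > 0" for n c R i
    by (rule bounded_Ck_subset[OF bounded_Ck_pd_laplace_kernel[OF that] upper_box_subset_norm_gt order_refl])
  \<comment> \<open>The radius 1 is that of the half ball, so these sets exhaust the half cylinder
    as c decreases to 0.\<close>
  define T :: "real \<Rightarrow> ('m space \<times> real) set" where "T c = upper_box c 1 \<times> {0<..<1}" for c
  have T: "open (T c)" for c
    unfolding T_def by (intro open_Times open_upper_box) auto
  have conv: "bounded_Ck n (T c) {()} (\<lambda>_ _. 1)
      (\<lambda>_ q. LINT s|lebesgue. LINT y'|lebesgue. k (fst q - (y', 0)) (snd q - s) * g j y' s)"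
    if "admissible_kernel k" "c > 0" for n c k j
    unfolding T_def g_eq
    by (rule bounded_Ck_convolution[OF that(1) gS_integrable gS_Y gT gT_0' that(2)])
  have inst: "bounded_Ck n (T c) {()} (\<lambda>_ _. 1)
      (\<lambda>_ q. LINT y'|lebesgue. k (fst q - (y', 0)) * g j y' (snd q))"
    if "\<And>n c R. c > 0 \<Longrightarrow> bounded_Ck n (upper_box c R) {()} (\<lambda>_ _. 1) (\<lambda>_. k)" "k \<in> borel_measurable borel" "c > 0"
    for n c k j
    unfolding T_def g_eq
    by (rule bounded_Ck_instant_potential[OF that(1,2) gS_integrable gS_Y gT that(3)])
  note add = bounded_Ck_add[OF T] and scale = bounded_Ck_scale[OF T, where w="\<lambda>_ _. 1", simplified]
    and sum = bounded_Ck_sum[OF T finite, where w="\<lambda>_ _. 1", simplified]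

  have velocity: "bounded_Ck n (T c) {()} (\<lambda>_ _. 1) (\<lambda>_ q. stokes_velocity g i (fst q) (snd q))"
    if c: "c > 0" for n c i
  proof -
    have "bounded_Ck n (T c) {()} (\<lambda>_ _. 1) (\<lambda>_ q. \<Sum>j\<in>UNIV. LINT s|lebesgue. LINT y'|lebesgue.
        golovkin_regular i j (fst q - (y', 0)) (snd q - s) * g j y' s)"
      by (rule sum) (rule conv[OF admissible_kernel_golovkin_regular c])
    moreover have "bounded_Ck n (T c) {()} (\<lambda>_ _. 1)
      (\<lambda>_ q. (- 2) * (LINT y'|lebesgue. pd i laplace_kernel (fst q - (y', 0)) * g None y' (snd q)))"
      by (rule scale) (rule inst[OF dE pd_laplace_kernel_measurable c])
    ultimately show ?thesis
      unfolding stokes_velocity_def diff_conv_add_uminus minus_mult_left by (rule add)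
  qed

  have pressure: "bounded_Ck n (T c) {()} (\<lambda>_ _. 1) (\<lambda>_ q. stokes_pressure g (fst q) (snd q))"
    if c: "c > 0" for n c
  proof -
    define V where "V i q = (LINT y'|lebesgue. laplace_kernel (fst q - (y', 0)) * g i y' (snd q))"
      for i and q :: "'m space \<times> real"
    define H where "H j q = (LINT s|lebesgue. LINT y'|lebesgue.
      pd j (\<lambda>w. kernel_A w (snd q - s)) (fst q - (y', 0)) * g j y' s)" for j and q :: "'m space \<times> real"
    have V: "bounded_Ck n (T c) {()} (\<lambda>_ _. 1) (\<lambda>_. V i)" for n i
      unfolding V_def[abs_def] by (rule inst[OF E laplace_kernel_measurable c])
    have H: "bounded_Ck n (T c) {()} (\<lambda>_ _. 1) (\<lambda>_. H j)" for n j
      unfolding H_def[abs_def]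
      by (rule conv[OF admissible_kernel_pd[OF admissible_kernel_kernel_A] c])
    note slice = bounded_Ck_slice_pd[OF T]
    have V2: "bounded_Ck n (T c) {()} (\<lambda>_ _. 1) (\<lambda>_ q. pd i (pd None (\<lambda>z. V i (z, snd q))) (fst q))" for n i
    proof -
      \<comment> \<open>Each slice derivative uses up one order, so the inner derivative is needed
        at all orders before the next one is taken.\<close>
      have "bounded_Ck n (T c) {()} (\<lambda>_ _. 1) (\<lambda>_ q. pd None (\<lambda>z. V i (z, snd q)) (fst q))" for n
        by (rule slice[OF V])
      from slice[OF this, where n=n and j=i] show ?thesis by simp
    qed
    have H2: "bounded_Ck n (T c) {()} (\<lambda>_ _. 1) (\<lambda>_ q. pd (Some k) (pd (Some k) (\<lambda>z. H j (z, snd q))) (fst q))" for n j k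
    proof -
      have "bounded_Ck n (T c) {()} (\<lambda>_ _. 1) (\<lambda>_ q. pd (Some k) (\<lambda>z. H j (z, snd q)) (fst q))" for n
        by (rule slice[OF H])
      from slice[OF this, where n=n and j="Some k"] show ?thesis by simp
    qed
    have W: "bounded_Ck n (T c) {()} (\<lambda>_ _. 1)
      (\<lambda>_ q. LINT y'|lebesgue. laplace_kernel (fst q - (y', 0)) * deriv (g None y') (snd q))" for n
    proof -
      have "deriv (g None y') t = a None * gS None y' * deriv (gT None) t" for y' t
        unfolding g_eq[abs_def] by (intro DERIV_imp_deriv DERIV_cmult gT_deriv)
      moreover have "bounded_Ck n (T c) {()} (\<lambda>_ _. 1)
        (\<lambda>_ q. LINT y'|lebesgue. laplace_kernel (fst q - (y', 0)) * (a None * gS None y' * deriv (gT None) (snd q)))"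
        unfolding T_def
        by (rule bounded_Ck_instant_potential[OF E laplace_kernel_measurable gS_integrable gS_Y gT' c])
      ultimately show ?thesis by (simp only:)
    qed
    \<comment> \<open>The pressure with its differences written as sums with factors - 4 and - 1,
      the shape to which the closure rules apply.\<close>
    have "bounded_Ck n (T c) {()} (\<lambda>_ _. 1) (\<lambda>_ q.
      (2 * (\<Sum>i\<in>UNIV. pd i (pd None (\<lambda>z. V i (z, snd q))) (fst q))
      + 2 * (LINT y'|lebesgue. laplace_kernel (fst q - (y', 0)) * deriv (g None y') (snd q)))
      + (- 4) * (\<Sum>j\<in>UNIV. deriv (\<lambda>\<tau>. H j (fst q, \<tau>)) (snd q)
        + (- 1) * (\<Sum>k\<in>UNIV. pd (Some k) (pd (Some k) (\<lambda>z. H j (z, snd q))) (fst q))))"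
      by (intro add sum scale V2 W H2 bounded_Ck_slice_deriv[OF T H])
    then show ?thesis
      by (simp add: stokes_pressure_def V_def H_def tangential_laplacian_def Let_def)
  qed

  \<comment> \<open>Half the height of a point above the boundary gives an admissible c whose set
    \<open>T c\<close> is a neighbourhood of the point, valid for all orders.\<close>
  have mem: "fst q \<in> upper_box (snd (fst q) / 2) 1 \<and> snd q \<in> {0<..<1} \<and> snd (fst q) / 2 > 0"
    if "q \<in> half_cylinder" for q :: "'m space \<times> real"
    using that by (auto simp: half_cylinder_def half_ball_def upper_box_def)
  show ?thesis
  proof (intro conjI allI)
    show "smooth_on half_cylinder (\<lambda>(x, t). stokes_velocity g i x t)" for i
    proof (rule smooth_onI)
      fix q :: "'m space \<times> real" assume "q \<in> half_cylinder"
      then have q: "q \<in> T (snd (fst q) / 2)" "snd (fst q) / 2 > 0"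
        using mem[of q] by (auto simp: T_def mem_Times_iff)
      show "\<exists>S. open S \<and> q \<in> S \<and> (\<forall>k. bounded_Ck k S {()} (\<lambda>_ _. 1) (\<lambda>_. \<lambda>(x, t). stokes_velocity g i x t))"
        using T q(1) velocity[OF q(2)] by (intro exI[of _ "T (snd (fst q) / 2)"]) (simp add: case_prod_unfold)
    qed
    show "smooth_on half_cylinder (\<lambda>(x, t). stokes_pressure g x t)"
    proof (rule smooth_onI)
      fix q :: "'m space \<times> real" assume "q \<in> half_cylinder"
      then have q: "q \<in> T (snd (fst q) / 2)" "snd (fst q) / 2 > 0"
        using mem[of q] by (auto simp: T_def mem_Times_iff)
      show "\<exists>S. open S \<and> q \<in> S \<and> (\<forall>k. bounded_Ck k S {()} (\<lambda>_ _. 1) (\<lambda>_. \<lambda>(x, t). stokes_pressure g x t))"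
        using T q(1) pressure[OF q(2)] by (intro exI[of _ "T (snd (fst q) / 2)"]) (simp add: case_prod_unfold)
    qed
  qed
qed

end
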